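(* Let $\ell$ be a positive integer and let $\overline{\lambda}=(\ell_2,\ldots,\ell_m)$, $\ell_2\ge\cdots\ge\ell_m$, be an integer partition of $\ell$. For every integer $k\ge\ell$ let $n_k$ be any integer satisfying $n_k\ge k+\ell_2$, and let $\overline{\lambda}+(n_k-\ell)$ be the integer partition of $n_k$ obtained by adding the part $n_k-\ell$ to $\overline{\lambda}$, i.e. the partition $(n_k-\ell,\ell_2,\ldots,\ell_m)$. Then, as formal power series in $x$, $$\sum_{k\ge\ell}{\chi^{(n_k-1,1)}}^{\otimes k}\big|_{\chi^{\overline{\lambda}+(n_k-\ell)}}\;\frac{x^k}{k!}=\frac{f^{\overline{\lambda}}}{\ell!}\,e^{p(x)}\,(e^x-1)^{\ell},$$ where $p(x)=e^x-x-1$ and $f^{\overline{\lambda}}$ is the number of standard tableaux of shape $\overline{\lambda}$.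
   Context: $\chi^\lambda$ denotes the irreducible character of the symmetric group $S_n$ indexed by $\lambda\vdash n$; $\chi^{\otimes k}$ is the $k$-th Kronecker (pointwise) power, and $\chi|_{\chi^\lambda}$ is the multiplicity of $\chi^\lambda$ in the character $\chi$. *)

theory Defs
  imports
    "HOL-Algebra.Sym_Groups"
    "HOL-Computational_Algebra.Formal_Power_Series"
    "HOL-Library.Function_Algebras"
    "HOL-Library.FuncSet"
    Complex_Main
begin

definition int_partitions :: "nat \<Rightarrow> nat list set" where
  "int_partitions n = {\<mu>. sorted_wrt (\<ge>) \<mu> \<and> 0 \<notin> set \<mu> \<and> sum_list \<mu> = n}"

definition cells :: "nat list \<Rightarrow> (nat \<times> nat) set" where
  "cells \<mu> = {(i, j). i < length \<mu> \<and> j < \<mu> ! i}"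

text \<open>Tableaux are taken to be \<^const>\<open>undefined\<close> outside the diagram, so that the set of
  tableaux of a given shape is finite and each tableau is counted once.\<close>

definition tableaux :: "nat list \<Rightarrow> (nat \<times> nat \<Rightarrow> nat) set" where
  "tableaux \<mu> = {t \<in> extensional (cells \<mu>). bij_betw t (cells \<mu>) {1..sum_list \<mu>}}"

definition standard_tableaux :: "nat list \<Rightarrow> (nat \<times> nat \<Rightarrow> nat) set" where
  "standard_tableaux \<mu> = {t \<in> tableaux \<mu>.
     (\<forall>i j j'. j < j' \<and> (i, j) \<in> cells \<mu> \<and> (i, j') \<in> cells \<mu> \<longrightarrow> t (i, j) < t (i, j')) \<and>
     (\<forall>i i' j. i < i' \<and> (i, j) \<in> cells \<mu> \<and> (i', j) \<in> cells \<mu> \<longrightarrow> t (i, j) < t (i', j))}"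

definition num_standard_tableaux :: "nat list \<Rightarrow> nat" where
  "num_standard_tableaux \<mu> = card (standard_tableaux \<mu>)"

text \<open>The complex vector space of functions on an arbitrary set, with pointwise operations.\<close>

definition cscale :: "complex \<Rightarrow> ('a \<Rightarrow> complex) \<Rightarrow> 'a \<Rightarrow> complex" where
  "cscale c f = (\<lambda>x. c * f x)"

global_interpretation cfun: vector_space "cscale :: complex \<Rightarrow> ('a \<Rightarrow> complex) \<Rightarrow> 'a \<Rightarrow> complex"
  by unfold_locales (auto simp: cscale_def fun_eq_iff algebra_simps)

text \<open>The trace of a linear map that leaves the finite-dimensional subspace \<open>V\<close> invariant,
  restricted to \<open>V\<close>: the sum of the diagonal entries with respect to some basis of \<open>V\<close>.\<close>

definition trace_on :: "('a \<Rightarrow> complex) set \<Rightarrow> (('a \<Rightarrow> complex) \<Rightarrow> ('a \<Rightarrow> complex)) \<Rightarrow> complex" where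
  "trace_on V T =
     (let B = (SOME B. cfun.independent B \<and> cfun.span B = V)
      in \<Sum>b\<in>B. cfun.representation B (T b) b)"

text \<open>A tabloid, that is, a tableau up to permutations of the entries within each row, is
  recorded as the sequence of the sets of entries of its rows. Vectors of the permutation
  module are complex-valued functions on tabloids.\<close>

type_synonym tabloid = "nat \<Rightarrow> nat set"

definition tabloid_of :: "nat list \<Rightarrow> (nat \<times> nat \<Rightarrow> nat) \<Rightarrow> tabloid" where
  "tabloid_of \<mu> t = (\<lambda>i. t ` {c \<in> cells \<mu>. fst c = i})"

definition column_stabilizer :: "nat list \<Rightarrow> (nat \<times> nat \<Rightarrow> nat) \<Rightarrow> (nat \<Rightarrow> nat) set" where
  "column_stabilizer \<mu> t = {\<pi> \<in> carrier (sym_group (sum_list \<mu>)).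
     \<forall>j. \<pi> ` (t ` {c \<in> cells \<mu>. snd c = j}) = t ` {c \<in> cells \<mu>. snd c = j}}"

definition polytabloid :: "nat list \<Rightarrow> (nat \<times> nat \<Rightarrow> nat) \<Rightarrow> tabloid \<Rightarrow> complex" where
  "polytabloid \<mu> t = (\<lambda>R. \<Sum>\<pi>\<in>column_stabilizer \<mu> t.
     if R = tabloid_of \<mu> (\<pi> \<circ> t) then of_int (sign \<pi>) else 0)"

definition specht_module :: "nat list \<Rightarrow> (tabloid \<Rightarrow> complex) set" where
  "specht_module \<mu> = cfun.span (polytabloid \<mu> ` tableaux \<mu>)"

text \<open>A permutation \<open>\<sigma>\<close> acts on tabloids by applying \<open>\<sigma>\<close> to all entries, and on functions by
  \<open>(\<sigma> f) R = f (\<sigma>\<inverse> R)\<close>; for bijective \<open>\<sigma>\<close>, the image under \<open>\<sigma>\<inverse>\<close> is the preimage under \<open>\<sigma>\<close>.\<close>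

definition perm_act :: "(nat \<Rightarrow> nat) \<Rightarrow> (tabloid \<Rightarrow> complex) \<Rightarrow> tabloid \<Rightarrow> complex" where
  "perm_act \<sigma> f = (\<lambda>R. f (\<lambda>i. \<sigma> -` R i))"

text \<open>The irreducible character of the symmetric group on \<open>{1..sum_list \<mu>}\<close> indexed by the
  partition \<open>\<mu>\<close> is the character of the Specht module of \<open>\<mu>\<close>.\<close>

definition irr_char :: "nat list \<Rightarrow> (nat \<Rightarrow> nat) \<Rightarrow> complex" where
  "irr_char \<mu> \<sigma> = trace_on (specht_module \<mu>) (perm_act \<sigma>)"

definition kronecker_power :: "((nat \<Rightarrow> nat) \<Rightarrow> complex) \<Rightarrow> nat \<Rightarrow> (nat \<Rightarrow> nat) \<Rightarrow> complex" where
  "kronecker_power \<chi> k = (\<lambda>\<sigma>. \<chi> \<sigma> ^ k)"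

text \<open>The multiplicity of \<open>irr_char \<mu>\<close> in a character \<open>\<chi>\<close> of the symmetric group on \<open>{1..n}\<close>:
  its coefficient in the decomposition of \<open>\<chi>\<close> into irreducible characters.\<close>

definition decomposes :: "nat \<Rightarrow> ((nat \<Rightarrow> nat) \<Rightarrow> complex) \<Rightarrow> (nat list \<Rightarrow> nat) \<Rightarrow> bool" where
  "decomposes n \<chi> m \<longleftrightarrow> (\<forall>\<sigma>\<in>carrier (sym_group n).
     \<chi> \<sigma> = (\<Sum>\<mu>\<in>int_partitions n. of_nat (m \<mu>) * irr_char \<mu> \<sigma>))"

definition multiplicity_in :: "nat \<Rightarrow> nat list \<Rightarrow> ((nat \<Rightarrow> nat) \<Rightarrow> complex) \<Rightarrow> nat" where
  "multiplicity_in n \<mu> \<chi> = (THE c. \<exists>m. decomposes n \<chi> m \<and> m \<mu> = c)"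

end

theory Submission
  imports Defs
begin

text \<open>
  Every Specht module carries an explicit equivariant orthogonal projection, a multiple of the sum
  of the outer products of its polytabloids; its trace against a permutation is the irreducible
  character. A function on tabloids that is antisymmetric under the column stabilizer of a tableau
  is a multiple of the polytabloid or zero, which gives Schur's lemma for these projections and
  hence orthonormality of the characters. For the branching rule, each partition \<open>\<mu>\<close> below \<open>\<kappa>\<close>
  in Young's lattice yields a nonzero intertwiner, so the dimensions satisfy
  \<open>d \<kappa> \<ge> (\<Sum>\<mu>. d \<mu>)\<close>; since the squared dimensions sum to at most \<open>n!\<close> and the squared numbers of
  standard tableaux sum to exactly \<open>n!\<close>, equality holds throughout.

  Induction after restriction multiplies a character by the number of fixed points
  \<open>fix = \<chi>\<^bsup>(n-1,1)\<^esup> + 1\<close>. Hence all Kronecker powers decompose with natural coefficients, and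
  \<open>\<langle>fix\<^bsup>j\<^esup>, \<chi>\<^bsup>\<kappa>\<^esup>\<rangle>\<close> obeys a recursion over the partitions below \<open>\<kappa>\<close>. For
  \<open>\<kappa> = (n - l, \<lambda>\<^sub>2, \<dots>)\<close> one removes a cell either from the first row or from the rest; this is
  the coefficient form of \<open>E\<^sub>l' = e\<^sup>x (E\<^sub>l + E\<^bsub>l-1\<^esub>)\<close>, which is solved by
  \<open>E\<^sub>l = e\<^sup>x e\<^bsup>p(x)\<^esup> (e\<^sup>x - 1)\<^bsup>l\<^esup> / l!\<close>. Passing from \<open>fix\<close> to \<open>fix - 1\<close> removes the factor \<open>e\<^sup>x\<close>.
\<close>

section \<open>Tabloids and column stabilizers\<close>

text \<open>\<open>irr_char\<close> is a trace with respect to an unspecified basis and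
  \<open>multiplicity_in\<close> a definite description, so neither can be computed with directly.
  Replacing a module by its projection matrix turns both into finite sums: a trace becomes a
  diagonal sum over tabloids, Schur's lemma an identity of matrix products, and a coefficient an
  inner product.

  The branching rule is a squeeze, because intertwiners bound the restriction only from below. The
  bound from above is global: Bessel's inequality for the regular character limits the sum of
  squared dimensions, and the relation between upper and lower covers in Young's lattice evaluates
  the same sum for standard tableaux.

  The hypothesis \<open>k + hd lb \<le> n k\<close> marks the stable range: each factor
  \<open>fix\<close> lowers the degree and the exponent together, so the first row stays long enough
  for every cover that the recursion visits, except where the coefficient in question is zero. The
  range contains all exponents up to \<open>k\<close> and therefore survives the binomial expansion
  of \<open>(fix - 1)^k\<close>.\<close>

lemma sum_list_eq_card_cells: "sum_list \<mu> = card (cells \<mu>)"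
  and finite_cells [simp]: "finite (cells \<mu>)"
proof -
  have eq: "cells \<mu> = Sigma {..<length \<mu>} (\<lambda>i. {..<\<mu> ! i})"
    by (auto simp: cells_def)
  show "finite (cells \<mu>)" unfolding eq by (intro finite_SigmaI) auto
  show "sum_list \<mu> = card (cells \<mu>)"
    unfolding eq by (simp add: sum_list_sum_nth atLeast0LessThan)
qed

lemma cells_down:
  assumes "\<mu> \<in> int_partitions n" "(i, j) \<in> cells \<mu>" "i' \<le> i" "j' \<le> j"
  shows "(i', j') \<in> cells \<mu>"
proof -
  have "sorted_wrt (\<ge>) \<mu>" using assms by (simp add: int_partitions_def)
  then have "\<mu> ! i \<le> \<mu> ! i'" if "i' < i"
    using assms that by (auto simp: cells_def sorted_wrt_iff_nth_less)
  then show ?thesis using assms by (cases "i' = i") (auto simp: cells_def)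
qed

lemma card_row: "card {c \<in> cells \<mu>. fst c = i} = (if i < length \<mu> then \<mu> ! i else 0)"
proof -
  have "{c \<in> cells \<mu>. fst c = i} = (if i < length \<mu> then Pair i ` {..<\<mu> ! i} else {})"
    by (auto simp: cells_def)
  then show ?thesis by (auto simp: card_image inj_on_def)
qed

text \<open>Row counts are the parts padded with zeros. As zero parts are excluded, the first
  vanishing count recovers the length.\<close>

lemma int_partitions_eqI:
  assumes "\<kappa> \<in> int_partitions n" "\<mu> \<in> int_partitions m"
    and "\<And>i. card {c \<in> cells \<kappa>. fst c = i} = card {c \<in> cells \<mu>. fst c = i}"
  shows "\<kappa> = \<mu>"
proof -
  have nz: "\<nu> ! i > 0" if "\<nu> \<in> int_partitions k" "i < length \<nu>" for \<nu> k i
    using that nth_mem[of i \<nu>] by (metis (mono_tags, lifting) gr0I int_partitions_def mem_Collect_eq)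
  have eq: "(if i < length \<kappa> then \<kappa> ! i else 0) = (if i < length \<mu> then \<mu> ! i else 0)" for i
    using assms(3)[of i] by (simp add: card_row)
  have len: "length \<kappa> = length \<mu>"
  proof (rule ccontr)
    assume "length \<kappa> \<noteq> length \<mu>"
    then consider "length \<kappa> < length \<mu>" | "length \<mu> < length \<kappa>" by linarith
    then show False
    proof cases
      case 1 then show False using eq[of "length \<kappa>"] nz[OF assms(2) 1] by simp
    next
      case 2 then show False using eq[of "length \<mu>"] nz[OF assms(1) 2] by simp
    qed
  qed
  show ?thesis
    using len eq by (intro nth_equalityI) (metis+)
qed

lemma finite_int_partitions [simp]: "finite (int_partitions n)"
proof -
  have "length xs \<le> sum_list xs" if "0 \<notin> set xs" for xs :: "nat list"
    using that by (induction xs) auto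
  then have "int_partitions n \<subseteq> {xs. set xs \<subseteq> {..n} \<and> length xs \<le> n}"
    using member_le_sum_list by (fastforce simp: int_partitions_def)
  then show ?thesis by (rule finite_subset) (rule finite_lists_length_le, simp)
qed

section \<open>Permutations acting on tabloids and tableaux\<close>

abbreviation perms :: "nat \<Rightarrow> (nat \<Rightarrow> nat) set" where
  "perms n \<equiv> {p. p permutes {1..n}}"

lemma carrier_sym_group: "carrier (sym_group n) = perms n"
  by (simp add: sym_group_def)

lemma finite_perms [simp]: "finite (perms n)"
  by (simp add: finite_permutations)

lemma card_perms [simp]: "card (perms n) = fact n"
  by (simp add: card_permutations)

text \<open>Preimages are the form in which \<open>perm_act\<close> transforms tabloids. They give a
  right action, so compositions are reversed.\<close>

definition pullback :: "(nat \<Rightarrow> nat) \<Rightarrow> tabloid \<Rightarrow> tabloid" where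
  "pullback \<sigma> R = (\<lambda>i. \<sigma> -` R i)"

lemma pullback_comp: "pullback (\<sigma> \<circ> \<tau>) R = pullback \<tau> (pullback \<sigma> R)"
  by (simp add: pullback_def vimage_comp)

lemma pullback_id [simp]: "pullback id R = R"
  by (simp add: pullback_def)

lemma pullback_inv:
  assumes "\<sigma> permutes S"
  shows "pullback (inv' \<sigma>) (pullback \<sigma> R) = R" "pullback \<sigma> (pullback (inv' \<sigma>) R) = R"
  using permutes_inv_o[OF assms] by (simp_all flip: pullback_comp)

lemma perm_act_pullback: "perm_act \<sigma> f R = f (pullback \<sigma> R)"
  by (simp add: perm_act_def pullback_def)

text \<open>Later arguments compare the row of an entry in one tableau with its column in another,
  so tableaux are mostly handled through their inverses.\<close>

definition position :: "nat list \<Rightarrow> (nat \<times> nat \<Rightarrow> nat) \<Rightarrow> nat \<Rightarrow> nat \<times> nat" where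
  "position \<mu> t = inv_into (cells \<mu>) t"

lemma tableaux_bij: "t \<in> tableaux \<mu> \<Longrightarrow> bij_betw t (cells \<mu>) {1..sum_list \<mu>}"
  by (simp add: tableaux_def)

lemma position_bij: "t \<in> tableaux \<mu> \<Longrightarrow> bij_betw (position \<mu> t) {1..sum_list \<mu>} (cells \<mu>)"
  unfolding position_def by (intro bij_betw_inv_into tableaux_bij)

lemma position_tableau [simp]:
  assumes "t \<in> tableaux \<mu>"
  shows "c \<in> cells \<mu> \<Longrightarrow> position \<mu> t (t c) = c"
    and "x \<in> {1..sum_list \<mu>} \<Longrightarrow> t (position \<mu> t x) = x"
  using tableaux_bij[OF assms] unfolding position_def
  by (auto simp: bij_betw_inv_into_left bij_betw_inv_into_right)

lemma tableau_image:
  assumes "t \<in> tableaux \<mu>"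
  shows "t ` {c \<in> cells \<mu>. Q c} = {x \<in> {1..sum_list \<mu>}. Q (position \<mu> t x)}"
proof -
  have "x \<in> t ` {c \<in> cells \<mu>. Q c}" if "x \<in> {1..sum_list \<mu>}" "Q (position \<mu> t x)" for x
    using that position_tableau(2)[OF assms that(1)] bij_betwE[OF position_bij[OF assms]]
    by (metis (mono_tags, lifting) imageI mem_Collect_eq)
  then show ?thesis using bij_betwE[OF tableaux_bij[OF assms]] assms by fastforce
qed

lemma tabloid_of_eq:
  assumes "t \<in> tableaux \<mu>"
  shows "tabloid_of \<mu> t i = {x \<in> {1..sum_list \<mu>}. fst (position \<mu> t x) = i}"
  unfolding tabloid_of_def using tableau_image[OF assms] .

text \<open>Preserving the column of each entry is enough: an injective map of a finite column into
  itself is onto.\<close>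

lemma column_stabilizer_iff:
  assumes "t \<in> tableaux \<mu>"
  shows "\<pi> \<in> column_stabilizer \<mu> t \<longleftrightarrow> \<pi> permutes {1..sum_list \<mu>} \<and>
    (\<forall>x \<in> {1..sum_list \<mu>}. snd (position \<mu> t (\<pi> x)) = snd (position \<mu> t x))"
    (is "?l \<longleftrightarrow> ?p \<and> ?c")
proof -
  let ?N = "{1..sum_list \<mu>}"
  let ?q = "\<lambda>x. snd (position \<mu> t x)"
  have "?l \<longleftrightarrow> ?p \<and> (\<forall>j. \<pi> ` {x \<in> ?N. ?q x = j} = {x \<in> ?N. ?q x = j})"
    by (simp add: column_stabilizer_def carrier_sym_group tableau_image[OF assms])
  also have "\<dots> \<longleftrightarrow> ?p \<and> ?c"
  proof (intro conj_cong refl iffI)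
    assume p: ?p and *: "\<forall>j. \<pi> ` {x \<in> ?N. ?q x = j} = {x \<in> ?N. ?q x = j}"
    show ?c
    proof
      fix x assume "x \<in> ?N"
      then have "\<pi> x \<in> \<pi> ` {y \<in> ?N. ?q y = ?q x}" by blast
      then show "?q (\<pi> x) = ?q x" using * by blast
    qed
  next
    assume p: ?p and c: ?c
    show "\<forall>j. \<pi> ` {x \<in> ?N. ?q x = j} = {x \<in> ?N. ?q x = j}"
    proof
      fix j
      have "\<pi> ` {x \<in> ?N. ?q x = j} \<subseteq> {x \<in> ?N. ?q x = j}"
        using c permutes_in_image[OF p] by auto
      moreover have "card (\<pi> ` {x \<in> ?N. ?q x = j}) = card {x \<in> ?N. ?q x = j}"
        using permutes_inj[OF p] by (intro card_image) (auto simp: inj_on_def)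
      ultimately show "\<pi> ` {x \<in> ?N. ?q x = j} = {x \<in> ?N. ?q x = j}"
        by (intro card_subset_eq) auto
    qed
  qed
  finally show ?thesis .
qed

lemma finite_column_stabilizer [simp]: "finite (column_stabilizer \<mu> t)"
  by (rule finite_subset[OF _ finite_perms[of "sum_list \<mu>"]])
    (auto simp: column_stabilizer_def carrier_sym_group)

definition tabloids :: "nat list \<Rightarrow> tabloid set" where
  "tabloids \<mu> = tabloid_of \<mu> ` tableaux \<mu>"

lemma finite_tableaux [simp]: "finite (tableaux \<mu>)"
proof -
  have "tableaux \<mu> \<subseteq> cells \<mu> \<rightarrow>\<^sub>E {1..sum_list \<mu>}"
    by (auto simp: tableaux_def PiE_def dest: bij_betwE)
  then show ?thesis by (rule finite_subset) (simp add: finite_PiE)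
qed

lemma finite_tabloids [simp]: "finite (tabloids \<mu>)"
  by (simp add: tabloids_def)

lemma tableaux_nonempty: "tableaux \<mu> \<noteq> {}"
proof -
  obtain f where f: "bij_betw f (cells \<mu>) {1..sum_list \<mu>}"
    using finite_same_card_bij[of "cells \<mu>" "{1..sum_list \<mu>}"] sum_list_eq_card_cells[of \<mu>]
    by fastforce
  then have "restrict f (cells \<mu>) \<in> tableaux \<mu>"
    using bij_betw_cong[of "cells \<mu>" f "restrict f (cells \<mu>)" "{1..sum_list \<mu>}"]
    by (simp add: tableaux_def)
  then show ?thesis by blast
qed

text \<open>The restriction keeps the moved tableau extensional, hence in
  \<open>tableaux \<mu>\<close>; the tabloid is the same as that of
  \<open>\<sigma> \<circ> t\<close>.\<close>

definition move :: "nat list \<Rightarrow> (nat \<Rightarrow> nat) \<Rightarrow> (nat \<times> nat \<Rightarrow> nat) \<Rightarrow> nat \<times> nat \<Rightarrow> nat" where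
  "move \<mu> \<sigma> t = restrict (\<sigma> \<circ> t) (cells \<mu>)"

lemma move_tableaux:
  assumes "t \<in> tableaux \<mu>" "\<sigma> permutes {1..sum_list \<mu>}"
  shows "move \<mu> \<sigma> t \<in> tableaux \<mu>"
proof -
  have "bij_betw (\<sigma> \<circ> t) (cells \<mu>) {1..sum_list \<mu>}"
    using bij_betw_trans[OF tableaux_bij[OF assms(1)] permutes_imp_bij[OF assms(2)]] .
  then show ?thesis
    using bij_betw_cong[of "cells \<mu>" "\<sigma> \<circ> t" "move \<mu> \<sigma> t" "{1..sum_list \<mu>}"]
    by (simp add: tableaux_def move_def)
qed

lemma tabloid_of_comp: "tabloid_of \<mu> (\<sigma> \<circ> t) i = \<sigma> ` tabloid_of \<mu> t i"
  by (auto simp: tabloid_of_def)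

text \<open>Translates the image form in the definition of \<open>polytabloid\<close> into
  pullbacks.\<close>

lemma eq_tabloid_of_comp_iff:
  assumes "\<sigma> permutes S"
  shows "R = tabloid_of \<mu> (\<sigma> \<circ> t) \<longleftrightarrow> pullback \<sigma> R = tabloid_of \<mu> t"
proof -
  have "R i = \<sigma> ` U \<longleftrightarrow> \<sigma> -` R i = U" for i U
    using permutes_inj[OF assms] permutes_surj[OF assms] by (metis inj_vimage_image_eq surj_image_vimage_eq)
  then show ?thesis by (auto simp: fun_eq_iff tabloid_of_comp pullback_def)
qed

lemma tabloid_of_move: "tabloid_of \<mu> (move \<mu> \<sigma> t) = tabloid_of \<mu> (\<sigma> \<circ> t)"
  by (auto simp: tabloid_of_def move_def fun_eq_iff)

lemma pullback_tabloids:
  assumes "\<sigma> permutes {1..sum_list \<mu>}"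
  shows "R \<in> tabloids \<mu> \<Longrightarrow> pullback \<sigma> R \<in> tabloids \<mu>"
    and "pullback \<sigma> R \<in> tabloids \<mu> \<longleftrightarrow> R \<in> tabloids \<mu>"
proof -
  have *: "pullback \<sigma> R \<in> tabloids \<mu>" if R: "R \<in> tabloids \<mu>" and \<sigma>: "\<sigma> permutes {1..sum_list \<mu>}" for \<sigma> R
  proof -
    obtain t where t: "t \<in> tableaux \<mu>" "R = tabloid_of \<mu> t" using R by (auto simp: tabloids_def)
    have i: "inv' \<sigma> permutes {1..sum_list \<mu>}" by (rule permutes_inv[OF \<sigma>])
    have "pullback \<sigma> R = tabloid_of \<mu> (inv' \<sigma> \<circ> t)"
      by (simp add: eq_tabloid_of_comp_iff[OF i] pullback_inv[OF \<sigma>] t)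
    then show ?thesis using move_tableaux[OF t(1) i]
      by (metis tabloid_of_move tabloids_def imageI)
  qed
  show "R \<in> tabloids \<mu> \<Longrightarrow> pullback \<sigma> R \<in> tabloids \<mu>" using * assms by blast
  show "pullback \<sigma> R \<in> tabloids \<mu> \<longleftrightarrow> R \<in> tabloids \<mu>"
    using *[OF _ assms] *[OF _ permutes_inv[OF assms], of "pullback \<sigma> R"] pullback_inv[OF assms] by auto
qed

lemma pullback_tabloids_bij:
  assumes "\<sigma> permutes {1..sum_list \<mu>}"
  shows "bij_betw (pullback \<sigma>) (tabloids \<mu>) (tabloids \<mu>)"
  by (rule bij_betw_byWitness[where f' = "pullback (inv' \<sigma>)"])
    (use assms permutes_inv[OF assms] in \<open>auto simp: pullback_inv[OF assms] pullback_tabloids(1)\<close>)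

lemma position_move:
  assumes t: "t \<in> tableaux \<mu>" and s: "\<sigma> permutes {1..sum_list \<mu>}" and x: "x \<in> {1..sum_list \<mu>}"
  shows "position \<mu> (move \<mu> \<sigma> t) (\<sigma> x) = position \<mu> t x"
proof -
  have c: "position \<mu> t x \<in> cells \<mu>" using bij_betwE[OF position_bij[OF t]] x by blast
  have "move \<mu> \<sigma> t (position \<mu> t x) = \<sigma> x"
    using c t x by (simp add: move_def)
  then show ?thesis using position_tableau(1)[OF move_tableaux[OF t s] c] by simp
qed

text \<open>A column of height \<open>h\<close> has \<open>min k h\<close> cells in the first \<open>k\<close> rows, and no injective
  redistribution of its entries over rows can place more of them there.\<close>

lemma column_count_le:
  assumes mu: "\<mu> \<in> int_partitions n" and t: "t \<in> tableaux \<mu>"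
    and inj: "inj_on (\<lambda>x. (r x, snd (position \<mu> t x))) {1..n}"
  shows "card {x \<in> {1..n}. snd (position \<mu> t x) = j \<and> r x < (k::nat)}
       \<le> card {x \<in> {1..n}. snd (position \<mu> t x) = j \<and> fst (position \<mu> t x) < k}"
    (is "card ?A \<le> card ?B")
proof (cases "\<forall>i<k. (i, j) \<in> cells \<mu>")
  case True
  have n: "sum_list \<mu> = n" using mu by (simp add: int_partitions_def)
  have "card ?A \<le> card {..<k}"
  proof (rule card_inj_on_le[where f = r])
    show "inj_on r ?A"
    proof (rule inj_onI)
      fix x y assume "x \<in> ?A" "y \<in> ?A" "r x = r y"
      then show "x = y" by (intro inj_onD[OF inj]) auto
    qed
  qed auto
  also have "\<dots> \<le> card ?B"
  proof (rule card_inj_on_le[where f = "\<lambda>i. t (i, j)"])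
    show "inj_on (\<lambda>i. t (i, j)) {..<k}"
      using True by (intro inj_onI) (auto dest: inj_onD[OF bij_betw_imp_inj_on[OF tableaux_bij[OF t]]])
    show "(\<lambda>i. t (i, j)) ` {..<k} \<subseteq> ?B"
      using True t bij_betwE[OF tableaux_bij[OF t]] by (auto simp: n)
  qed simp
  finally show ?thesis .
next
  case False
  then obtain i where i: "i < k" "(i, j) \<notin> cells \<mu>" by blast
  have n: "sum_list \<mu> = n" using mu by (simp add: int_partitions_def)
  have "fst (position \<mu> t x) < k" if "x \<in> {1..n}" "snd (position \<mu> t x) = j" for x
  proof -
    have "(fst (position \<mu> t x), j) \<in> cells \<mu>"
      using that bij_betwE[OF position_bij[OF t]] n by fastforce
    then show ?thesis using i cells_down[OF mu, of "fst (position \<mu> t x)" j i j] by linarith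
  qed
  then show ?thesis by (intro card_mono) auto
qed

text \<open>Comparing \<open>top_rows\<close> for all \<open>k\<close> is the dominance order on partitions.\<close>

definition top_rows :: "nat list \<Rightarrow> nat \<Rightarrow> nat" where
  "top_rows \<mu> k = card {c \<in> cells \<mu>. fst c < k}"

lemma top_rows_tableau:
  assumes t: "t \<in> tableaux \<mu>" and n: "sum_list \<mu> = n"
  shows "top_rows \<mu> k = card {x \<in> {1..n}. fst (position \<mu> t x) < k}"
proof -
  have "card {c \<in> cells \<mu>. fst c < k} = card (t ` {c \<in> cells \<mu>. fst c < k})"
    using bij_betw_imp_inj_on[OF tableaux_bij[OF t]]
    by (intro card_image[symmetric]) (auto simp: inj_on_def)
  then show ?thesis by (simp add: tableau_image[OF t] top_rows_def n)
qed

lemma card_level_set: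
  fixes f :: "'a \<Rightarrow> nat"
  assumes "finite A"
  shows "card {x \<in> A. f x = i} = card {x \<in> A. f x < Suc i} - card {x \<in> A. f x < i}"
proof -
  have "{x \<in> A. f x = i} = {x \<in> A. f x < Suc i} - {x \<in> A. f x < i}" by auto
  moreover have "card ({x \<in> A. f x < Suc i} - {x \<in> A. f x < i})
      = card {x \<in> A. f x < Suc i} - card {x \<in> A. f x < i}"
    using assms by (intro card_Diff_subset) auto
  ultimately show ?thesis by (rule ssubst)
qed

text \<open>Successive differences of \<open>top_rows\<close> are row lengths, so dominance is
  antisymmetric.\<close>

lemma top_rows_antisym:
  assumes "\<kappa> \<in> int_partitions n" "\<mu> \<in> int_partitions m"
    and "\<And>k. top_rows \<kappa> k \<le> top_rows \<mu> k" "\<And>k. top_rows \<mu> k \<le> top_rows \<kappa> k"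
  shows "\<kappa> = \<mu>"
proof (rule int_partitions_eqI[OF assms(1,2)])
  fix i
  have eq: "top_rows \<kappa> k = top_rows \<mu> k" for k using assms(3,4) le_antisym by blast
  have "card {c \<in> cells \<nu>. fst c = i} = top_rows \<nu> (Suc i) - top_rows \<nu> i" for \<nu>
    using card_level_set[of "cells \<nu>" fst i] by (simp add: top_rows_def)
  then show "card {c \<in> cells \<kappa>. fst c = i} = card {c \<in> cells \<mu>. fst c = i}" using eq by simp
qed

lemma sum_card_columns:
  fixes c :: "nat \<Rightarrow> nat"
  shows "(\<Sum>j\<in>c ` {1..n}. card {x \<in> {1..n}. c x = j \<and> Q x}) = card {x \<in> {1..n}. Q x}"
proof -
  have "{x \<in> {1..n}. Q x} = (\<Union>j\<in>c ` {1..n}. {x \<in> {1..n}. c x = j \<and> Q x})" by auto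
  also have "card \<dots> = (\<Sum>j\<in>c ` {1..n}. card {x \<in> {1..n}. c x = j \<and> Q x})"
    by (rule card_UN_disjoint) auto
  finally show ?thesis ..
qed

text \<open>The dominance lemma. The injectivity hypothesis says that entries sharing a row of
  \<open>s\<close> lie in different columns of \<open>t\<close>; the bound for a single column is
  then summed over the columns of \<open>t\<close>.\<close>

lemma top_rows_le:
  assumes la: "\<kappa> \<in> int_partitions n" and mu: "\<mu> \<in> int_partitions n"
    and s: "s \<in> tableaux \<kappa>" and t: "t \<in> tableaux \<mu>"
    and inj: "inj_on (\<lambda>x. (fst (position \<kappa> s x), snd (position \<mu> t x))) {1..n}"
  shows "top_rows \<kappa> k \<le> top_rows \<mu> k"
proof -
  let ?c = "\<lambda>x. snd (position \<mu> t x)"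
  have n: "sum_list \<kappa> = n" "sum_list \<mu> = n" using la mu by (auto simp: int_partitions_def)
  have "(\<Sum>j\<in>?c ` {1..n}. card {x \<in> {1..n}. ?c x = j \<and> fst (position \<kappa> s x) < k})
     \<le> (\<Sum>j\<in>?c ` {1..n}. card {x \<in> {1..n}. ?c x = j \<and> fst (position \<mu> t x) < k})"
    by (intro sum_mono column_count_le[OF mu t inj])
  then show ?thesis
    unfolding sum_card_columns top_rows_tableau[OF s n(1)] top_rows_tableau[OF t n(2)] .
qed

text \<open>The equality case of the dominance lemma: in each column of \<open>t\<close>, the rows
  that the entries have in \<open>s\<close> are exactly the rows of that column, so sorting the
  entries of every column by these rows is a column permutation.\<close>

lemma column_straighten:
  assumes mu: "\<mu> \<in> int_partitions n"
    and s: "s \<in> tableaux \<mu>" and t: "t \<in> tableaux \<mu>"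
    and inj: "inj_on (\<lambda>x. (fst (position \<mu> s x), snd (position \<mu> t x))) {1..n}"
  shows "\<exists>\<rho>\<in>column_stabilizer \<mu> t. pullback \<rho> (tabloid_of \<mu> t) = tabloid_of \<mu> s"
proof -
  let ?c = "\<lambda>x. snd (position \<mu> t x)" and ?r = "\<lambda>x. fst (position \<mu> s x)"
  let ?q = "\<lambda>x. (?r x, ?c x)"
  have n: "sum_list \<mu> = n" using mu by (auto simp: int_partitions_def)
  have eq: "card {x \<in> {1..n}. ?c x = j \<and> ?r x < k}
    = card {x \<in> {1..n}. ?c x = j \<and> fst (position \<mu> t x) < k}" for j k
  proof (cases "j \<in> ?c ` {1..n}")
    case True
    \<comment> \<open>Both totals count the entries in the first \<open>k\<close> rows of a tableau
      of shape \<open>\<mu>\<close>, so none of the columnwise inequalities can be strict.\<close>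
    have "(\<Sum>j\<in>?c ` {1..n}. card {x \<in> {1..n}. ?c x = j \<and> ?r x < k})
     = (\<Sum>j\<in>?c ` {1..n}. card {x \<in> {1..n}. ?c x = j \<and> fst (position \<mu> t x) < k})"
      unfolding sum_card_columns using top_rows_tableau[OF s n] top_rows_tableau[OF t n] by simp
    then show ?thesis
      by (rule sum_mono_inv[OF _ column_count_le[OF mu t inj] True]) simp
  next
    case False
    then have "{x \<in> {1..n}. ?c x = j \<and> Q x} = {}" for Q by auto
    then show ?thesis by presburger
  qed
  \<comment> \<open>Level sets are differences of successive counts, so every cell is hit; equal
    cardinalities then make \<open>?q\<close> a bijection onto the diagram.\<close>
  have "cells \<mu> \<subseteq> ?q ` {1..n}"
  proof clarify
    fix i j assume ij: "(i, j) \<in> cells \<mu>"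
    have diff: "card {x \<in> {1..n}. ?c x = j \<and> f x = i}
      = card {x \<in> {1..n}. ?c x = j \<and> f x < Suc i} - card {x \<in> {1..n}. ?c x = j \<and> f x < i}"
      for f :: "nat \<Rightarrow> nat"
      using card_level_set[of "{x \<in> {1..n}. ?c x = j}" f i] by simp
    have "card {x \<in> {1..n}. ?c x = j \<and> ?r x = i}
       = card {x \<in> {1..n}. ?c x = j \<and> fst (position \<mu> t x) = i}"
      using diff[of ?r] diff[of "\<lambda>x. fst (position \<mu> t x)"] eq[of j "Suc i"] eq[of j i] by argo
    moreover have "t (i, j) \<in> {x \<in> {1..n}. ?c x = j \<and> fst (position \<mu> t x) = i}"
      using ij t bij_betwE[OF tableaux_bij[OF t]] n by auto
    moreover have "finite {x \<in> {1..n}. ?c x = j \<and> fst (position \<mu> t x) = i}" by simp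
    ultimately have "card {x \<in> {1..n}. ?c x = j \<and> ?r x = i} \<noteq> 0"
      using card_0_eq by (metis emptyE)
    then have "{x \<in> {1..n}. ?c x = j \<and> ?r x = i} \<noteq> {}"
      by (intro notI) (simp only: card.empty)
    then obtain x where "x \<in> {1..n}" "(i, j) = ?q x" by blast
    then show "(i, j) \<in> ?q ` {1..n}" by (rule image_eqI[rotated])
  qed
  moreover have "card (?q ` {1..n}) = card (cells \<mu>)"
    using card_image[OF inj] n by (simp add: sum_list_eq_card_cells)
  ultimately have "?q ` {1..n} = cells \<mu>"
    by (metis card_subset_eq finite_imageI finite_atLeastAtMost)
  then have q: "bij_betw ?q {1..n} (cells \<mu>)" using inj by (simp add: bij_betw_def)
  \<comment> \<open>\<open>\<rho>\<close> sends an entry to the one that \<open>t\<close> has in the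
    same column, at the row which the entry has in \<open>s\<close>.\<close>
  define \<rho> where "\<rho> x = (if x \<in> {1..n} then t (?q x) else x)" for x
  have "bij_betw (t \<circ> ?q) {1..n} {1..n}"
    using bij_betw_trans[OF q] tableaux_bij[OF t] n by simp
  moreover have "bij_betw \<rho> {1..n} {1..n} = bij_betw (t \<circ> ?q) {1..n} {1..n}"
    by (rule bij_betw_cong) (simp add: \<rho>_def)
  ultimately have "bij_betw \<rho> {1..n} {1..n}" by blast
  then have p: "\<rho> permutes {1..n}" by (rule bij_imp_permutes) (auto simp: \<rho>_def)
  have pos: "position \<mu> t (\<rho> x) = ?q x" if "x \<in> {1..n}" for x
  proof -
    have "?q x \<in> cells \<mu>" using bij_betwE[OF q] that by blast
    then show ?thesis using that position_tableau(1)[OF t] by (simp add: \<rho>_def)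
  qed
  have "\<rho> \<in> column_stabilizer \<mu> t"
    using p pos by (simp add: column_stabilizer_iff[OF t] n)
  moreover have "pullback \<rho> (tabloid_of \<mu> t) = tabloid_of \<mu> s"
  proof
    fix i
    show "pullback \<rho> (tabloid_of \<mu> t) i = tabloid_of \<mu> s i"
    proof (rule Set.set_eqI)
      fix x
      have "x \<in> pullback \<rho> (tabloid_of \<mu> t) i \<longleftrightarrow> \<rho> x \<in> {1..n} \<and> fst (position \<mu> t (\<rho> x)) = i"
        by (simp add: pullback_def tabloid_of_eq[OF t] n)
      also have "\<dots> \<longleftrightarrow> x \<in> {1..n} \<and> fst (position \<mu> s x) = i"
        unfolding permutes_in_image[OF p] by (rule conj_cong[OF refl]) (simp only: pos fst_conv)
      also have "\<dots> \<longleftrightarrow> x \<in> tabloid_of \<mu> s i"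
        by (simp add: tabloid_of_eq[OF s] n)
      finally show "x \<in> pullback \<rho> (tabloid_of \<mu> t) i \<longleftrightarrow> x \<in> tabloid_of \<mu> s i" .
    qed
  qed
  ultimately show ?thesis by blast
qed

text \<open>Without injectivity, two entries share a row of \<open>s\<close> and a column of
  \<open>t\<close>. Their transposition is an odd column permutation for \<open>t\<close> and leaves
  the tabloid of \<open>s\<close> alone.\<close>

lemma collision_transpose:
  assumes s: "s \<in> tableaux \<kappa>" and t: "t \<in> tableaux \<mu>" and n: "sum_list \<kappa> = n" "sum_list \<mu> = n"
    and "\<not> inj_on (\<lambda>x. (fst (position \<kappa> s x), snd (position \<mu> t x))) {1..n}"
  shows "\<exists>\<pi>\<in>column_stabilizer \<mu> t. sign \<pi> = -1 \<and> pullback \<pi> (tabloid_of \<kappa> s) = tabloid_of \<kappa> s"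
proof -
  obtain x y where xy: "x \<in> {1..n}" "y \<in> {1..n}" "x \<noteq> y"
    "fst (position \<kappa> s x) = fst (position \<kappa> s y)" "snd (position \<mu> t x) = snd (position \<mu> t y)"
    using assms(5) by (auto simp: inj_on_def)
  let ?p = "Transposition.transpose x y"
  have p: "?p permutes {1..n}" using xy by (intro permutes_swap_id)
  have "?p \<in> column_stabilizer \<mu> t"
    using xy p by (auto simp: column_stabilizer_iff[OF t] n transpose_def)
  moreover have "pullback ?p (tabloid_of \<kappa> s) = tabloid_of \<kappa> s"
  proof
    fix i
    have "?p z \<in> tabloid_of \<kappa> s i \<longleftrightarrow> z \<in> tabloid_of \<kappa> s i" for z
      using xy by (cases "z = x"; cases "z = y") (auto simp: tabloid_of_eq[OF s] n)
    then show "pullback ?p (tabloid_of \<kappa> s) i = tabloid_of \<kappa> s i"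
      by (auto simp: pullback_def)
  qed
  moreover have "sign ?p = -1" using xy by (simp add: sign_swap_id)
  ultimately show ?thesis by blast
qed

section \<open>Antisymmetric functions on tabloids\<close>

text \<open>Only the summation set is explicit; row and column indices range over whole types. Real
  entries suffice because polytabloids have integer values, and complex numbers enter only when
  \<open>polytabloid\<close> and \<open>irr_char\<close> are compared with their real
  counterparts.\<close>

definition mmul :: "'b set \<Rightarrow> ('a \<Rightarrow> 'b \<Rightarrow> real) \<Rightarrow> ('b \<Rightarrow> 'c \<Rightarrow> real) \<Rightarrow> 'a \<Rightarrow> 'c \<Rightarrow> real" where
  "mmul Y A B = (\<lambda>x z. \<Sum>y\<in>Y. A x y * B y z)"

definition adjoint :: "('a \<Rightarrow> 'b \<Rightarrow> real) \<Rightarrow> 'b \<Rightarrow> 'a \<Rightarrow> real" where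
  "adjoint A = (\<lambda>x y. A y x)"

definition mtrace :: "'a set \<Rightarrow> ('a \<Rightarrow> 'a \<Rightarrow> real) \<Rightarrow> real" where
  "mtrace X A = (\<Sum>x\<in>X. A x x)"

lemma mmul_assoc: "mmul Y (mmul X A B) C = mmul X A (mmul Y B C)"
proof (intro ext)
  fix x z
  show "mmul Y (mmul X A B) C x z = mmul X A (mmul Y B C) x z"
    unfolding mmul_def sum_distrib_left sum_distrib_right
    by (subst sum.swap) (simp add: mult.assoc)
qed

lemma mmul_scale_right: "mmul Y A (\<lambda>x z. c * B x z) = (\<lambda>x z. c * mmul Y A B x z)"
  and mmul_scale_left: "mmul Y (\<lambda>x z. c * A x z) B = (\<lambda>x z. c * mmul Y A B x z)"
  by (simp_all add: mmul_def sum_distrib_left mult_ac)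

lemma mmul_zero [simp]: "mmul Y A (\<lambda>x z. 0) = (\<lambda>x z. 0)" "mmul Y (\<lambda>x z. 0) B = (\<lambda>x z. 0)"
  by (simp_all add: mmul_def)

lemma adjoint_mmul: "adjoint (mmul Y A B) = mmul Y (adjoint B) (adjoint A)"
  by (simp add: adjoint_def mmul_def mult.commute)

lemma adjoint_adjoint [simp]: "adjoint (adjoint A) = A"
  by (simp add: adjoint_def)

lemma mtrace_mmul_commute: "mtrace X (mmul Y A B) = mtrace Y (mmul X B A)"
  unfolding mtrace_def mmul_def by (subst sum.swap) (simp add: mult.commute)

lemma mtrace_scale: "mtrace X (\<lambda>x z. c * A x z) = c * mtrace X A"
  by (simp add: mtrace_def sum_distrib_left)

lemma mtrace_mmul_adjoint: "mtrace X (mmul Y A (adjoint A)) = (\<Sum>x\<in>X. \<Sum>y\<in>Y. (A x y)\<^sup>2)"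
  by (simp add: mtrace_def mmul_def adjoint_def power2_eq_square)

section \<open>Real polytabloids and their characterization by antisymmetry\<close>

definition rpolytabloid :: "nat list \<Rightarrow> (nat \<times> nat \<Rightarrow> nat) \<Rightarrow> tabloid \<Rightarrow> real" where
  "rpolytabloid \<mu> t R = (\<Sum>\<pi>\<in>column_stabilizer \<mu> t.
     if pullback \<pi> R = tabloid_of \<mu> t then of_int (sign \<pi>) else 0)"

lemma column_stabilizer_permutes: "\<pi> \<in> column_stabilizer \<mu> t \<Longrightarrow> \<pi> permutes {1..sum_list \<mu>}"
  by (simp add: column_stabilizer_def carrier_sym_group)

lemma perms_permutation: "\<pi> permutes {1..n::nat} \<Longrightarrow> permutation \<pi>"
  using permutation_permutes by blast

lemma polytabloid_rpolytabloid: "polytabloid \<mu> t R = of_real (rpolytabloid \<mu> t R)"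
proof -
  have "polytabloid \<mu> t R = (\<Sum>\<pi>\<in>column_stabilizer \<mu> t.
     of_real (if pullback \<pi> R = tabloid_of \<mu> t then of_int (sign \<pi>) else 0))"
    unfolding polytabloid_def
    by (intro sum.cong refl) (simp add: eq_tabloid_of_comp_iff[OF column_stabilizer_permutes])
  then show ?thesis unfolding rpolytabloid_def of_real_sum by (rule trans) (rule refl)
qed

lemma column_stabilizer_comp:
  assumes "\<pi> \<in> column_stabilizer \<mu> t" "\<rho> \<in> column_stabilizer \<mu> t"
  shows "\<pi> \<circ> \<rho> \<in> column_stabilizer \<mu> t"
proof -
  have "(\<pi> \<circ> \<rho>) ` A = A" if "\<pi> ` A = A" "\<rho> ` A = A" for A
    using that by (metis image_comp)
  moreover have "\<pi> \<circ> \<rho> permutes {1..sum_list \<mu>}"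
    using assms by (intro permutes_compose column_stabilizer_permutes)
  ultimately show ?thesis
    using assms by (simp add: column_stabilizer_def carrier_sym_group)
qed

lemma id_column_stabilizer: "id \<in> column_stabilizer \<mu> t"
  by (simp add: column_stabilizer_def carrier_sym_group permutes_id)

text \<open>Left multiplication by \<open>\<rho>\<close> permutes the column stabilizer and
  multiplies all signs by \<open>sign \<rho>\<close>.\<close>

lemma rpolytabloid_antisym:
  assumes rho: "\<rho> \<in> column_stabilizer \<mu> t"
  shows "rpolytabloid \<mu> t (pullback \<rho> R) = of_int (sign \<rho>) * rpolytabloid \<mu> t R"
proof -
  let ?C = "column_stabilizer \<mu> t"
  have b: "bij_betw (\<lambda>\<pi>. \<rho> \<circ> \<pi>) ?C ?C"
  proof -
    have i: "inj_on (\<lambda>\<pi>. \<rho> \<circ> \<pi>) ?C"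
      using permutes_inj[OF column_stabilizer_permutes[OF rho]]
      by (intro inj_onI) (metis fun.inj_map_strong inj_eq)
    have "(\<lambda>\<pi>. \<rho> \<circ> \<pi>) ` ?C \<subseteq> ?C" using column_stabilizer_comp[OF rho] by blast
    then show ?thesis using i by (simp add: bij_betw_def endo_inj_surj)
  qed
  have s: "(of_int (sign (\<rho> \<circ> \<pi>)) :: real) = of_int (sign \<rho>) * of_int (sign \<pi>)" if "\<pi> \<in> ?C" for \<pi>
    using that rho by (simp add: sign_compose perms_permutation[OF column_stabilizer_permutes])
  have "rpolytabloid \<mu> t (pullback \<rho> R) = (\<Sum>\<pi>\<in>?C. of_int (sign \<rho>) *
      (if pullback (\<rho> \<circ> \<pi>) R = tabloid_of \<mu> t then of_int (sign (\<rho> \<circ> \<pi>)) else 0))"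
    unfolding rpolytabloid_def pullback_comp[symmetric]
    by (intro sum.cong refl) (simp add: s of_int_mult[symmetric] del: of_int_mult)
  also have "\<dots> = of_int (sign \<rho>) * rpolytabloid \<mu> t R"
    unfolding rpolytabloid_def sum_distrib_left[symmetric] by (subst sum.reindex_bij_betw[OF b]) (rule refl)
  finally show ?thesis .
qed

text \<open>A column permutation that also preserves the rows fixes every cell, so only the identity
  contributes. This normalization shows that polytabloids are nonzero and lets scalars be read off
  at one tabloid.\<close>

lemma rpolytabloid_self:
  assumes t: "t \<in> tableaux \<mu>"
  shows "rpolytabloid \<mu> t (tabloid_of \<mu> t) = 1"
proof -
  have id: "\<pi> = id" if pi: "\<pi> \<in> column_stabilizer \<mu> t"
    and eq: "pullback \<pi> (tabloid_of \<mu> t) = tabloid_of \<mu> t" for \<pi>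
  proof
    fix x
    have p: "\<pi> permutes {1..sum_list \<mu>}" using column_stabilizer_permutes[OF pi] .
    show "\<pi> x = id x"
    proof (cases "x \<in> {1..sum_list \<mu>}")
      case True
      then have px: "\<pi> x \<in> {1..sum_list \<mu>}" using permutes_in_image[OF p] by blast
      have "x \<in> pullback \<pi> (tabloid_of \<mu> t) (fst (position \<mu> t x))"
        unfolding eq using True by (simp add: tabloid_of_eq[OF t])
      then have "fst (position \<mu> t (\<pi> x)) = fst (position \<mu> t x)"
        by (simp add: pullback_def tabloid_of_eq[OF t])
      moreover have "snd (position \<mu> t (\<pi> x)) = snd (position \<mu> t x)"
        using pi True by (simp add: column_stabilizer_iff[OF t])
      ultimately have "position \<mu> t (\<pi> x) = position \<mu> t x" by (simp add: prod_eq_iff)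
      then show ?thesis
        using inj_onD[OF bij_betw_imp_inj_on[OF position_bij[OF t]] _ px True] by simp
    next
      case False
      then show ?thesis using permutes_not_in[OF p] by simp
    qed
  qed
  have "rpolytabloid \<mu> t (tabloid_of \<mu> t)
      = (\<Sum>\<pi>\<in>column_stabilizer \<mu> t. if \<pi> = id then 1 else 0)"
    unfolding rpolytabloid_def using id by (intro sum.cong refl) auto
  then show ?thesis by (simp add: id_column_stabilizer)
qed

lemma rpolytabloid_zero:
  assumes t: "t \<in> tableaux \<mu>" and R: "R \<notin> tabloids \<mu>"
  shows "rpolytabloid \<mu> t R = 0"
  unfolding rpolytabloid_def
proof (intro sum.neutral ballI)
  fix \<pi> assume "\<pi> \<in> column_stabilizer \<mu> t"
  then have "pullback \<pi> R \<noteq> tabloid_of \<mu> t"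
    using R t pullback_tabloids(2)[OF column_stabilizer_permutes] by (metis tabloids_def imageI)
  then show "(if pullback \<pi> R = tabloid_of \<mu> t then of_int (sign \<pi>) else (0::real)) = 0" by simp
qed

text \<open>The property of a polytabloid that survives equivariant maps; on tabloids of its own
  shape it determines the function up to a scalar.\<close>

definition antisymmetric_under :: "(nat \<Rightarrow> nat) set \<Rightarrow> (tabloid \<Rightarrow> real) \<Rightarrow> bool" where
  "antisymmetric_under C g \<longleftrightarrow> (\<forall>\<pi>\<in>C. \<forall>R. g (pullback \<pi> R) = of_int (sign \<pi>) * g R)"

lemma antisymmetric_collision:
  assumes "s \<in> tableaux \<kappa>" "t \<in> tableaux \<mu>" "sum_list \<kappa> = n" "sum_list \<mu> = n"
    and "\<not> inj_on (\<lambda>x. (fst (position \<kappa> s x), snd (position \<mu> t x))) {1..n}"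
    and "antisymmetric_under (column_stabilizer \<mu> t) g"
  shows "g (tabloid_of \<kappa> s) = 0"
proof -
  obtain \<pi> where "\<pi> \<in> column_stabilizer \<mu> t" "sign \<pi> = -1"
    "pullback \<pi> (tabloid_of \<kappa> s) = tabloid_of \<kappa> s"
    using collision_transpose[OF assms(1-5)] by blast
  then have "g (tabloid_of \<kappa> s) = - g (tabloid_of \<kappa> s)"
    using assms(6) unfolding antisymmetric_under_def by (metis mult_minus1 of_int_1 of_int_minus)
  then show ?thesis by simp
qed

text \<open>A tabloid either has two entries of one row in a common column of \<open>t\<close>, and
  then both sides vanish, or it is a column permutation of the tabloid of \<open>t\<close>, and then
  antisymmetry fixes the value.\<close>

lemma antisymmetric_multiple:
  assumes mu: "\<mu> \<in> int_partitions n" and t: "t \<in> tableaux \<mu>"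
    and g: "antisymmetric_under (column_stabilizer \<mu> t) g" and R: "R \<in> tabloids \<mu>"
  shows "g R = g (tabloid_of \<mu> t) * rpolytabloid \<mu> t R"
proof -
  have n: "sum_list \<mu> = n" using mu by (simp add: int_partitions_def)
  obtain s where s: "s \<in> tableaux \<mu>" "R = tabloid_of \<mu> s" using R by (auto simp: tabloids_def)
  have e: "antisymmetric_under (column_stabilizer \<mu> t) (rpolytabloid \<mu> t)"
    by (simp add: antisymmetric_under_def rpolytabloid_antisym)
  show ?thesis
  proof (cases "inj_on (\<lambda>x. (fst (position \<mu> s x), snd (position \<mu> t x))) {1..n}")
    case True
    then obtain \<rho> where "\<rho> \<in> column_stabilizer \<mu> t" "pullback \<rho> (tabloid_of \<mu> t) = R"
      using column_straighten[OF mu s(1) t] s(2) by blast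
    then show ?thesis
      using g rpolytabloid_antisym[of \<rho> \<mu> t "tabloid_of \<mu> t"] rpolytabloid_self[OF t]
      by (auto simp: antisymmetric_under_def)
  next
    case False
    then show ?thesis
      using antisymmetric_collision[OF s(1) t n n False g]
        antisymmetric_collision[OF s(1) t n n False e] s(2) by simp
  qed
qed

text \<open>A tabloid without collision would force \<open>\<mu>\<close> to dominate
  \<open>\<kappa>\<close> by \<open>top_rows_le\<close>, so under \<open>k\<close> every tabloid of
  shape \<open>\<kappa>\<close> has a collision.\<close>

lemma antisymmetric_vanish:
  assumes la: "\<kappa> \<in> int_partitions n" and mu: "\<mu> \<in> int_partitions n" and t: "t \<in> tableaux \<mu>"
    and g: "antisymmetric_under (column_stabilizer \<mu> t) g" and R: "R \<in> tabloids \<kappa>"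
    and k: "\<not> top_rows \<kappa> k \<le> top_rows \<mu> k"
  shows "g R = 0"
proof -
  have n: "sum_list \<kappa> = n" "sum_list \<mu> = n" using la mu by (auto simp: int_partitions_def)
  obtain s where s: "s \<in> tableaux \<kappa>" "R = tabloid_of \<kappa> s" using R by (auto simp: tabloids_def)
  show ?thesis
    using antisymmetric_collision[OF s(1) t n _ g] top_rows_le[OF la mu s(1) t] k s(2) by blast
qed

section \<open>Polytabloids of moved tableaux\<close>

lemma inv_comp_cancel:
  assumes "\<sigma> permutes S"
  shows "inv' \<sigma> \<circ> (\<sigma> \<circ> f) = f" "\<sigma> \<circ> (inv' \<sigma> \<circ> f) = f" "(f \<circ> \<sigma>) \<circ> inv' \<sigma> = f" "(f \<circ> inv' \<sigma>) \<circ> \<sigma> = f"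
  using permutes_inv_o[OF assms] by (simp_all add: comp_assoc) (simp_all flip: comp_assoc)

lemma column_stabilizer_move:
  assumes t: "t \<in> tableaux \<mu>" and s: "\<sigma> permutes {1..sum_list \<mu>}"
  shows "\<sigma> \<circ> \<pi> \<circ> inv' \<sigma> \<in> column_stabilizer \<mu> (move \<mu> \<sigma> t) \<longleftrightarrow> \<pi> \<in> column_stabilizer \<mu> t"
proof -
  let ?N = "{1..sum_list \<mu>}"
  have i: "inv' \<sigma> permutes ?N" by (rule permutes_inv[OF s])
  have perm: "\<sigma> \<circ> \<pi> \<circ> inv' \<sigma> permutes ?N \<longleftrightarrow> \<pi> permutes ?N"
  proof
    assume "\<sigma> \<circ> \<pi> \<circ> inv' \<sigma> permutes ?N"
    from permutes_compose[OF permutes_compose[OF s this] i] show "\<pi> permutes ?N"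
      by (simp only: comp_assoc inv_comp_cancel[OF s] permutes_inv_o[OF s] comp_id)
  qed (use s i in \<open>intro permutes_compose\<close>)
  have "(\<forall>x\<in>?N. snd (position \<mu> (move \<mu> \<sigma> t) ((\<sigma> \<circ> \<pi> \<circ> inv' \<sigma>) x)) = snd (position \<mu> (move \<mu> \<sigma> t) x))
     \<longleftrightarrow> (\<forall>y\<in>?N. snd (position \<mu> t (\<pi> y)) = snd (position \<mu> t y))" if p: "\<pi> permutes ?N"
  proof -
    have "(\<forall>x\<in>?N. Q x) \<longleftrightarrow> (\<forall>y\<in>?N. Q (\<sigma> y))" for Q
    proof -
      have "(\<forall>x\<in>\<sigma> ` ?N. Q x) \<longleftrightarrow> (\<forall>y\<in>?N. Q (\<sigma> y))" by blast
      then show ?thesis unfolding permutes_image[OF s] .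
    qed
    then have "(\<forall>x\<in>?N. snd (position \<mu> (move \<mu> \<sigma> t) ((\<sigma> \<circ> \<pi> \<circ> inv' \<sigma>) x)) = snd (position \<mu> (move \<mu> \<sigma> t) x))
      \<longleftrightarrow> (\<forall>y\<in>?N. snd (position \<mu> (move \<mu> \<sigma> t) ((\<sigma> \<circ> \<pi> \<circ> inv' \<sigma>) (\<sigma> y))) = snd (position \<mu> (move \<mu> \<sigma> t) (\<sigma> y)))"
      .
    also have "\<dots> \<longleftrightarrow> (\<forall>y\<in>?N. snd (position \<mu> t (\<pi> y)) = snd (position \<mu> t y))"
    proof (rule ball_cong[OF refl])
      fix y assume y: "y \<in> ?N"
      have py: "\<pi> y \<in> ?N" using permutes_in_image[OF p] y by blast
      show "(snd (position \<mu> (move \<mu> \<sigma> t) ((\<sigma> \<circ> \<pi> \<circ> inv' \<sigma>) (\<sigma> y))) = snd (position \<mu> (move \<mu> \<sigma> t) (\<sigma> y)))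
        = (snd (position \<mu> t (\<pi> y)) = snd (position \<mu> t y))"
        by (simp only: comp_apply permutes_inverses[OF s] position_move[OF t s y] position_move[OF t s py])
    qed
    finally show ?thesis .
  qed
  then show ?thesis
    unfolding column_stabilizer_iff[OF t] column_stabilizer_iff[OF move_tableaux[OF t s]] perm by blast
qed

text \<open>Conjugation by \<open>\<sigma>\<close> carries one column stabilizer onto the other
  without changing signs. Hence a single polytabloid generates all others of its shape.\<close>

lemma rpolytabloid_move:
  assumes t: "t \<in> tableaux \<mu>" and s: "\<sigma> permutes {1..sum_list \<mu>}"
  shows "rpolytabloid \<mu> (move \<mu> \<sigma> t) R = rpolytabloid \<mu> t (pullback \<sigma> R)"
proof -
  have ps: "permutation \<sigma>" "permutation (inv' \<sigma>)"
    using perms_permutation s permutes_inv[OF s] by blast+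
  have b: "bij_betw (\<lambda>\<pi>. \<sigma> \<circ> \<pi> \<circ> inv' \<sigma>) (column_stabilizer \<mu> t) (column_stabilizer \<mu> (move \<mu> \<sigma> t))"
  proof (rule bij_betw_byWitness[where f' = "\<lambda>\<pi>. inv' \<sigma> \<circ> \<pi> \<circ> \<sigma>"])
    show "(\<lambda>\<pi>. \<sigma> \<circ> \<pi> \<circ> inv' \<sigma>) ` column_stabilizer \<mu> t \<subseteq> column_stabilizer \<mu> (move \<mu> \<sigma> t)"
      using column_stabilizer_move[OF t s] by blast
    have c: "\<sigma> \<circ> (inv' \<sigma> \<circ> \<pi> \<circ> \<sigma>) \<circ> inv' \<sigma> = \<pi>" for \<pi>
      by (simp only: comp_assoc inv_comp_cancel[OF s] permutes_inv_o[OF s] comp_id)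
    show "(\<lambda>\<pi>. inv' \<sigma> \<circ> \<pi> \<circ> \<sigma>) ` column_stabilizer \<mu> (move \<mu> \<sigma> t) \<subseteq> column_stabilizer \<mu> t"
    proof clarify
      fix \<pi> assume "\<pi> \<in> column_stabilizer \<mu> (move \<mu> \<sigma> t)"
      then show "inv' \<sigma> \<circ> \<pi> \<circ> \<sigma> \<in> column_stabilizer \<mu> t"
        using column_stabilizer_move[OF t s, of "inv' \<sigma> \<circ> \<pi> \<circ> \<sigma>"] by (simp only: c)
    qed
  qed (simp_all only: comp_assoc inv_comp_cancel[OF s] permutes_inv_o[OF s] comp_id ball_simps, simp_all)
  have u: "pullback \<sigma> (tabloid_of \<mu> (move \<mu> \<sigma> t)) = tabloid_of \<mu> t"
    using eq_tabloid_of_comp_iff[OF s] tabloid_of_move by blast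
  have "rpolytabloid \<mu> (move \<mu> \<sigma> t) R = (\<Sum>\<pi>\<in>column_stabilizer \<mu> t.
     if pullback (\<sigma> \<circ> \<pi> \<circ> inv' \<sigma>) R = tabloid_of \<mu> (move \<mu> \<sigma> t) then of_int (sign (\<sigma> \<circ> \<pi> \<circ> inv' \<sigma>)) else 0)"
    unfolding rpolytabloid_def by (rule sum.reindex_bij_betw[OF b, symmetric])
  also have "\<dots> = rpolytabloid \<mu> t (pullback \<sigma> R)"
    unfolding rpolytabloid_def
  proof (intro sum.cong refl if_cong)
    fix \<pi> assume pi: "\<pi> \<in> column_stabilizer \<mu> t"
    have pp: "permutation \<pi>" using perms_permutation column_stabilizer_permutes[OF pi] by blast
    have "sign (\<sigma> \<circ> \<pi> \<circ> inv' \<sigma>) = sign \<sigma> * sign \<pi> * sign \<sigma>"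
      using ps pp by (simp add: sign_compose permutation_compose sign_inverse)
    then show "(of_int (sign (\<sigma> \<circ> \<pi> \<circ> inv' \<sigma>)) :: real) = of_int (sign \<pi>)"
      by (simp add: sign_def[of \<sigma>])
    have "pullback (inv' \<sigma>) Z = W \<longleftrightarrow> Z = pullback \<sigma> W" for Z W
      by (auto simp: pullback_inv[OF s])
    then show "(pullback (\<sigma> \<circ> \<pi> \<circ> inv' \<sigma>) R = tabloid_of \<mu> (move \<mu> \<sigma> t))
      = (pullback \<pi> (pullback \<sigma> R) = tabloid_of \<mu> t)"
      unfolding u[symmetric] pullback_comp .
  qed
  finally show ?thesis .
qed

lemma tableaux_move_transitive:
  assumes t: "t \<in> tableaux \<mu>" and s: "s \<in> tableaux \<mu>"
  obtains \<sigma> where "\<sigma> permutes {1..sum_list \<mu>}" "s = move \<mu> \<sigma> t"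
proof -
  let ?N = "{1..sum_list \<mu>}"
  define \<sigma> where "\<sigma> x = (if x \<in> ?N then s (position \<mu> t x) else x)" for x
  have "bij_betw (s \<circ> position \<mu> t) ?N ?N"
    using bij_betw_trans[OF position_bij[OF t] tableaux_bij[OF s]] .
  moreover have "bij_betw \<sigma> ?N ?N = bij_betw (s \<circ> position \<mu> t) ?N ?N"
    by (rule bij_betw_cong) (simp add: \<sigma>_def)
  ultimately have p: "\<sigma> permutes ?N" by (intro bij_imp_permutes) (auto simp: \<sigma>_def)
  have "s c = move \<mu> \<sigma> t c" for c
  proof (cases "c \<in> cells \<mu>")
    case True
    then have "t c \<in> ?N" using bij_betwE[OF tableaux_bij[OF t]] by blast
    then show ?thesis using True t by (simp add: move_def \<sigma>_def)
  next
    case False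
    moreover have "s \<in> extensional (cells \<mu>)" using s by (simp add: tableaux_def)
    ultimately show ?thesis using extensional_arb[of s "cells \<mu>" c] by (simp add: move_def)
  qed
  then show ?thesis using that p by blast
qed

section \<open>Projections onto Specht modules and orthogonality of characters\<close>

text \<open>Any tableau will do: another choice merely reindexes the group sum in
  \<open>gram\<close>.\<close>

definition base_tableau :: "nat list \<Rightarrow> nat \<times> nat \<Rightarrow> nat" where
  "base_tableau \<mu> = (SOME t. t \<in> tableaux \<mu>)"

lemma base_tableau: "base_tableau \<mu> \<in> tableaux \<mu>"
  unfolding base_tableau_def using tableaux_nonempty by (metis some_in_eq)

abbreviation base_polytabloid :: "nat list \<Rightarrow> tabloid \<Rightarrow> real" where
  "base_polytabloid \<mu> \<equiv> rpolytabloid \<mu> (base_tableau \<mu>)"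

abbreviation base_tabloid :: "nat list \<Rightarrow> tabloid" where
  "base_tabloid \<mu> \<equiv> tabloid_of \<mu> (base_tableau \<mu>)"

lemma base_tabloid: "base_tabloid \<mu> \<in> tabloids \<mu>"
  using base_tableau by (simp add: tabloids_def)

text \<open>Up to the factor \<open>gram_scale\<close>, this is the orthogonal projection onto the Specht module: its
  columns are combinations of polytabloids, and it acts on each polytabloid as a scalar.\<close>

definition gram :: "nat list \<Rightarrow> tabloid \<Rightarrow> tabloid \<Rightarrow> real" where
  "gram \<mu> R S = (\<Sum>\<sigma>\<in>perms (sum_list \<mu>). base_polytabloid \<mu> (pullback \<sigma> R) * base_polytabloid \<mu> (pullback \<sigma> S))"

text \<open>The eigenvalue of \<open>gram \<mu>\<close> on the base polytabloid, read off at the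
  base tabloid, where the polytabloid has the value 1.\<close>

definition gram_scale :: "nat list \<Rightarrow> real" where
  "gram_scale \<mu> = (\<Sum>S\<in>tabloids \<mu>. gram \<mu> (base_tabloid \<mu>) S * base_polytabloid \<mu> S)"

definition specht_proj :: "nat list \<Rightarrow> tabloid \<Rightarrow> tabloid \<Rightarrow> real" where
  "specht_proj \<mu> R S = gram \<mu> R S / gram_scale \<mu>"

text \<open>Simultaneous invariance in both indices means commuting with the action of
  \<open>perms n\<close>. The degree is independent of the shapes involved, so the notion also
  covers restriction to a smaller group.\<close>

definition equivariant :: "nat \<Rightarrow> (tabloid \<Rightarrow> tabloid \<Rightarrow> real) \<Rightarrow> bool" where
  "equivariant n A \<longleftrightarrow> (\<forall>\<sigma>\<in>perms n. \<forall>R S. A (pullback \<sigma> R) (pullback \<sigma> S) = A R S)"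

lemma equivariantD:
  "equivariant n A \<Longrightarrow> \<sigma> permutes {1..n} \<Longrightarrow> A (pullback \<sigma> R) (pullback \<sigma> S) = A R S"
  by (simp add: equivariant_def)

lemma sum_perms_left: "\<tau> permutes {1..n} \<Longrightarrow> (\<Sum>\<sigma>\<in>perms n. f (\<tau> \<circ> \<sigma>)) = (\<Sum>\<sigma>\<in>perms n. f \<sigma>)"
  by (rule setum_permutations_compose_left[symmetric])

lemma sum_perms_right: "\<tau> permutes {1..n} \<Longrightarrow> (\<Sum>\<sigma>\<in>perms n. f (\<sigma> \<circ> \<tau>)) = (\<Sum>\<sigma>\<in>perms n. f \<sigma>)"
  by (rule sum_permutations_compose_right[symmetric])

lemma equivariant_gram: "equivariant (sum_list \<mu>) (gram \<mu>)"
  unfolding equivariant_def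
proof (intro ballI allI)
  fix \<tau> R S assume t: "\<tau> \<in> perms (sum_list \<mu>)"
  have "gram \<mu> (pullback \<tau> R) (pullback \<tau> S)
     = (\<Sum>\<sigma>\<in>perms (sum_list \<mu>). base_polytabloid \<mu> (pullback (\<tau> \<circ> \<sigma>) R) * base_polytabloid \<mu> (pullback (\<tau> \<circ> \<sigma>) S))"
    by (simp add: gram_def pullback_comp)
  also have "\<dots> = gram \<mu> R S"
    unfolding gram_def using t
    by (intro sum_perms_left[where f = "\<lambda>\<sigma>. base_polytabloid \<mu> (pullback \<sigma> R) * base_polytabloid \<mu> (pullback \<sigma> S)"]) simp
  finally show "gram \<mu> (pullback \<tau> R) (pullback \<tau> S) = gram \<mu> R S" .
qed

lemma equivariant_specht_proj: "equivariant (sum_list \<mu>) (specht_proj \<mu>)"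
  using equivariant_gram[of \<mu>] by (simp add: equivariant_def specht_proj_def)

lemma gram_sym: "gram \<mu> R S = gram \<mu> S R"
  by (simp add: gram_def mult.commute)

lemma specht_proj_sym: "specht_proj \<mu> R S = specht_proj \<mu> S R"
  using gram_sym[of \<mu> R S] by (simp add: specht_proj_def)

lemma adjoint_specht_proj [simp]: "adjoint (specht_proj \<mu>) = specht_proj \<mu>"
  unfolding adjoint_def by (intro ext specht_proj_sym)

lemma gram_support: "R \<notin> tabloids \<mu> \<Longrightarrow> gram \<mu> R S = 0"
proof -
  assume "R \<notin> tabloids \<mu>"
  then have "base_polytabloid \<mu> (pullback \<sigma> R) = 0" if "\<sigma> \<in> perms (sum_list \<mu>)" for \<sigma>
    using that pullback_tabloids(2) by (intro rpolytabloid_zero[OF base_tableau]) auto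
  then show ?thesis by (simp add: gram_def)
qed

lemma specht_proj_support: "R \<notin> tabloids \<mu> \<Longrightarrow> specht_proj \<mu> R S = 0" "S \<notin> tabloids \<mu> \<Longrightarrow> specht_proj \<mu> R S = 0"
proof -
  show *: "R \<notin> tabloids \<mu> \<Longrightarrow> specht_proj \<mu> R S = 0" for R S by (simp add: specht_proj_def gram_support)
  show "S \<notin> tabloids \<mu> \<Longrightarrow> specht_proj \<mu> R S = 0" using * by (simp add: specht_proj_sym[of \<mu> R S])
qed

lemma sum_pullback_tabloids:
  assumes "\<sigma> permutes {1..sum_list \<mu>}"
  shows "(\<Sum>S\<in>tabloids \<mu>. f (pullback \<sigma> S)) = (\<Sum>S\<in>tabloids \<mu>. f S)"
  using sum.reindex_bij_betw[OF pullback_tabloids_bij[OF assms]] .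

lemma antisymmetric_image:
  assumes "equivariant (sum_list \<mu>) A"
  shows "antisymmetric_under (column_stabilizer \<mu> t) (\<lambda>R. \<Sum>S\<in>tabloids \<mu>. A R S * rpolytabloid \<mu> t S)"
  unfolding antisymmetric_under_def
proof (intro ballI allI)
  fix \<pi> R assume pi: "\<pi> \<in> column_stabilizer \<mu> t"
  have p: "\<pi> permutes {1..sum_list \<mu>}" using column_stabilizer_permutes[OF pi] .
  have "(\<Sum>S\<in>tabloids \<mu>. A (pullback \<pi> R) S * rpolytabloid \<mu> t S)
      = (\<Sum>S\<in>tabloids \<mu>. A (pullback \<pi> R) (pullback \<pi> S) * rpolytabloid \<mu> t (pullback \<pi> S))"
    by (rule sum_pullback_tabloids[OF p, symmetric])
  also have "\<dots> = (\<Sum>S\<in>tabloids \<mu>. of_int (sign \<pi>) * (A R S * rpolytabloid \<mu> t S))"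
    by (simp add: equivariantD[OF assms p] rpolytabloid_antisym[OF pi] mult_ac)
  finally show "(\<Sum>S\<in>tabloids \<mu>. A (pullback \<pi> R) S * rpolytabloid \<mu> t S)
    = of_int (sign \<pi>) * (\<Sum>S\<in>tabloids \<mu>. A R S * rpolytabloid \<mu> t S)"
    by (simp add: sum_distrib_left)
qed

text \<open>Equivariance shifts \<open>\<sigma>\<close> from the polytabloid to the row index of
  \<open>A\<close>, so the product only involves the image under \<open>A\<close> of one fixed
  polytabloid.\<close>

lemma mmul_gram:
  assumes "equivariant (sum_list \<mu>) A"
  shows "mmul (tabloids \<mu>) A (gram \<mu>) R S
    = (\<Sum>\<sigma>\<in>perms (sum_list \<mu>). (\<Sum>U\<in>tabloids \<mu>. A (pullback \<sigma> R) U * base_polytabloid \<mu> U) * base_polytabloid \<mu> (pullback \<sigma> S))"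
proof -
  have "mmul (tabloids \<mu>) A (gram \<mu>) R S
    = (\<Sum>\<sigma>\<in>perms (sum_list \<mu>). \<Sum>U\<in>tabloids \<mu>.
        A R U * base_polytabloid \<mu> (pullback \<sigma> U) * base_polytabloid \<mu> (pullback \<sigma> S))"
    unfolding mmul_def gram_def sum_distrib_left by (subst sum.swap) (simp add: mult.assoc)
  also have "\<dots> = (\<Sum>\<sigma>\<in>perms (sum_list \<mu>). \<Sum>U\<in>tabloids \<mu>.
        A (pullback \<sigma> R) U * base_polytabloid \<mu> U * base_polytabloid \<mu> (pullback \<sigma> S))"
  proof (rule sum.cong[OF refl])
    fix \<sigma> assume "\<sigma> \<in> perms (sum_list \<mu>)"
    then have s: "\<sigma> permutes {1..sum_list \<mu>}" by simp
    show "(\<Sum>U\<in>tabloids \<mu>. A R U * base_polytabloid \<mu> (pullback \<sigma> U) * base_polytabloid \<mu> (pullback \<sigma> S))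
      = (\<Sum>U\<in>tabloids \<mu>. A (pullback \<sigma> R) U * base_polytabloid \<mu> U * base_polytabloid \<mu> (pullback \<sigma> S))"
      by (subst sum_pullback_tabloids[OF s, symmetric]) (simp add: equivariantD[OF assms s])
  qed
  finally show ?thesis by (simp add: sum_distrib_right)
qed

text \<open>The image of the base polytabloid under \<open>A\<close> is antisymmetric, hence a
  multiple of it, and the scalar is its value at the base tabloid.\<close>

lemma mmul_gram_same:
  assumes mu: "\<mu> \<in> int_partitions n" and A: "equivariant n A" and R: "R \<in> tabloids \<mu>"
  shows "mmul (tabloids \<mu>) A (gram \<mu>) R S
    = (\<Sum>U\<in>tabloids \<mu>. A (base_tabloid \<mu>) U * base_polytabloid \<mu> U) * gram \<mu> R S"
proof -
  have n: "sum_list \<mu> = n" using mu by (simp add: int_partitions_def)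
  have A': "equivariant (sum_list \<mu>) A" using A n by simp
  have "(\<Sum>U\<in>tabloids \<mu>. A (pullback \<sigma> R) U * base_polytabloid \<mu> U)
    = (\<Sum>U\<in>tabloids \<mu>. A (base_tabloid \<mu>) U * base_polytabloid \<mu> U) * base_polytabloid \<mu> (pullback \<sigma> R)"
    if "\<sigma> \<in> perms (sum_list \<mu>)" for \<sigma>
    using antisymmetric_multiple[OF mu base_tableau antisymmetric_image[OF A']]
      pullback_tabloids(1)[OF _ R] that by simp
  then show ?thesis
    unfolding mmul_gram[OF A'] gram_def sum_distrib_left by (intro sum.cong refl) (simp only: mult.assoc)
qed

lemma mmul_gram_vanish:
  assumes la: "\<kappa> \<in> int_partitions n" and mu: "\<mu> \<in> int_partitions n" and A: "equivariant n A"
    and R: "R \<in> tabloids \<kappa>" and k: "\<not> top_rows \<kappa> k \<le> top_rows \<mu> k"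
  shows "mmul (tabloids \<mu>) A (gram \<mu>) R S = 0"
proof -
  have n: "sum_list \<kappa> = n" "sum_list \<mu> = n" using la mu by (auto simp: int_partitions_def)
  have A': "equivariant (sum_list \<mu>) A" using A n by simp
  have "(\<Sum>U\<in>tabloids \<mu>. A (pullback \<sigma> R) U * base_polytabloid \<mu> U) = 0"
    if "\<sigma> \<in> perms (sum_list \<mu>)" for \<sigma>
    using antisymmetric_vanish[OF la mu base_tableau antisymmetric_image[OF A'] _ k]
      pullback_tabloids(1)[OF _ R] that n by simp
  then show ?thesis unfolding mmul_gram[OF A'] by simp
qed

lemma gram_rpolytabloid:
  assumes mu: "\<mu> \<in> int_partitions n" and t: "t \<in> tableaux \<mu>"
  shows "(\<Sum>S\<in>tabloids \<mu>. gram \<mu> R S * rpolytabloid \<mu> t S) = gram_scale \<mu> * rpolytabloid \<mu> t R"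
proof -
  have base: "(\<Sum>S\<in>tabloids \<mu>. gram \<mu> R S * base_polytabloid \<mu> S) = gram_scale \<mu> * base_polytabloid \<mu> R" for R
  proof (cases "R \<in> tabloids \<mu>")
    case True
    show ?thesis
      unfolding gram_scale_def
      by (rule antisymmetric_multiple[OF mu base_tableau antisymmetric_image[OF equivariant_gram] True])
  next
    case False
    then show ?thesis by (simp add: gram_support rpolytabloid_zero[OF base_tableau])
  qed
  obtain \<sigma> where s: "\<sigma> permutes {1..sum_list \<mu>}" and "t = move \<mu> \<sigma> (base_tableau \<mu>)"
    using tableaux_move_transitive[OF base_tableau t] by blast
  then have m: "rpolytabloid \<mu> t S = base_polytabloid \<mu> (pullback \<sigma> S)" for S
    by (simp add: rpolytabloid_move[OF base_tableau s])
  have "(\<Sum>S\<in>tabloids \<mu>. gram \<mu> R S * rpolytabloid \<mu> t S)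
    = (\<Sum>S\<in>tabloids \<mu>. gram \<mu> (pullback \<sigma> R) (pullback \<sigma> S) * base_polytabloid \<mu> (pullback \<sigma> S))"
    by (simp add: m equivariantD[OF equivariant_gram s])
  also have "\<dots> = (\<Sum>S\<in>tabloids \<mu>. gram \<mu> (pullback \<sigma> R) S * base_polytabloid \<mu> S)"
    by (rule sum_pullback_tabloids[OF s])
  finally show ?thesis by (simp add: base m)
qed

text \<open>With \<open>e\<close> the base polytabloid, \<open>\<langle>e, gram e\<rangle>\<close>
  is the eigenvalue times the squared norm of \<open>e\<close>, and also the sum over all
  \<open>\<sigma>\<close> of \<open>\<langle>e, \<sigma> e\<rangle>\<close> squared, in which the
  identity contributes a positive term.\<close>

lemma gram_scale_pos:
  assumes mu: "\<mu> \<in> int_partitions n"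
  shows "gram_scale \<mu> > 0"
proof -
  let ?X = "tabloids \<mu>"
  have "base_polytabloid \<mu> (base_tabloid \<mu>) = 1" by (rule rpolytabloid_self[OF base_tableau])
  then have pos: "(\<Sum>R\<in>?X. (base_polytabloid \<mu> R)\<^sup>2) > 0"
    by (intro sum_pos2[OF _ base_tabloid]) auto
  have "gram_scale \<mu> * (\<Sum>R\<in>?X. (base_polytabloid \<mu> R)\<^sup>2)
    = (\<Sum>R\<in>?X. base_polytabloid \<mu> R * (\<Sum>S\<in>?X. gram \<mu> R S * base_polytabloid \<mu> S))"
    by (simp add: gram_rpolytabloid[OF mu base_tableau] sum_distrib_left power2_eq_square mult_ac)
  also have "\<dots> = (\<Sum>R\<in>?X. \<Sum>S\<in>?X. \<Sum>\<sigma>\<in>perms (sum_list \<mu>).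
      (base_polytabloid \<mu> R * base_polytabloid \<mu> (pullback \<sigma> R)) * (base_polytabloid \<mu> S * base_polytabloid \<mu> (pullback \<sigma> S)))"
    by (simp add: gram_def sum_distrib_left sum_distrib_right mult_ac)
  also have "\<dots> = (\<Sum>R\<in>?X. \<Sum>\<sigma>\<in>perms (sum_list \<mu>). \<Sum>S\<in>?X.
      (base_polytabloid \<mu> R * base_polytabloid \<mu> (pullback \<sigma> R)) * (base_polytabloid \<mu> S * base_polytabloid \<mu> (pullback \<sigma> S)))"
    by (intro sum.cong refl sum.swap)
  also have "\<dots> = (\<Sum>\<sigma>\<in>perms (sum_list \<mu>). \<Sum>R\<in>?X. \<Sum>S\<in>?X.
      (base_polytabloid \<mu> R * base_polytabloid \<mu> (pullback \<sigma> R)) * (base_polytabloid \<mu> S * base_polytabloid \<mu> (pullback \<sigma> S)))"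
    by (rule sum.swap)
  also have "\<dots> = (\<Sum>\<sigma>\<in>perms (sum_list \<mu>). (\<Sum>R\<in>?X. base_polytabloid \<mu> R * base_polytabloid \<mu> (pullback \<sigma> R))\<^sup>2)"
    by (simp add: power2_eq_square sum_product)
  also have "\<dots> > 0"
  proof (rule sum_pos2[where i = id])
    show "0 < (\<Sum>R\<in>?X. base_polytabloid \<mu> R * base_polytabloid \<mu> (pullback id R))\<^sup>2"
      using pos by (simp add: power2_eq_square[symmetric])
  qed (auto simp: permutes_id finite_permutations)
  finally show ?thesis using pos by (simp add: zero_less_mult_iff)
qed

lemma specht_proj_rpolytabloid:
  assumes mu: "\<mu> \<in> int_partitions n" and t: "t \<in> tableaux \<mu>"
  shows "(\<Sum>S\<in>tabloids \<mu>. specht_proj \<mu> R S * rpolytabloid \<mu> t S) = rpolytabloid \<mu> t R"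
  using gram_rpolytabloid[OF mu t] gram_scale_pos[OF mu]
  by (simp add: specht_proj_def sum_divide_distrib[symmetric])

lemma specht_proj_eq: "specht_proj \<mu> = (\<lambda>R S. inverse (gram_scale \<mu>) * gram \<mu> R S)"
  by (simp add: specht_proj_def fun_eq_iff divide_inverse mult.commute)

section \<open>Schur's lemma for the projections\<close>

lemma mmul_proj_same:
  assumes mu: "\<mu> \<in> int_partitions n" and A: "equivariant n A"
  obtains c where "\<And>R S. R \<in> tabloids \<mu> \<Longrightarrow> mmul (tabloids \<mu>) A (specht_proj \<mu>) R S = c * specht_proj \<mu> R S"
proof (rule that)
  show "mmul (tabloids \<mu>) A (specht_proj \<mu>) R S
      = (\<Sum>U\<in>tabloids \<mu>. A (base_tabloid \<mu>) U * base_polytabloid \<mu> U) * specht_proj \<mu> R S"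
    if "R \<in> tabloids \<mu>" for R S
    using mmul_gram_same[OF mu A that] by (simp add: specht_proj_eq mmul_scale_right)
qed

lemma specht_proj_idem:
  assumes mu: "\<mu> \<in> int_partitions n"
  shows "mmul (tabloids \<mu>) (specht_proj \<mu>) (specht_proj \<mu>) = specht_proj \<mu>"
proof (intro ext)
  fix R S
  have n: "sum_list \<mu> = n" using mu by (simp add: int_partitions_def)
  have e: "equivariant n (specht_proj \<mu>)" using equivariant_specht_proj[of \<mu>] n by simp
  show "mmul (tabloids \<mu>) (specht_proj \<mu>) (specht_proj \<mu>) R S = specht_proj \<mu> R S"
  proof (cases "R \<in> tabloids \<mu>")
    case True
    have "(\<Sum>U\<in>tabloids \<mu>. specht_proj \<mu> (base_tabloid \<mu>) U * base_polytabloid \<mu> U) = 1"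
      by (simp add: specht_proj_rpolytabloid[OF mu base_tableau] rpolytabloid_self[OF base_tableau])
    then show ?thesis using mmul_gram_same[OF mu e True, of S] by (simp add: specht_proj_eq mmul_scale_right)
  next
    case False
    then show ?thesis by (simp add: mmul_def specht_proj_support)
  qed
qed

text \<open>\<open>mmul_proj_same\<close> gives the scalar only for row indices that are tabloids;
  multiplying by the projection on the left extends the identity to all indices.\<close>

lemma schur_same:
  assumes mu: "\<mu> \<in> int_partitions n" and A: "equivariant n A"
  obtains c where "mmul (tabloids \<mu>) (specht_proj \<mu>) (mmul (tabloids \<mu>) A (specht_proj \<mu>)) = (\<lambda>R S. c * specht_proj \<mu> R S)"
proof -
  obtain c where c: "\<And>R S. R \<in> tabloids \<mu> \<Longrightarrow> mmul (tabloids \<mu>) A (specht_proj \<mu>) R S = c * specht_proj \<mu> R S"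
    using mmul_proj_same[OF mu A] by blast
  have "mmul (tabloids \<mu>) (specht_proj \<mu>) (mmul (tabloids \<mu>) A (specht_proj \<mu>))
     = mmul (tabloids \<mu>) (specht_proj \<mu>) (\<lambda>R S. c * specht_proj \<mu> R S)"
    by (simp add: mmul_def[of _ "specht_proj \<mu>"] c)
  then show ?thesis using that[of c] by (simp add: mmul_scale_right specht_proj_idem[OF mu])
qed

text \<open>Vanishing is known only when \<open>\<mu>\<close> fails to dominate
  \<open>\<kappa>\<close>. For distinct partitions dominance fails in at least one direction, and
  taking adjoints exchanges the two.\<close>

lemma schur_diff:
  assumes la: "\<kappa> \<in> int_partitions n" and mu: "\<mu> \<in> int_partitions n" and neq: "\<kappa> \<noteq> \<mu>"
    and A: "equivariant n A"
  shows "mmul (tabloids \<kappa>) (specht_proj \<kappa>) (mmul (tabloids \<mu>) A (specht_proj \<mu>)) = (\<lambda>R S. 0)"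
proof -
  have vanish: "mmul (tabloids \<kappa>) (specht_proj \<kappa>) (mmul (tabloids \<mu>) A (specht_proj \<mu>)) = (\<lambda>R S. 0)"
    if la: "\<kappa> \<in> int_partitions n" and mu: "\<mu> \<in> int_partitions n" and A: "equivariant n A"
      and k: "\<not> top_rows \<kappa> k \<le> top_rows \<mu> k" for \<kappa> \<mu> A k
  proof -
    have "mmul (tabloids \<mu>) A (specht_proj \<mu>) R S = 0" if "R \<in> tabloids \<kappa>" for R S
      using mmul_gram_vanish[OF la mu A that k] by (simp add: specht_proj_eq mmul_scale_right)
    then show ?thesis by (simp add: mmul_def[of _ "specht_proj \<kappa>"])
  qed
  obtain k where "\<not> top_rows \<kappa> k \<le> top_rows \<mu> k \<or> \<not> top_rows \<mu> k \<le> top_rows \<kappa> k"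
    using top_rows_antisym[OF la mu] neq by blast
  then show ?thesis
  proof
    assume "\<not> top_rows \<kappa> k \<le> top_rows \<mu> k"
    then show ?thesis using vanish[OF la mu A] by blast
  next
    assume k: "\<not> top_rows \<mu> k \<le> top_rows \<kappa> k"
    have A': "equivariant n (adjoint A)" using A by (simp add: equivariant_def adjoint_def)
    have "adjoint (mmul (tabloids \<kappa>) (specht_proj \<kappa>) (mmul (tabloids \<mu>) A (specht_proj \<mu>)))
      = mmul (tabloids \<mu>) (specht_proj \<mu>) (mmul (tabloids \<kappa>) (adjoint A) (specht_proj \<kappa>))"
      by (simp add: adjoint_mmul mmul_assoc)
    also have "\<dots> = (\<lambda>R S. 0)" using vanish[OF mu la A' k] .
    finally show ?thesis by (simp add: adjoint_def fun_eq_iff)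
  qed
qed

text \<open>The trace of \<open>\<sigma>\<close> composed with the projection onto the Specht module.\<close>

definition specht_char :: "nat list \<Rightarrow> (nat \<Rightarrow> nat) \<Rightarrow> real" where
  "specht_char \<mu> \<sigma> = (\<Sum>R\<in>tabloids \<mu>. specht_proj \<mu> (pullback \<sigma> R) R)"

section \<open>Dimensions and orthogonality of the characters\<close>

lemma specht_char_id: "specht_char \<mu> id = mtrace (tabloids \<mu>) (specht_proj \<mu>)"
  by (simp add: specht_char_def mtrace_def)

text \<open>A symmetric idempotent has trace equal to the sum of its squared entries, and this one
  is nonzero because it fixes the base polytabloid.\<close>

lemma mtrace_proj_pos:
  assumes mu: "\<mu> \<in> int_partitions n"
  shows "mtrace (tabloids \<mu>) (specht_proj \<mu>) > 0"
proof -
  let ?X = "tabloids \<mu>"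
  have "mtrace ?X (specht_proj \<mu>) = mtrace ?X (mmul ?X (specht_proj \<mu>) (adjoint (specht_proj \<mu>)))"
    by (simp add: specht_proj_idem[OF mu])
  also have "\<dots> = (\<Sum>x\<in>?X. \<Sum>y\<in>?X. (specht_proj \<mu> x y)\<^sup>2)" by (rule mtrace_mmul_adjoint)
  finally have eq: "mtrace ?X (specht_proj \<mu>) = (\<Sum>x\<in>?X. \<Sum>y\<in>?X. (specht_proj \<mu> x y)\<^sup>2)" .
  have "\<exists>y\<in>?X. specht_proj \<mu> (base_tabloid \<mu>) y \<noteq> 0"
  proof (rule ccontr)
    assume "\<not> ?thesis"
    then have "(\<Sum>S\<in>?X. specht_proj \<mu> (base_tabloid \<mu>) S * base_polytabloid \<mu> S) = 0" by simp
    then show False by (simp add: specht_proj_rpolytabloid[OF mu base_tableau] rpolytabloid_self[OF base_tableau])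
  qed
  then obtain y where y: "y \<in> ?X" "specht_proj \<mu> (base_tabloid \<mu>) y \<noteq> 0" by blast
  have "(\<Sum>y\<in>?X. (specht_proj \<mu> (base_tabloid \<mu>) y)\<^sup>2) > 0"
    using y by (intro sum_pos2[OF _ y(1)]) auto
  then show ?thesis unfolding eq
    by (rule sum_pos2[OF finite_tabloids base_tabloid]) (intro sum_nonneg zero_le_power2)
qed

text \<open>The sum over the group of the translates of the matrix unit at \<open>(R, S)\<close>. It
  is the equivariant matrix to which Schur's lemma is applied in the orthogonality
  relations.\<close>

definition orbit_matrix :: "nat \<Rightarrow> tabloid \<Rightarrow> tabloid \<Rightarrow> tabloid \<Rightarrow> tabloid \<Rightarrow> real" where
  "orbit_matrix n R S = (\<lambda>R' S'. \<Sum>\<sigma>\<in>perms n. if R' = pullback \<sigma> R \<and> S' = pullback \<sigma> S then 1 else 0)"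

lemma pullback_inject:
  assumes "\<sigma> permutes S"
  shows "pullback \<sigma> R = pullback \<sigma> R' \<longleftrightarrow> R = R'"
proof
  assume "pullback \<sigma> R = pullback \<sigma> R'"
  then have "pullback (inv' \<sigma>) (pullback \<sigma> R) = pullback (inv' \<sigma>) (pullback \<sigma> R')"
    by (rule arg_cong)
  then show "R = R'" unfolding pullback_inv(1)[OF assms] .
qed simp

lemma equivariant_orbit_matrix: "equivariant n (orbit_matrix n R S)"
  unfolding equivariant_def
proof (intro ballI allI)
  fix \<tau> R' S' assume "\<tau> \<in> perms n"
  then have t: "\<tau> permutes {1..n}" by simp
  have "orbit_matrix n R S (pullback \<tau> R') (pullback \<tau> S') = (\<Sum>\<sigma>\<in>perms n.
     if pullback \<tau> R' = pullback (\<sigma> \<circ> \<tau>) R \<and> pullback \<tau> S' = pullback (\<sigma> \<circ> \<tau>) S then 1 else 0)"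
    unfolding orbit_matrix_def by (rule sum_perms_right[OF t, symmetric, where f = "\<lambda>\<sigma>.
      if pullback \<tau> R' = pullback \<sigma> R \<and> pullback \<tau> S' = pullback \<sigma> S then 1 else 0"])
  also have "\<dots> = orbit_matrix n R S R' S'"
    by (simp add: orbit_matrix_def pullback_comp pullback_inject[OF t])
  finally show "orbit_matrix n R S (pullback \<tau> R') (pullback \<tau> S') = orbit_matrix n R S R' S'" .
qed

lemma mmul_orbit_matrix_left:
  assumes S: "S \<in> tabloids \<mu>" and n: "sum_list \<mu> = n"
  shows "mmul (tabloids \<mu>) (orbit_matrix n R S) B y z
     = (\<Sum>\<sigma>\<in>perms n. if y = pullback \<sigma> R then B (pullback \<sigma> S) z else 0)"
proof -
  have s: "pullback \<sigma> S \<in> tabloids \<mu>" if "\<sigma> \<in> perms n" for \<sigma>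
    using that pullback_tabloids(1)[of \<sigma> \<mu> S] S unfolding n mem_Collect_eq by blast
  have "mmul (tabloids \<mu>) (orbit_matrix n R S) B y z = (\<Sum>\<sigma>\<in>perms n. \<Sum>w\<in>tabloids \<mu>.
     (if y = pullback \<sigma> R \<and> w = pullback \<sigma> S then 1 else 0) * B w z)"
    unfolding mmul_def orbit_matrix_def sum_distrib_right by (rule sum.swap)
  also have "\<dots> = (\<Sum>\<sigma>\<in>perms n. \<Sum>w\<in>tabloids \<mu>.
     (if w = pullback \<sigma> S then if y = pullback \<sigma> R then B (pullback \<sigma> S) z else 0 else 0))"
    by (intro sum.cong refl) auto
  also have "\<dots> = (\<Sum>\<sigma>\<in>perms n. if y = pullback \<sigma> R then B (pullback \<sigma> S) z else 0)"
    using s by (intro sum.cong refl) (simp add: sum.delta)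
  finally show ?thesis .
qed

lemma mmul_orbit_matrix:
  assumes R: "R \<in> tabloids \<kappa>" and S: "S \<in> tabloids \<mu>" and n: "sum_list \<kappa> = n" "sum_list \<mu> = n"
  shows "mmul (tabloids \<kappa>) A (mmul (tabloids \<mu>) (orbit_matrix n R S) B) x z
    = (\<Sum>\<sigma>\<in>perms n. A x (pullback \<sigma> R) * B (pullback \<sigma> S) z)"
proof -
  have s: "pullback \<sigma> R \<in> tabloids \<kappa>" if "\<sigma> \<in> perms n" for \<sigma>
    using that pullback_tabloids(1)[of \<sigma> \<kappa> R] R unfolding n mem_Collect_eq by blast
  have "mmul (tabloids \<kappa>) A (mmul (tabloids \<mu>) (orbit_matrix n R S) B) x z
    = (\<Sum>\<sigma>\<in>perms n. \<Sum>y\<in>tabloids \<kappa>. A x y * (if y = pullback \<sigma> R then B (pullback \<sigma> S) z else 0))"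
    unfolding mmul_def[of "tabloids \<kappa>"] mmul_orbit_matrix_left[OF S n(2)] sum_distrib_left by (rule sum.swap)
  also have "\<dots> = (\<Sum>\<sigma>\<in>perms n. \<Sum>y\<in>tabloids \<kappa>.
       (if y = pullback \<sigma> R then A x (pullback \<sigma> R) * B (pullback \<sigma> S) z else 0))"
    by (intro sum.cong refl) auto
  also have "\<dots> = (\<Sum>\<sigma>\<in>perms n. A x (pullback \<sigma> R) * B (pullback \<sigma> S) z)"
    using s by (intro sum.cong refl) (simp add: sum.delta)
  finally show ?thesis .
qed

text \<open>The diagonal sums are multiplied out and the sum over \<open>\<sigma>\<close> is carried
  out innermost. Symmetry of the projection puts \<open>\<sigma>\<close> on the column index of one
  factor, where the usual relation has an inverse.\<close>

lemma sum_specht_char_product: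
  assumes n: "sum_list \<kappa> = n" "sum_list \<mu> = n"
  shows "(\<Sum>\<sigma>\<in>perms n. specht_char \<kappa> \<sigma> * specht_char \<mu> \<sigma>)
    = (\<Sum>R\<in>tabloids \<kappa>. \<Sum>S\<in>tabloids \<mu>.
        mmul (tabloids \<kappa>) (specht_proj \<kappa>) (mmul (tabloids \<mu>) (orbit_matrix n R S) (specht_proj \<mu>)) R S)"
proof -
  have "(\<Sum>\<sigma>\<in>perms n. specht_char \<kappa> \<sigma> * specht_char \<mu> \<sigma>)
    = (\<Sum>\<sigma>\<in>perms n. \<Sum>R\<in>tabloids \<kappa>. \<Sum>S\<in>tabloids \<mu>.
        specht_proj \<kappa> R (pullback \<sigma> R) * specht_proj \<mu> (pullback \<sigma> S) S)"
    unfolding specht_char_def sum_product specht_proj_sym[of \<kappa> "pullback _ _"] by (rule refl)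
  also have "\<dots> = (\<Sum>R\<in>tabloids \<kappa>. \<Sum>\<sigma>\<in>perms n. \<Sum>S\<in>tabloids \<mu>.
        specht_proj \<kappa> R (pullback \<sigma> R) * specht_proj \<mu> (pullback \<sigma> S) S)"
    by (rule sum.swap)
  also have "\<dots> = (\<Sum>R\<in>tabloids \<kappa>. \<Sum>S\<in>tabloids \<mu>. \<Sum>\<sigma>\<in>perms n.
        specht_proj \<kappa> R (pullback \<sigma> R) * specht_proj \<mu> (pullback \<sigma> S) S)"
    by (intro sum.cong refl sum.swap)
  finally show ?thesis by (simp add: mmul_orbit_matrix n)
qed

lemma specht_char_orthogonal:
  assumes la: "\<kappa> \<in> int_partitions n" and mu: "\<mu> \<in> int_partitions n" and neq: "\<kappa> \<noteq> \<mu>"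
  shows "(\<Sum>\<sigma>\<in>perms n. specht_char \<kappa> \<sigma> * specht_char \<mu> \<sigma>) = 0"
proof -
  have n: "sum_list \<kappa> = n" "sum_list \<mu> = n" using la mu by (auto simp: int_partitions_def)
  show ?thesis
    unfolding sum_specht_char_product[OF n]
    by (simp add: schur_diff[OF la mu neq equivariant_orbit_matrix])
qed

text \<open>By Schur's lemma \<open>P E P = c P\<close> for each orbit matrix \<open>E\<close>; taking traces determines \<open>c\<close>.\<close>

lemma specht_char_norm:
  assumes mu: "\<mu> \<in> int_partitions n"
  shows "(\<Sum>\<sigma>\<in>perms n. specht_char \<mu> \<sigma> * specht_char \<mu> \<sigma>) = fact n"
proof -
  let ?X = "tabloids \<mu>" and ?P = "specht_proj \<mu>"
  have n: "sum_list \<mu> = n" using mu by (auto simp: int_partitions_def)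
  define d where "d = mtrace ?X ?P"
  have d: "d > 0" using mtrace_proj_pos[OF mu] by (simp add: d_def)
  have eq: "mmul ?X ?P (mmul ?X (orbit_matrix n R S) ?P) R S = fact n / d * (?P R S)\<^sup>2"
    if R: "R \<in> ?X" and S: "S \<in> ?X" for R S
  proof -
    let ?E = "orbit_matrix n R S"
    obtain c where c: "mmul ?X ?P (mmul ?X ?E ?P) = (\<lambda>R S. c * ?P R S)"
      by (rule schur_same[OF mu equivariant_orbit_matrix])
    have "c * d = mtrace ?X (mmul ?X ?P (mmul ?X ?E ?P))" by (simp add: c mtrace_scale d_def)
    also have "\<dots> = mtrace ?X (mmul ?X ?E (mmul ?X ?P ?P))"
      by (rule trans[OF mtrace_mmul_commute]) (simp only: mmul_assoc)
    also have "\<dots> = (\<Sum>x\<in>?X. \<Sum>\<sigma>\<in>perms n. if x = pullback \<sigma> R then ?P (pullback \<sigma> S) x else 0)"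
      unfolding specht_proj_idem[OF mu] mtrace_def mmul_orbit_matrix_left[OF S n] by (rule refl)
    also have "\<dots> = (\<Sum>\<sigma>\<in>perms n. \<Sum>x\<in>?X. if x = pullback \<sigma> R then ?P (pullback \<sigma> S) x else 0)"
      by (rule sum.swap)
    also have "\<dots> = (\<Sum>\<sigma>\<in>perms n. ?P S R)"
    proof (rule sum.cong[OF refl])
      fix \<sigma> assume "\<sigma> \<in> perms n"
      then have s: "\<sigma> permutes {1..sum_list \<mu>}" unfolding n by blast
      show "(\<Sum>x\<in>?X. if x = pullback \<sigma> R then ?P (pullback \<sigma> S) x else 0) = ?P S R"
        using pullback_tabloids(1)[OF s R] equivariantD[OF equivariant_specht_proj s, of S R]
        by (simp add: sum.delta)
    qed
    also have "\<dots> = fact n * ?P R S"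
      using card_perms[of n] by (simp add: specht_proj_sym[of _ S R])
    finally have "c = fact n / d * ?P R S" using d by (simp add: field_simps)
    then show ?thesis by (simp add: c power2_eq_square)
  qed
  have "(\<Sum>\<sigma>\<in>perms n. specht_char \<mu> \<sigma> * specht_char \<mu> \<sigma>)
    = (\<Sum>R\<in>?X. \<Sum>S\<in>?X. fact n / d * (?P R S)\<^sup>2)"
    unfolding sum_specht_char_product[OF n n] by (simp add: eq)
  also have "\<dots> = fact n / d * mtrace ?X (mmul ?X ?P (adjoint ?P))"
    by (simp only: mtrace_mmul_adjoint sum_distrib_left)
  also have "\<dots> = fact n" using d by (simp add: specht_proj_idem[OF mu] d_def)
  finally show ?thesis .
qed

section \<open>Comparison with the traces that define \<open>irr_char\<close>\<close>

lemma sum_fun_apply: "(\<Sum>a\<in>A. f a) x = (\<Sum>a\<in>A. f a x)"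
  by (induction A rule: infinite_finite_induct) auto

text \<open>The columns \<open>p S\<close> of the projection reproduce the module: \<open>f\<close>
  is the sum of \<open>f S\<close> times \<open>p S\<close>. Expanding basis vectors this way and
  exchanging sums gives a trace that no longer mentions the basis.\<close>

lemma irr_char_eq:
  assumes mu: "\<mu> \<in> int_partitions n" and sg: "\<sigma> permutes {1..n}"
  shows "irr_char \<mu> \<sigma> = of_real (specht_char \<mu> \<sigma>)"
proof -
  let ?X = "tabloids \<mu>" and ?V = "specht_module \<mu>"
  have n: "sum_list \<mu> = n" using mu by (auto simp: int_partitions_def)
  have s: "\<sigma> permutes {1..sum_list \<mu>}" using sg n by simp
  define p where "p S = (\<lambda>R. complex_of_real (specht_proj \<mu> R S))" for S
  \<comment> \<open>The fixed space of the projection, a subspace containing all polytabloids and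
    hence the Specht module.\<close>
  define W where "W = {f. \<forall>R. (\<Sum>S\<in>?X. f S * p S R) = f R}"
  have polyt: "polytabloid \<mu> t \<in> W" if t: "t \<in> tableaux \<mu>" for t
  proof -
    have "(\<Sum>S\<in>?X. polytabloid \<mu> t S * p S R) = polytabloid \<mu> t R" for R
    proof -
      have "(\<Sum>S\<in>?X. polytabloid \<mu> t S * p S R)
          = of_real (\<Sum>S\<in>?X. specht_proj \<mu> R S * rpolytabloid \<mu> t S)"
        by (simp only: polytabloid_rpolytabloid p_def of_real_sum of_real_mult mult.commute)
      then show ?thesis by (simp only: specht_proj_rpolytabloid[OF mu t] polytabloid_rpolytabloid)
    qed
    then show ?thesis by (simp only: W_def mem_Collect_eq simp_thms)
  qed
  have "cfun.subspace W"
  proof (rule cfun.subspaceI)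
    show "0 \<in> W" by (simp add: W_def)
    show "f + g \<in> W" if "f \<in> W" "g \<in> W" for f g
      using that by (simp add: W_def distrib_right sum.distrib)
    show "cscale c f \<in> W" if "f \<in> W" for c f
      using that by (simp add: W_def cscale_def mult.assoc sum_distrib_left[symmetric])
  qed
  then have "?V \<subseteq> W"
    using polyt unfolding specht_module_def by (intro cfun.span_minimal) auto
  then have repr: "(\<Sum>S\<in>?X. f S * p S R) = f R" if "f \<in> ?V" for f R
    using that by (auto simp: W_def)
  have pV: "p S \<in> ?V" for S
  proof -
    have "p S = (\<Sum>\<tau>\<in>perms n. cscale (of_real (base_polytabloid \<mu> (pullback \<tau> S) / gram_scale \<mu>))
        (polytabloid \<mu> (move \<mu> \<tau> (base_tableau \<mu>))))"
    proof
      fix R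
      have "specht_proj \<mu> R S = (\<Sum>\<tau>\<in>perms n. base_polytabloid \<mu> (pullback \<tau> S) / gram_scale \<mu>
          * rpolytabloid \<mu> (move \<mu> \<tau> (base_tableau \<mu>)) R)"
        by (simp add: specht_proj_def gram_def n sum_divide_distrib rpolytabloid_move[OF base_tableau] mult.commute)
      then show "p S R = (\<Sum>\<tau>\<in>perms n. cscale (of_real (base_polytabloid \<mu> (pullback \<tau> S) / gram_scale \<mu>))
        (polytabloid \<mu> (move \<mu> \<tau> (base_tableau \<mu>)))) R"
        unfolding sum_fun_apply cscale_def polytabloid_rpolytabloid p_def by simp
    qed
    also have "\<dots> \<in> ?V"
      unfolding specht_module_def
      by (intro cfun.span_sum cfun.span_scale cfun.span_base imageI move_tableaux[OF base_tableau])
        (simp add: n)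
    finally show ?thesis .
  qed
  have act_p: "perm_act \<sigma> (p S) \<in> ?V" for S
  proof -
    have "perm_act \<sigma> (p S) = p (pullback (inv' \<sigma>) S)"
      using equivariantD[OF equivariant_specht_proj s, of _ "pullback (inv' \<sigma>) S"]
      by (simp add: fun_eq_iff perm_act_pullback p_def pullback_inv[OF s])
    then show ?thesis using pV by simp
  qed
  define B where "B = (SOME B. cfun.independent B \<and> cfun.span B = ?V)"
  have subV: "cfun.subspace ?V" by (simp add: specht_module_def)
  obtain B0 where "B0 \<subseteq> ?V" "cfun.independent B0" "?V \<subseteq> cfun.span B0"
    using cfun.maximal_independent_subset[of ?V] by blast
  then have "cfun.independent B0 \<and> cfun.span B0 = ?V"
    using cfun.span_minimal[OF _ subV] by blast
  then have B: "cfun.independent B" "cfun.span B = ?V"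
    using someI[of "\<lambda>B. cfun.independent B \<and> cfun.span B = ?V"] unfolding B_def by blast+
  have fB: "finite B"
    using cfun.independent_span_bound[of "polytabloid \<mu> ` tableaux \<mu>" B] B cfun.span_superset[of B]
    by (simp add: specht_module_def)
  have aB: "perm_act \<sigma> (p S) \<in> cfun.span B" for S using act_p B(2) by simp
  have "irr_char \<mu> \<sigma> = (\<Sum>b\<in>B. cfun.representation B (perm_act \<sigma> b) b)"
    unfolding irr_char_def trace_on_def Let_def B_def[symmetric] by (rule refl)
  also have "\<dots> = (\<Sum>b\<in>B. \<Sum>S\<in>?X. b S * cfun.representation B (perm_act \<sigma> (p S)) b)"
  proof (rule sum.cong[OF refl])
    fix b assume b: "b \<in> B"
    then have "b \<in> ?V" using B cfun.span_superset by blast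
    then have "perm_act \<sigma> b R = (\<Sum>S\<in>?X. cscale (b S) (perm_act \<sigma> (p S))) R" for R
      unfolding perm_act_pullback sum_fun_apply cscale_def by (rule repr[symmetric])
    then have "perm_act \<sigma> b = (\<Sum>S\<in>?X. cscale (b S) (perm_act \<sigma> (p S)))" by blast
    then show "cfun.representation B (perm_act \<sigma> b) b
      = (\<Sum>S\<in>?X. b S * cfun.representation B (perm_act \<sigma> (p S)) b)"
      using cfun.representation_sum[OF B(1), of ?X "\<lambda>S. cscale (b S) (perm_act \<sigma> (p S))"]
        cfun.span_scale[OF aB] cfun.representation_scale[OF B(1) aB]
      by simp
  qed
  also have "\<dots> = (\<Sum>S\<in>?X. \<Sum>b\<in>B. cfun.representation B (perm_act \<sigma> (p S)) b * b S)"
    by (subst sum.swap) (simp add: mult.commute)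
  \<comment> \<open>The sum over \<open>B\<close> reassembles the vector
    \<open>perm_act \<sigma> (p S)\<close> from its coordinates, evaluated at
    \<open>S\<close>.\<close>
  also have "\<dots> = (\<Sum>S\<in>?X. perm_act \<sigma> (p S) S)"
  proof (rule sum.cong[OF refl])
    fix S
    have "(\<Sum>b\<in>B. cscale (cfun.representation B (perm_act \<sigma> (p S)) b) b) = perm_act \<sigma> (p S)"
      by (rule cfun.sum_representation_eq[OF B(1) aB fB order_refl])
    from fun_cong[OF this, of S]
    show "(\<Sum>b\<in>B. cfun.representation B (perm_act \<sigma> (p S)) b * b S) = perm_act \<sigma> (p S) S"
      unfolding sum_fun_apply cscale_def .
  qed
  also have "\<dots> = of_real (specht_char \<mu> \<sigma>)"
    by (simp add: perm_act_pullback p_def specht_char_def)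
  finally show ?thesis .
qed

section \<open>Restriction of Specht modules to a smaller symmetric group\<close>

text \<open>Only used when \<open>\<kappa>\<close> is a partition of \<open>n + 1\<close>; then these are the partitions obtained from
  \<open>\<kappa>\<close> by removing one cell.\<close>

definition lower_covers :: "nat \<Rightarrow> nat list \<Rightarrow> nat list set" where
  "lower_covers n \<kappa> = {\<mu> \<in> int_partitions n. cells \<mu> \<subseteq> cells \<kappa>}"

lemma finite_lower [simp]: "finite (lower_covers n \<kappa>)"
  by (simp add: lower_covers_def)

lemma int_partitions_card_cells: "\<mu> \<in> int_partitions n \<Longrightarrow> card (cells \<mu>) = n"
  by (simp add: int_partitions_def flip: sum_list_eq_card_cells)

lemma lower_added_cell:
  assumes "\<kappa> \<in> int_partitions (Suc n)" "\<mu> \<in> lower_covers n \<kappa>"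
  obtains c where "c \<notin> cells \<mu>" "cells \<kappa> = insert c (cells \<mu>)"
proof -
  have sub: "cells \<mu> \<subseteq> cells \<kappa>" and mu: "\<mu> \<in> int_partitions n" using assms(2) by (auto simp: lower_covers_def)
  have "card (cells \<kappa> - cells \<mu>) = 1"
    using sub int_partitions_card_cells[OF assms(1)] int_partitions_card_cells[OF mu]
    by (simp add: card_Diff_subset)
  then obtain c where "cells \<kappa> - cells \<mu> = {c}" by (auto simp: card_1_singleton_iff)
  then show ?thesis using that[of c] sub by blast
qed

definition add_entry :: "nat \<Rightarrow> nat \<Rightarrow> tabloid \<Rightarrow> tabloid" where
  "add_entry m i R = R(i := insert m (R i))"

text \<open>As an operator it evaluates a function on larger tabloids at
  \<open>add_entry m i R\<close>: tabloids with \<open>m\<close> in row \<open>i\<close> lose that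
  entry, all others are sent to zero.\<close>

definition add_entry_matrix :: "nat \<Rightarrow> nat \<Rightarrow> tabloid \<Rightarrow> tabloid \<Rightarrow> real" where
  "add_entry_matrix m i R S = (if S = add_entry m i R then 1 else 0)"

lemma pullback_add_entry:
  assumes s: "\<sigma> permutes {1..n}"
  shows "pullback \<sigma> (add_entry (Suc n) i R) = add_entry (Suc n) i (pullback \<sigma> R)"
proof -
  have fx: "\<sigma> (Suc n) = Suc n" by (rule permutes_not_in[OF s]) simp
  have "\<sigma> x = Suc n \<longleftrightarrow> x = Suc n" for x
    using permutes_inj[OF s] fx by (metis injD)
  then show ?thesis by (auto simp: pullback_def add_entry_def fun_eq_iff)
qed

lemma equivariant_add_entry_matrix: "equivariant n (add_entry_matrix (Suc n) i)"
  unfolding equivariant_def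
proof (intro ballI allI)
  fix \<sigma> R S assume "\<sigma> \<in> perms n"
  then have s: "\<sigma> permutes {1..n}" by simp
  show "add_entry_matrix (Suc n) i (pullback \<sigma> R) (pullback \<sigma> S) = add_entry_matrix (Suc n) i R S"
    by (simp add: add_entry_matrix_def pullback_add_entry[OF s, symmetric] pullback_inject[OF s])
qed

lemma equivariant_mono: "equivariant m A \<Longrightarrow> n \<le> m \<Longrightarrow> equivariant n A"
  unfolding equivariant_def using permutes_subset[of _ "{1..n}" "{1..m}"] by auto

lemma equivariant_mmul:
  assumes A: "equivariant m A" and B: "equivariant m B" and m: "m \<le> sum_list \<kappa>"
  shows "equivariant m (mmul (tabloids \<kappa>) A B)"
  unfolding equivariant_def
proof (intro ballI allI)
  fix \<sigma> R S assume "\<sigma> \<in> perms m"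
  then have s: "\<sigma> permutes {1..m}" by simp
  then have s': "\<sigma> permutes {1..sum_list \<kappa>}"
    by (rule permutes_subset) (use m in auto)
  have "mmul (tabloids \<kappa>) A B (pullback \<sigma> R) (pullback \<sigma> S)
    = (\<Sum>y\<in>tabloids \<kappa>. A (pullback \<sigma> R) (pullback \<sigma> y) * B (pullback \<sigma> y) (pullback \<sigma> S))"
    unfolding mmul_def by (rule sum_pullback_tabloids[OF s', symmetric])
  then show "mmul (tabloids \<kappa>) A B (pullback \<sigma> R) (pullback \<sigma> S) = mmul (tabloids \<kappa>) A B R S"
    by (simp add: equivariantD[OF A s] equivariantD[OF B s] mmul_def)
qed

lemma equivariant_adjoint: "equivariant n A \<Longrightarrow> equivariant n (adjoint A)"
  by (simp add: equivariant_def adjoint_def)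

lemma extend_tableau:
  assumes t: "t \<in> tableaux \<mu>" and n: "sum_list \<mu> = n" "sum_list \<kappa> = Suc n"
    and c: "c \<notin> cells \<mu>" "cells \<kappa> = insert c (cells \<mu>)"
  shows "t(c := Suc n) \<in> tableaux \<kappa>"
    and "x \<in> {1..n} \<Longrightarrow> position \<kappa> (t(c := Suc n)) x = position \<mu> t x"
    and "position \<kappa> (t(c := Suc n)) (Suc n) = c"
    and "tabloid_of \<kappa> (t(c := Suc n)) = add_entry (Suc n) (fst c) (tabloid_of \<mu> t)"
proof -
  have "bij_betw (t(c := Suc n)) (cells \<mu>) {1..n}"
    using tableaux_bij[OF t] c(1) n(1) by (subst bij_betw_cong[of _ _ t]) auto
  then have "bij_betw (t(c := Suc n)) (cells \<mu> \<union> {c}) ({1..n} \<union> {Suc n})"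
    by (rule bij_betw_combine) (auto simp: bij_betw_def)
  moreover have "{1..n} \<union> {Suc n} = {1..Suc n}" by auto
  ultimately have "bij_betw (t(c := Suc n)) (cells \<kappa>) {1..Suc n}" using c(2) by simp
  moreover have "t(c := Suc n) \<in> extensional (cells \<kappa>)"
    using t c(2) by (auto simp: tableaux_def extensional_def)
  ultimately show T: "t(c := Suc n) \<in> tableaux \<kappa>" using n by (simp add: tableaux_def)
  show "position \<kappa> (t(c := Suc n)) (Suc n) = c"
    using position_tableau(1)[OF T, of c] c(2) by simp
  show "position \<kappa> (t(c := Suc n)) x = position \<mu> t x" if x: "x \<in> {1..n}"
  proof -
    have "position \<mu> t x \<in> cells \<mu>" using bij_betwE[OF position_bij[OF t]] x n by blast
    moreover have "t (position \<mu> t x) = x" using position_tableau(2)[OF t] x n by blast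
    moreover from calculation(1) c have "position \<mu> t x \<noteq> c" by blast
    ultimately show ?thesis
      using position_tableau(1)[OF T, of "position \<mu> t x"] c(2) by simp
  qed
  show "tabloid_of \<kappa> (t(c := Suc n)) = add_entry (Suc n) (fst c) (tabloid_of \<mu> t)"
    using c by (auto simp: tabloid_of_def add_entry_def fun_eq_iff image_iff)
qed

lemma tabloids_subset: "R \<in> tabloids \<mu> \<Longrightarrow> R i \<subseteq> {1..sum_list \<mu>}"
  by (auto simp: tabloids_def tabloid_of_eq)

text \<open>A contributing column permutation of the extended tableau must fix \<open>Suc n\<close>:
  the entry sent to \<open>Suc n\<close> lies in the row of \<open>c\<close> by the tabloid
  condition and in the column of \<open>c\<close> by column preservation, hence in \<open>c\<close>
  itself. Both sums thus run over the same permutations.\<close>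

lemma rpolytabloid_add_entry:
  assumes t: "t \<in> tableaux \<mu>" and n: "sum_list \<mu> = n" "sum_list \<kappa> = Suc n"
    and c: "c \<notin> cells \<mu>" "cells \<kappa> = insert c (cells \<mu>)" and R: "R \<in> tabloids \<mu>"
  shows "rpolytabloid \<kappa> (t(c := Suc n)) (add_entry (Suc n) (fst c) R) = rpolytabloid \<mu> t R"
proof -
  let ?s = "t(c := Suc n)" and ?i = "fst c"
  note s = extend_tableau(1)[OF t n c] and pos = extend_tableau(2,3)[OF t n c]
    and tab = extend_tableau(4)[OF t n c]
  have notin: "Suc n \<notin> R ?i" "Suc n \<notin> tabloid_of \<mu> t ?i"
    using tabloids_subset[OF R, of ?i] n(1) by (auto simp: tabloid_of_eq[OF t])
  have eq: "{\<pi> \<in> column_stabilizer \<kappa> ?s. pullback \<pi> (add_entry (Suc n) ?i R) = tabloid_of \<kappa> ?s}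
    = {\<pi> \<in> column_stabilizer \<mu> t. pullback \<pi> R = tabloid_of \<mu> t}" (is "?A = ?B")
  proof (intro equalityI subsetI)
    fix \<pi> assume "\<pi> \<in> ?A"
    then have p: "\<pi> permutes {1..Suc n}"
      and col: "\<And>x. x \<in> {1..Suc n} \<Longrightarrow> snd (position \<kappa> ?s (\<pi> x)) = snd (position \<kappa> ?s x)"
      and pb: "pullback \<pi> (add_entry (Suc n) ?i R) = tabloid_of \<kappa> ?s"
      by (auto simp: column_stabilizer_iff[OF s] n)
    define y where "y = inv' \<pi> (Suc n)"
    have y: "\<pi> y = Suc n" by (simp add: y_def permutes_inverses[OF p])
    then have yN: "y \<in> {1..Suc n}" using permutes_in_image[OF p, of y] by simp
    have "y \<in> pullback \<pi> (add_entry (Suc n) ?i R) ?i"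
      by (simp add: pullback_def add_entry_def y)
    then have "fst (position \<kappa> ?s y) = ?i" unfolding pb tabloid_of_eq[OF s] by simp
    moreover have "snd (position \<kappa> ?s y) = snd c" using col[OF yN] by (simp only: y pos)
    ultimately have "position \<kappa> ?s y = position \<kappa> ?s (Suc n)" unfolding pos by (simp add: prod_eq_iff)
    then have "y = Suc n"
      using inj_onD[OF bij_betw_imp_inj_on[OF position_bij[OF s]], of y "Suc n"] yN n by simp
    then have fx: "\<pi> (Suc n) = Suc n" using y by simp
    have p': "\<pi> permutes {1..n}"
      by (rule permutes_superset[OF p]) (use fx in \<open>auto simp: le_Suc_eq\<close>)
    have "snd (position \<mu> t (\<pi> x)) = snd (position \<mu> t x)" if x: "x \<in> {1..n}" for x
    proof -
      have "\<pi> x \<in> {1..n}" using permutes_in_image[OF p'] x by blast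
      then show ?thesis using col[of x] x by (simp only: pos) simp
    qed
    then have C: "\<pi> \<in> column_stabilizer \<mu> t" using p' by (simp add: column_stabilizer_iff[OF t] n)
    have "add_entry (Suc n) ?i (pullback \<pi> R) = add_entry (Suc n) ?i (tabloid_of \<mu> t)"
      using pb by (simp only: tab pullback_add_entry[OF p'])
    moreover have "Suc n \<notin> pullback \<pi> R ?i" using notin fx by (simp add: pullback_def)
    ultimately have "pullback \<pi> R k = tabloid_of \<mu> t k" for k
      using notin(2) unfolding add_entry_def fun_eq_iff by (cases "k = ?i") (metis fun_upd_same insert_ident, metis fun_upd_other)
    then show "\<pi> \<in> ?B" using C by blast
  next
    fix \<pi> assume "\<pi> \<in> ?B"
    then have p: "\<pi> permutes {1..n}"
      and col: "\<And>x. x \<in> {1..n} \<Longrightarrow> snd (position \<mu> t (\<pi> x)) = snd (position \<mu> t x)"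
      and pb: "pullback \<pi> R = tabloid_of \<mu> t"
      by (auto simp: column_stabilizer_iff[OF t] n)
    have fx: "\<pi> (Suc n) = Suc n" by (rule permutes_not_in[OF p]) simp
    have p': "\<pi> permutes {1..Suc n}" by (rule permutes_subset[OF p]) auto
    have "snd (position \<kappa> ?s (\<pi> x)) = snd (position \<kappa> ?s x)" if x: "x \<in> {1..Suc n}" for x
    proof (cases "x = Suc n")
      case False
      then have x: "x \<in> {1..n}" using x by auto
      have "\<pi> x \<in> {1..n}" using permutes_in_image[OF p] x by blast
      then show ?thesis using col[OF x] x by (simp only: pos)
    qed (simp add: fx)
    then have "\<pi> \<in> column_stabilizer \<kappa> ?s" using p' by (simp add: column_stabilizer_iff[OF s] n)
    then show "\<pi> \<in> ?A" by (simp add: pullback_add_entry[OF p] pb tab)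
  qed
  have "rpolytabloid \<kappa> ?s (add_entry (Suc n) ?i R) = (\<Sum>\<pi>\<in>?A. of_int (sign \<pi>))"
    unfolding rpolytabloid_def by (rule sum.inter_filter[symmetric]) simp
  also have "\<dots> = (\<Sum>\<pi>\<in>?B. of_int (sign \<pi>))" by (simp only: eq)
  also have "\<dots> = rpolytabloid \<mu> t R"
    unfolding rpolytabloid_def by (rule sum.inter_filter) simp
  finally show ?thesis .
qed

text \<open>An equivariant partial isometry from the Specht module of \<open>\<kappa>\<close> onto
  that of \<open>\<mu>\<close>: the first conjunct makes it factor through both projections, the
  second normalizes it.\<close>

definition intertwiner :: "nat \<Rightarrow> nat list \<Rightarrow> nat list \<Rightarrow> (tabloid \<Rightarrow> tabloid \<Rightarrow> real) \<Rightarrow> bool" where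
  "intertwiner n \<kappa> \<mu> T \<longleftrightarrow>
    (\<exists>M. equivariant n M \<and> T = mmul (tabloids \<mu>) (specht_proj \<mu>) (mmul (tabloids \<kappa>) M (specht_proj \<kappa>))) \<and>
    mmul (tabloids \<kappa>) T (adjoint T) = specht_proj \<mu>"

text \<open>Inserting \<open>Suc n\<close> into the added cell relates a polytabloid of
  \<open>\<kappa>\<close> to one of \<open>\<mu>\<close>, so the compressed matrix \<open>T\<close>
  is nonzero. By Schur's lemma \<open>T\<close> times its adjoint is \<open>d\<close> times the
  projection; comparing traces gives \<open>d > 0\<close>, and \<open>T\<close> is divided by the
  square root of \<open>d\<close>.\<close>

lemma intertwiner_exists:
  assumes la: "\<kappa> \<in> int_partitions (Suc n)" and low: "\<mu> \<in> lower_covers n \<kappa>"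
  shows "\<exists>T. intertwiner n \<kappa> \<mu> T"
proof -
  let ?X = "tabloids \<kappa>" and ?Y = "tabloids \<mu>"
  have mu: "\<mu> \<in> int_partitions n" using low by (simp add: lower_covers_def)
  have n: "sum_list \<mu> = n" "sum_list \<kappa> = Suc n" using la mu by (auto simp: int_partitions_def)
  obtain c where c: "c \<notin> cells \<mu>" "cells \<kappa> = insert c (cells \<mu>)"
    using lower_added_cell[OF la low] by blast
  let ?t = "base_tableau \<mu>"
  define s where "s = ?t(c := Suc n)"
  have s: "s \<in> tableaux \<kappa>" unfolding s_def by (rule extend_tableau(1)[OF base_tableau n c])
  define B where "B = add_entry_matrix (Suc n) (fst c)"
  define T where "T = mmul ?Y (specht_proj \<mu>) (mmul ?X B (specht_proj \<kappa>))"
  \<comment> \<open>Vectors are written as matrices with one column, indexed by \<open>unit\<close>,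
    to make associativity of \<open>mmul\<close> available.\<close>
  define v where "v S (u::unit) = rpolytabloid \<kappa> s S" for S u
  define w where "w S (u::unit) = base_polytabloid \<mu> S" for S u
  have Pv: "mmul ?X (specht_proj \<kappa>) v = v"
    by (simp add: mmul_def v_def specht_proj_rpolytabloid[OF la s] fun_eq_iff)
  have Pw: "mmul ?Y (specht_proj \<mu>) w = w"
    by (simp add: mmul_def w_def specht_proj_rpolytabloid[OF mu base_tableau] fun_eq_iff)
  have Bv: "mmul ?X B v R u = w R u" if R: "R \<in> ?Y" for R u
  proof -
    have "mmul ?X B v R u = (\<Sum>S\<in>?X. if S = add_entry (Suc n) (fst c) R then rpolytabloid \<kappa> s S else 0)"
      unfolding mmul_def B_def add_entry_matrix_def v_def by (intro sum.cong refl) auto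
    also have "\<dots> = rpolytabloid \<kappa> s (add_entry (Suc n) (fst c) R)"
      using rpolytabloid_zero[OF s] by (simp add: sum.delta)
    also have "\<dots> = w R u" unfolding s_def w_def by (rule rpolytabloid_add_entry[OF base_tableau n c R])
    finally show ?thesis .
  qed
  have "mmul ?X T v = mmul ?Y (specht_proj \<mu>) (mmul ?X B v)" by (simp only: T_def mmul_assoc Pv)
  also have "\<dots> = mmul ?Y (specht_proj \<mu>) w" by (simp add: mmul_def[of ?Y] Bv)
  finally have "mmul ?X T v (base_tabloid \<mu>) () = 1"
    by (simp add: Pw) (simp add: w_def rpolytabloid_self[OF base_tableau])
  then obtain S where S: "S \<in> ?X" "T (base_tabloid \<mu>) S \<noteq> 0"
    unfolding mmul_def by (metis (no_types, lifting) mult_zero_left sum.neutral zero_neq_one)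
  have B: "equivariant n B" unfolding B_def by (rule equivariant_add_entry_matrix)
  have P: "equivariant n (specht_proj \<kappa>)" using equivariant_mono[OF equivariant_specht_proj[of \<kappa>]] n by simp
  define N where "N = mmul ?X (mmul ?X B (specht_proj \<kappa>)) (mmul ?X (specht_proj \<kappa>) (adjoint B))"
  have N: "equivariant n N"
    unfolding N_def using n by (intro equivariant_mmul B P equivariant_adjoint) auto
  have TN: "mmul ?X T (adjoint T) = mmul ?Y (specht_proj \<mu>) (mmul ?Y N (specht_proj \<mu>))"
    by (simp add: T_def N_def adjoint_mmul mmul_assoc)
  obtain d where d: "mmul ?Y (specht_proj \<mu>) (mmul ?Y N (specht_proj \<mu>)) = (\<lambda>R S. d * specht_proj \<mu> R S)"
    by (rule schur_same[OF mu N])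
  have "0 < (\<Sum>S\<in>?X. (T (base_tabloid \<mu>) S)\<^sup>2)"
    using S by (intro sum_pos2[OF _ S(1)]) auto
  then have "0 < (\<Sum>R\<in>?Y. \<Sum>S\<in>?X. (T R S)\<^sup>2)"
    by (rule sum_pos2[OF finite_tabloids base_tabloid]) (intro sum_nonneg zero_le_power2)
  also have "\<dots> = mtrace ?Y (mmul ?X T (adjoint T))" by (rule mtrace_mmul_adjoint[symmetric])
  also have "\<dots> = d * mtrace ?Y (specht_proj \<mu>)" unfolding TN d by (rule mtrace_scale)
  finally have d0: "d > 0" using mtrace_proj_pos[OF mu] by (simp add: zero_less_mult_iff)
  let ?T = "\<lambda>R S. inverse (sqrt d) * T R S" and ?M = "\<lambda>R S. inverse (sqrt d) * B R S"
  have "?T = mmul ?Y (specht_proj \<mu>) (mmul ?X ?M (specht_proj \<kappa>))"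
    by (simp only: mmul_scale_left mmul_scale_right T_def)
  moreover have "equivariant n ?M" using B by (simp add: equivariant_def)
  moreover have "mmul ?X ?T (adjoint ?T) = specht_proj \<mu>"
  proof -
    have "adjoint ?T = (\<lambda>R S. inverse (sqrt d) * adjoint T R S)" by (simp add: adjoint_def)
    then have "mmul ?X ?T (adjoint ?T) = (\<lambda>R S. inverse (sqrt d) * (inverse (sqrt d) * (d * specht_proj \<mu> R S)))"
      by (simp only: mmul_scale_left mmul_scale_right TN d)
    also have "\<dots> = specht_proj \<mu>"
    proof (intro ext)
      fix R S
      have "inverse (sqrt d) * (inverse (sqrt d) * (d * specht_proj \<mu> R S))
        = (inverse (sqrt d) * inverse (sqrt d) * d) * specht_proj \<mu> R S" by (simp only: mult.assoc)
      also have "inverse (sqrt d) * inverse (sqrt d) * d = 1"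
        using d0 by (simp add: inverse_mult_distrib[symmetric] del: inverse_mult_distrib)
      finally show "inverse (sqrt d) * (inverse (sqrt d) * (d * specht_proj \<mu> R S)) = specht_proj \<mu> R S" by simp
    qed
    finally show ?thesis .
  qed
  ultimately show ?thesis unfolding intertwiner_def by blast
qed

section \<open>Traces and orthogonality of intertwiners\<close>

context
  fixes n \<kappa> \<mu> T
  assumes la: "\<kappa> \<in> int_partitions (Suc n)" and mu: "\<mu> \<in> int_partitions n"
    and T: "intertwiner n \<kappa> \<mu> T"
begin

private lemma n: "sum_list \<mu> = n" "sum_list \<kappa> = Suc n"
  using la mu by (auto simp: int_partitions_def)

lemma intertwiner_specht_proj:
  "mmul (tabloids \<mu>) (specht_proj \<mu>) T = T" "mmul (tabloids \<kappa>) T (specht_proj \<kappa>) = T"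
proof -
  obtain M where M: "T = mmul (tabloids \<mu>) (specht_proj \<mu>) (mmul (tabloids \<kappa>) M (specht_proj \<kappa>))"
    using T by (auto simp: intertwiner_def)
  show "mmul (tabloids \<mu>) (specht_proj \<mu>) T = T"
    unfolding M by (simp only: mmul_assoc[symmetric] specht_proj_idem[OF mu])
  show "mmul (tabloids \<kappa>) T (specht_proj \<kappa>) = T"
    unfolding M by (simp only: mmul_assoc specht_proj_idem[OF la])
qed

lemma equivariant_intertwiner: "equivariant n T"
proof -
  obtain M where M: "equivariant n M" "T = mmul (tabloids \<mu>) (specht_proj \<mu>) (mmul (tabloids \<kappa>) M (specht_proj \<kappa>))"
    using T by (auto simp: intertwiner_def)
  show ?thesis
    unfolding M(2) using M(1) n
    by (intro equivariant_mmul equivariant_mono[OF equivariant_specht_proj[of \<kappa>]] equivariant_mono[OF equivariant_specht_proj[of \<mu>]]) auto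
qed

text \<open>The adjoint of \<open>T\<close> times \<open>T\<close> projects onto a copy of the
  smaller Specht module inside the larger one. Equivariance and exchange of sums move the trace of
  \<open>\<sigma>\<close> from this copy to the original.\<close>

lemma trace_intertwiner:
  assumes s: "\<sigma> permutes {1..n}"
  shows "(\<Sum>R\<in>tabloids \<kappa>. mmul (tabloids \<mu>) (adjoint T) T (pullback \<sigma> R) R) = specht_char \<mu> \<sigma>"
proof -
  have s': "\<sigma> permutes {1..sum_list \<mu>}" using s n by simp
  have "(\<Sum>R\<in>tabloids \<kappa>. mmul (tabloids \<mu>) (adjoint T) T (pullback \<sigma> R) R)
    = (\<Sum>R\<in>tabloids \<kappa>. \<Sum>U\<in>tabloids \<mu>. T (pullback \<sigma> U) (pullback \<sigma> R) * T (pullback \<sigma> U) R)"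
    unfolding mmul_def adjoint_def
    by (intro sum.cong refl sum_pullback_tabloids[OF s', symmetric])
  also have "\<dots> = (\<Sum>U\<in>tabloids \<mu>. \<Sum>R\<in>tabloids \<kappa>. T U R * T (pullback \<sigma> U) R)"
    unfolding equivariantD[OF equivariant_intertwiner s] by (rule sum.swap)
  also have "\<dots> = (\<Sum>U\<in>tabloids \<mu>. mmul (tabloids \<kappa>) T (adjoint T) (pullback \<sigma> U) U)"
    by (simp add: mmul_def adjoint_def mult.commute)
  also have "\<dots> = specht_char \<mu> \<sigma>"
    using T by (simp add: intertwiner_def specht_char_def)
  finally show ?thesis .
qed

lemma mtrace_intertwiner: "mtrace (tabloids \<kappa>) (mmul (tabloids \<mu>) (adjoint T) T) = specht_char \<mu> id"
  using T unfolding mtrace_mmul_commute[of "tabloids \<kappa>"] specht_char_id intertwiner_def by simp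

end

text \<open>\<open>T\<close> times the adjoint of \<open>U\<close> is an equivariant map between
  Specht modules of distinct partitions, which Schur's lemma annihilates.\<close>

lemma intertwiner_orthogonal:
  assumes la: "\<kappa> \<in> int_partitions (Suc n)" and mu: "\<mu> \<in> int_partitions n" "\<nu> \<in> int_partitions n"
    and T: "intertwiner n \<kappa> \<mu> T" "intertwiner n \<kappa> \<nu> U" and neq: "\<mu> \<noteq> \<nu>"
  shows "mmul (tabloids \<kappa>) T (adjoint U) = (\<lambda>R S. 0)"
proof -
  let ?X = "tabloids \<kappa>"
  have n: "sum_list \<mu> = n" "sum_list \<nu> = n" "sum_list \<kappa> = Suc n"
    using la mu by (auto simp: int_partitions_def)
  have e: "equivariant n (mmul ?X T (adjoint U))"
    using equivariant_intertwiner[OF la mu(1) T(1)] equivariant_intertwiner[OF la mu(2) T(2)] n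
    by (intro equivariant_mmul equivariant_adjoint) auto
  have "mmul ?X T (adjoint U)
    = mmul ?X (mmul (tabloids \<mu>) (specht_proj \<mu>) T) (adjoint (mmul (tabloids \<nu>) (specht_proj \<nu>) U))"
    by (simp only: intertwiner_specht_proj[OF la mu(1) T(1)] intertwiner_specht_proj[OF la mu(2) T(2)])
  also have "\<dots> = mmul (tabloids \<mu>) (specht_proj \<mu>) (mmul (tabloids \<nu>) (mmul ?X T (adjoint U)) (specht_proj \<nu>))"
    by (simp only: adjoint_mmul adjoint_specht_proj mmul_assoc)
  also have "\<dots> = (\<lambda>R S. 0)" by (rule schur_diff[OF mu neq e])
  finally show ?thesis .
qed

text \<open>The Hilbert-Schmidt inner product; the squared norm of an orthogonal projection is its
  trace.\<close>

definition inner_product :: "'a set \<Rightarrow> ('a \<Rightarrow> 'a \<Rightarrow> real) \<Rightarrow> ('a \<Rightarrow> 'a \<Rightarrow> real) \<Rightarrow> real" where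
  "inner_product X A B = (\<Sum>x\<in>X. \<Sum>y\<in>X. A x y * B x y)"

lemma inner_product_mtrace: "inner_product X A B = mtrace X (mmul X A (adjoint B))"
  by (simp add: inner_product_def mtrace_def mmul_def adjoint_def)

lemma inner_product_diff:
  "inner_product X (\<lambda>x y. A x y - B x y) C = inner_product X A C - inner_product X B C"
  "inner_product X C (\<lambda>x y. A x y - B x y) = inner_product X C A - inner_product X C B"
  by (simp_all add: inner_product_def sum_subtractf algebra_simps)

lemma inner_product_sum_left:
  "inner_product X (\<lambda>x y. \<Sum>i\<in>I. A i x y) C = (\<Sum>i\<in>I. inner_product X (A i) C)"
proof -
  have "inner_product X (\<lambda>x y. \<Sum>i\<in>I. A i x y) C
    = (\<Sum>x\<in>X. \<Sum>i\<in>I. \<Sum>y\<in>X. A i x y * C x y)"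
    unfolding inner_product_def sum_distrib_right by (intro sum.cong refl sum.swap)
  also have "\<dots> = (\<Sum>i\<in>I. inner_product X (A i) C)"
    unfolding inner_product_def by (rule sum.swap)
  finally show ?thesis .
qed

lemma inner_product_commute: "inner_product X A B = inner_product X B A"
  by (simp add: inner_product_def mult.commute)

text \<open>With the partial isometries \<open>T \<mu>\<close> onto the smaller Specht modules, \<open>Q = P - (\<Sum>\<mu>. (T \<mu>)\<^sup>T (T \<mu>))\<close>
  is the projection onto the part of the restricted module that they do not account for.\<close>

lemma branching_defect:
  assumes la: "\<kappa> \<in> int_partitions (Suc n)"
  shows "\<exists>Q. inner_product (tabloids \<kappa>) Q Q = specht_char \<kappa> id - (\<Sum>\<mu>\<in>lower_covers n \<kappa>. specht_char \<mu> id) \<and>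
    (\<forall>\<sigma>. \<sigma> permutes {1..n} \<longrightarrow> (\<Sum>R\<in>tabloids \<kappa>. Q (pullback \<sigma> R) R)
        = specht_char \<kappa> \<sigma> - (\<Sum>\<mu>\<in>lower_covers n \<kappa>. specht_char \<mu> \<sigma>))"
proof -
  let ?X = "tabloids \<kappa>" and ?L = "lower_covers n \<kappa>"
  have mu: "\<mu> \<in> int_partitions n" if "\<mu> \<in> ?L" for \<mu> using that by (simp add: lower_covers_def)
  obtain T where T: "\<And>\<mu>. \<mu> \<in> ?L \<Longrightarrow> intertwiner n \<kappa> \<mu> (T \<mu>)"
    using intertwiner_exists[OF la] by metis
  define E where "E \<mu> = mmul (tabloids \<mu>) (adjoint (T \<mu>)) (T \<mu>)" for \<mu>
  have E_sym: "adjoint (E \<mu>) = E \<mu>" for \<mu> by (simp add: E_def adjoint_mmul)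
  have PE: "inner_product ?X (specht_proj \<kappa>) (E \<mu>) = specht_char \<mu> id" if m: "\<mu> \<in> ?L" for \<mu>
  proof -
    have "inner_product ?X (specht_proj \<kappa>) (E \<mu>) = mtrace ?X (mmul ?X (E \<mu>) (specht_proj \<kappa>))"
      unfolding inner_product_mtrace E_sym by (rule mtrace_mmul_commute)
    also have "mmul ?X (E \<mu>) (specht_proj \<kappa>) = E \<mu>"
      by (simp only: E_def mmul_assoc intertwiner_specht_proj[OF la mu[OF m] T[OF m]])
    finally show ?thesis using mtrace_intertwiner[OF la mu[OF m] T[OF m]] by (simp add: E_def)
  qed
  have EE: "inner_product ?X (E \<mu>) (E \<nu>) = (if \<mu> = \<nu> then specht_char \<mu> id else 0)"
    if m: "\<mu> \<in> ?L" and v: "\<nu> \<in> ?L" for \<mu> \<nu>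
  proof -
    have eq: "inner_product ?X (E \<mu>) (E \<nu>)
      = mtrace ?X (mmul (tabloids \<mu>) (adjoint (T \<mu>)) (mmul (tabloids \<nu>) (mmul ?X (T \<mu>) (adjoint (T \<nu>))) (T \<nu>)))"
      unfolding inner_product_mtrace E_sym by (simp only: E_def mmul_assoc)
    show ?thesis
    proof (cases "\<mu> = \<nu>")
      case True
      note eq
      also have "mmul ?X (T \<mu>) (adjoint (T \<nu>)) = specht_proj \<nu>"
        using T[OF v] True by (simp add: intertwiner_def)
      also have "mmul (tabloids \<nu>) (specht_proj \<nu>) (T \<nu>) = T \<nu>"
        by (rule intertwiner_specht_proj(1)[OF la mu[OF v] T[OF v]])
      also have "mtrace ?X (mmul (tabloids \<mu>) (adjoint (T \<mu>)) (T \<nu>)) = specht_char \<mu> id"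
        using mtrace_intertwiner[OF la mu[OF m] T[OF m]] True by simp
      finally show ?thesis using True by simp
    next
      case False
      then show ?thesis
        using intertwiner_orthogonal[OF la mu[OF m] mu[OF v] T[OF m] T[OF v] False]
        by (simp add: eq) (simp add: mtrace_def)
    qed
  qed
  \<comment> \<open>A sum of mutually orthogonal projections inside the image of
    \<open>specht_proj \<kappa>\<close>. Its inner products with itself and with that projection
    therefore agree, and the squared norm of the difference is a difference of traces.\<close>
  define S where "S R U = (\<Sum>\<mu>\<in>?L. E \<mu> R U)" for R U
  have SP: "inner_product ?X S (specht_proj \<kappa>) = (\<Sum>\<mu>\<in>?L. specht_char \<mu> id)"
    unfolding S_def inner_product_sum_left
    by (intro sum.cong refl) (simp add: inner_product_commute[of ?X "E _"] PE)
  have "inner_product ?X S S = (\<Sum>\<mu>\<in>?L. inner_product ?X S (E \<mu>))"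
    unfolding S_def inner_product_sum_left inner_product_commute[of ?X _ "\<lambda>R U. \<Sum>\<mu>\<in>?L. E \<mu> R U"]
    by (rule refl)
  also have "\<dots> = (\<Sum>\<mu>\<in>?L. \<Sum>\<nu>\<in>?L. inner_product ?X (E \<nu>) (E \<mu>))"
    unfolding S_def inner_product_sum_left by (rule refl)
  also have "\<dots> = (\<Sum>\<mu>\<in>?L. specht_char \<mu> id)"
    by (intro sum.cong refl) (simp add: EE sum.delta)
  finally have SS: "inner_product ?X S S = (\<Sum>\<mu>\<in>?L. specht_char \<mu> id)" .
  have PP: "inner_product ?X (specht_proj \<kappa>) (specht_proj \<kappa>) = specht_char \<kappa> id"
    by (simp add: inner_product_mtrace specht_proj_idem[OF la] specht_char_id)
  show ?thesis
  proof (intro exI conjI allI impI)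
    show "inner_product ?X (\<lambda>R U. specht_proj \<kappa> R U - S R U) (\<lambda>R U. specht_proj \<kappa> R U - S R U)
      = specht_char \<kappa> id - (\<Sum>\<mu>\<in>?L. specht_char \<mu> id)"
      by (simp add: inner_product_diff PP SS SP inner_product_commute[of ?X "specht_proj \<kappa>" S])
    show "(\<Sum>R\<in>?X. specht_proj \<kappa> (pullback \<sigma> R) R - S (pullback \<sigma> R) R)
        = specht_char \<kappa> \<sigma> - (\<Sum>\<mu>\<in>?L. specht_char \<mu> \<sigma>)" if s: "\<sigma> permutes {1..n}" for \<sigma>
    proof -
      have "(\<Sum>R\<in>?X. S (pullback \<sigma> R) R) = (\<Sum>\<mu>\<in>?L. \<Sum>R\<in>?X. E \<mu> (pullback \<sigma> R) R)"
        unfolding S_def by (rule sum.swap)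
      also have "\<dots> = (\<Sum>\<mu>\<in>?L. specht_char \<mu> \<sigma>)"
        unfolding E_def by (intro sum.cong refl trace_intertwiner[OF la mu T s])
      finally show ?thesis by (simp add: sum_subtractf specht_char_def)
    qed
  qed
qed

lemma specht_dim_ge:
  assumes "\<kappa> \<in> int_partitions (Suc n)"
  shows "(\<Sum>\<mu>\<in>lower_covers n \<kappa>. specht_char \<mu> id) \<le> specht_char \<kappa> id"
proof -
  obtain Q where "inner_product (tabloids \<kappa>) Q Q
      = specht_char \<kappa> id - (\<Sum>\<mu>\<in>lower_covers n \<kappa>. specht_char \<mu> id)"
    using branching_defect[OF assms] by blast
  moreover have "inner_product (tabloids \<kappa>) Q Q \<ge> 0"
    by (simp add: inner_product_def sum_nonneg)
  ultimately show ?thesis by simp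
qed

text \<open>Equal dimensions give the defect \<open>Q\<close> norm zero, so \<open>Q\<close>
  vanishes entrywise and its trace against every \<open>\<sigma>\<close> is zero.\<close>

lemma specht_char_restrict_if_dim:
  assumes la: "\<kappa> \<in> int_partitions (Suc n)"
    and dim: "specht_char \<kappa> id = (\<Sum>\<mu>\<in>lower_covers n \<kappa>. specht_char \<mu> id)"
    and s: "\<sigma> permutes {1..n}"
  shows "specht_char \<kappa> \<sigma> = (\<Sum>\<mu>\<in>lower_covers n \<kappa>. specht_char \<mu> \<sigma>)"
proof -
  let ?X = "tabloids \<kappa>"
  obtain Q where Q: "inner_product ?X Q Q = specht_char \<kappa> id - (\<Sum>\<mu>\<in>lower_covers n \<kappa>. specht_char \<mu> id)"
    and mtrace: "\<And>\<sigma>. \<sigma> permutes {1..n} \<Longrightarrow> (\<Sum>R\<in>?X. Q (pullback \<sigma> R) R)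
        = specht_char \<kappa> \<sigma> - (\<Sum>\<mu>\<in>lower_covers n \<kappa>. specht_char \<mu> \<sigma>)"
    using branching_defect[OF la] by blast
  have "(\<Sum>x\<in>?X. \<Sum>y\<in>?X. Q x y * Q x y) = 0" using Q dim by (simp add: inner_product_def)
  then have "(\<Sum>y\<in>?X. Q x y * Q x y) = 0" if "x \<in> ?X" for x
    using that sum_nonneg_eq_0_iff[of ?X "\<lambda>x. \<Sum>y\<in>?X. Q x y * Q x y"] by (simp add: sum_nonneg)
  then have zero: "Q x y = 0" if "x \<in> ?X" "y \<in> ?X" for x y
    using that sum_nonneg_eq_0_iff[of ?X "\<lambda>y. Q x y * Q x y"] by simp
  have "\<sigma> permutes {1..sum_list \<kappa>}"
    using la by (intro permutes_subset[OF s]) (auto simp: int_partitions_def)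
  then have "(\<Sum>R\<in>?X. Q (pullback \<sigma> R) R) = 0"
    by (intro sum.neutral ballI zero pullback_tabloids(1))
  then show ?thesis using mtrace[OF s] by simp
qed

section \<open>Young's lattice\<close>

definition upper_covers :: "nat \<Rightarrow> nat list \<Rightarrow> nat list set" where
  "upper_covers n \<mu> = {\<kappa> \<in> int_partitions (Suc n). cells \<mu> \<subseteq> cells \<kappa>}"

lemma finite_upper [simp]: "finite (upper_covers n \<mu>)"
  by (simp add: upper_covers_def)

lemma cells_inject:
  assumes "\<mu> \<in> int_partitions n" "\<nu> \<in> int_partitions m"
  shows "cells \<mu> = cells \<nu> \<longleftrightarrow> \<mu> = \<nu>"
proof
  assume "cells \<mu> = cells \<nu>"
  then show "\<mu> = \<nu>" by (intro int_partitions_eqI[OF assms]) simp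
qed simp

lemma cells_inj_on: "inj_on cells (int_partitions n)"
  by (rule inj_onI) (simp only: cells_inject)

text \<open>Finite order ideals in the plane. Unlike lists of parts, they are visibly closed under
  union and intersection.\<close>

definition young_diagram :: "(nat \<times> nat) set \<Rightarrow> bool" where
  "young_diagram D \<longleftrightarrow> finite D \<and> (\<forall>i j i' j'. (i, j) \<in> D \<longrightarrow> i' \<le> i \<longrightarrow> j' \<le> j \<longrightarrow> (i', j') \<in> D)"

lemma young_diagramD:
  "young_diagram D \<Longrightarrow> (i, j) \<in> D \<Longrightarrow> i' \<le> i \<Longrightarrow> j' \<le> j \<Longrightarrow> (i', j') \<in> D"
  by (simp add: young_diagram_def)

lemma young_diagram_cells: "\<mu> \<in> int_partitions n \<Longrightarrow> young_diagram (cells \<mu>)"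
  using cells_down by (auto simp: young_diagram_def)

lemma initial_segment_nat:
  fixes A :: "nat set"
  assumes "finite A" "\<And>x y. x \<in> A \<Longrightarrow> y \<le> x \<Longrightarrow> y \<in> A"
  shows "A = {..<card A}"
proof -
  have sub: "A \<subseteq> {..<card A}"
  proof
    fix x assume "x \<in> A"
    have "{..x} \<subseteq> A" by (rule subsetI, rule assms(2)[OF \<open>x \<in> A\<close>]) simp
    then have "Suc x \<le> card A" using card_mono[OF assms(1), of "{..x}"] by simp
    then show "x \<in> {..<card A}" by simp
  qed
  then show ?thesis by (intro card_subset_eq) auto
qed

definition row_length :: "(nat \<times> nat) set \<Rightarrow> nat \<Rightarrow> nat" where
  "row_length D i = card {j. (i, j) \<in> D}"

lemma young_diagram_iff:
  assumes "young_diagram D"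
  shows "(i, j) \<in> D \<longleftrightarrow> j < row_length D i"
proof -
  have "{j. (i, j) \<in> D} \<subseteq> snd ` D" by force
  then have "finite {j. (i, j) \<in> D}"
    using assms finite_subset by (auto simp: young_diagram_def)
  then have "{j. (i, j) \<in> D} = {..<row_length D i}"
    unfolding row_length_def using young_diagramD[OF assms] by (intro initial_segment_nat) auto
  then show ?thesis by auto
qed

lemma row_length_antimono:
  assumes "young_diagram D" "i \<le> i'"
  shows "row_length D i' \<le> row_length D i"
proof (rule ccontr)
  assume "\<not> ?thesis"
  then have "(i', row_length D i) \<in> D" using assms by (simp add: young_diagram_iff)
  then have "(i, row_length D i) \<in> D" using young_diagramD[OF assms(1) _ assms(2)] by blast
  then show False using assms by (simp add: young_diagram_iff)
qed

lemma young_diagram_partition: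
  assumes "young_diagram D" "card D = n"
  obtains \<mu> where "\<mu> \<in> int_partitions n" "cells \<mu> = D"
proof -
  let ?r = "row_length D"
  \<comment> \<open>The number of nonempty rows; stopping there keeps zeros out of the list.\<close>
  define h where "h = card {i. (i, 0) \<in> D}"
  have "{i. (i, 0) \<in> D} \<subseteq> fst ` D" by force
  then have "finite {i. (i, 0) \<in> D}"
    using assms finite_subset by (auto simp: young_diagram_def)
  then have "{i. (i, 0) \<in> D} = {..<h}"
    unfolding h_def using young_diagramD[OF assms(1)] by (intro initial_segment_nat) auto
  then have h: "i < h \<longleftrightarrow> ?r i > 0" for i
    using young_diagram_iff[OF assms(1), of i 0] by blast
  define \<mu> where "\<mu> = map ?r [0..<h]"
  have "(i, j) \<in> cells \<mu> \<longleftrightarrow> (i, j) \<in> D" for i j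
    using h[of i] by (cases "i < h") (simp_all add: cells_def \<mu>_def young_diagram_iff[OF assms(1)])
  then have cells: "cells \<mu> = D" by auto
  moreover have "sorted_wrt (\<ge>) \<mu>"
    unfolding sorted_wrt_iff_nth_less
  proof (intro allI impI)
    fix i j assume "i < j" "j < length \<mu>"
    then show "\<mu> ! j \<le> \<mu> ! i"
      using row_length_antimono[OF assms(1), of i j] by (simp add: \<mu>_def)
  qed
  moreover have "0 \<notin> set \<mu>"
  proof
    assume "0 \<in> set \<mu>"
    then obtain i where "i < h" "?r i = 0" by (auto simp: \<mu>_def)
    then show False using h[of i] by simp
  qed
  moreover have "sum_list \<mu> = n" unfolding sum_list_eq_card_cells cells by (rule assms(2))
  ultimately have "\<mu> \<in> int_partitions n" unfolding int_partitions_def by blast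
  then show ?thesis using cells by (rule that)
qed

text \<open>A common upper cover can only be the union of the two diagrams and a common lower cover
  only their intersection. The sizes of union and intersection add up to twice \<open>Suc m\<close>,
  so both covers exist or neither does.\<close>

lemma card_upper_inter_neq:
  assumes mu: "\<mu> \<in> int_partitions (Suc m)" and nu: "\<nu> \<in> int_partitions (Suc m)" and neq: "\<mu> \<noteq> \<nu>"
  shows "card (upper_covers (Suc m) \<mu> \<inter> upper_covers (Suc m) \<nu>) = card (lower_covers m \<mu> \<inter> lower_covers m \<nu>)"
proof -
  let ?D = "cells \<mu>" and ?E = "cells \<nu>"
  have D: "card ?D = Suc m" "card ?E = Suc m" using mu nu by (simp_all add: int_partitions_card_cells)
  have total: "card (?D \<union> ?E) + card (?D \<inter> ?E) = 2 * Suc m"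
    using card_Un_Int[of ?D ?E] D by simp
  have "?D \<noteq> ?E" using neq cells_inject[OF mu nu] by simp
  then have "?D \<inter> ?E \<subset> ?D" using D card_subset_eq[of ?E ?D] by auto
  then have less: "card (?D \<inter> ?E) < Suc m" using psubset_card_mono[of ?D "?D \<inter> ?E"] D by simp
  have yU: "young_diagram (?D \<union> ?E)" and yI: "young_diagram (?D \<inter> ?E)"
    using young_diagram_cells[OF mu] young_diagram_cells[OF nu] unfolding young_diagram_def by blast+
  have U: "upper_covers (Suc m) \<mu> \<inter> upper_covers (Suc m) \<nu> = {\<kappa> \<in> int_partitions (Suc (Suc m)). cells \<kappa> = ?D \<union> ?E}"
  proof (intro equalityI subsetI)
    fix \<kappa> assume k: "\<kappa> \<in> upper_covers (Suc m) \<mu> \<inter> upper_covers (Suc m) \<nu>"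
    then have kp: "\<kappa> \<in> int_partitions (Suc (Suc m))" and sub: "?D \<union> ?E \<subseteq> cells \<kappa>" by (auto simp: upper_covers_def)
    have "card (cells \<kappa>) = Suc (Suc m)" using kp by (rule int_partitions_card_cells)
    then have "card (cells \<kappa>) \<le> card (?D \<union> ?E)" using total less by simp
    then have "?D \<union> ?E = cells \<kappa>" using sub by (intro card_seteq) auto
    then show "\<kappa> \<in> {\<kappa> \<in> int_partitions (Suc (Suc m)). cells \<kappa> = ?D \<union> ?E}" using kp by simp
  qed (auto simp: upper_covers_def)
  have L: "lower_covers m \<mu> \<inter> lower_covers m \<nu> = {\<kappa> \<in> int_partitions m. cells \<kappa> = ?D \<inter> ?E}"
  proof (intro equalityI subsetI)
    fix \<kappa> assume k: "\<kappa> \<in> lower_covers m \<mu> \<inter> lower_covers m \<nu>"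
    then have kp: "\<kappa> \<in> int_partitions m" and sub: "cells \<kappa> \<subseteq> ?D \<inter> ?E" by (auto simp: lower_covers_def)
    have "card (cells \<kappa>) = m" using kp by (rule int_partitions_card_cells)
    then have "card (?D \<inter> ?E) \<le> card (cells \<kappa>)" using less by simp
    then have "cells \<kappa> = ?D \<inter> ?E" using sub by (intro card_seteq) auto
    then show "\<kappa> \<in> {\<kappa> \<in> int_partitions m. cells \<kappa> = ?D \<inter> ?E}" using kp by simp
  qed (auto simp: lower_covers_def)
  have single: "card {\<kappa> \<in> int_partitions k. cells \<kappa> = G} = (if card G = k then 1 else 0)"
    if y: "young_diagram G" for G k
  proof (cases "card G = k")
    case True
    then obtain \<kappa> where k: "\<kappa> \<in> int_partitions k" "cells \<kappa> = G"
      using young_diagram_partition[OF y] by blast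
    then have "{\<kappa> \<in> int_partitions k. cells \<kappa> = G} = {\<kappa>}" using cells_inject by auto
    then show ?thesis using True by simp
  next
    case False
    then have "{\<kappa> \<in> int_partitions k. cells \<kappa> = G} = {}" using int_partitions_card_cells by auto
    then show ?thesis using False by simp
  qed
  have "card (?D \<union> ?E) = Suc (Suc m) \<longleftrightarrow> card (?D \<inter> ?E) = m" using total by arith
  then show ?thesis unfolding U L single[OF yU] single[OF yI] by simp
qed

text \<open>A cell can be removed at the end of row \<open>i\<close> exactly if the next row is
  shorter (\<open>i \<in> J\<close>). A cell can be added at the end of row \<open>Suc i\<close> for
  the same \<open>i\<close>, and always at the end of row 0.\<close>

lemma card_upper:
  assumes mu: "\<mu> \<in> int_partitions (Suc m)"
  shows "card (upper_covers (Suc m) \<mu>) = Suc (card (lower_covers m \<mu>))"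
proof -
  let ?D = "cells \<mu>" and ?r = "row_length (cells \<mu>)"
  note y = young_diagram_cells[OF mu]
  note iff = young_diagram_iff[OF y]
  note anti = row_length_antimono[OF y]
  have cardD: "card ?D = Suc m" using mu by (rule int_partitions_card_cells)
  define A where "A = {c. c \<notin> ?D \<and> young_diagram (insert c ?D)}"
  define B where "B = {c \<in> ?D. young_diagram (?D - {c})}"
  define J where "J = {i. ?r (Suc i) < ?r i}"
  have A: "A = (\<lambda>i. (i, ?r i)) ` insert 0 (Suc ` J)"
  proof (intro equalityI subsetI)
    fix c assume "c \<in> A"
    obtain i j where c: "c = (i, j)" by (cases c)
    have notin: "(i, j) \<notin> ?D" and yi: "young_diagram (insert (i, j) ?D)"
      using \<open>c \<in> A\<close> by (auto simp: A_def c)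
    have "j \<ge> ?r i" using notin by (simp add: iff)
    moreover have "j \<le> ?r i"
    proof (rule ccontr)
      assume gt: "\<not> j \<le> ?r i"
      then have "(i, ?r i) \<in> insert (i, j) ?D" using young_diagramD[OF yi, of i j i "?r i"] by simp
      then show False using gt by (simp add: iff)
    qed
    ultimately have j: "j = ?r i" by simp
    have "i \<in> insert 0 (Suc ` J)"
    proof (cases i)
      case (Suc k)
      have "(k, j) \<in> insert (i, j) ?D" using young_diagramD[OF yi, of i j k j] Suc by simp
      then have "?r i < ?r k" using Suc j by (simp add: iff)
      then show ?thesis using Suc by (simp add: J_def)
    qed simp
    then show "c \<in> (\<lambda>i. (i, ?r i)) ` insert 0 (Suc ` J)" unfolding c j by (rule imageI)
  next
    fix c assume "c \<in> (\<lambda>i. (i, ?r i)) ` insert 0 (Suc ` J)"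
    then obtain i where i: "i \<in> insert 0 (Suc ` J)" and c: "c = (i, ?r i)" by blast
    have "young_diagram (insert c ?D)"
      unfolding young_diagram_def
    proof (intro conjI allI impI)
      fix a b a' b' assume ab: "(a, b) \<in> insert c ?D" and le: "a' \<le> a" "b' \<le> b"
      show "(a', b') \<in> insert c ?D"
      proof (cases "(a, b) = c")
        case True
        show ?thesis
        proof (cases "a' = i")
          case True
          then show ?thesis using \<open>(a, b) = c\<close> c le by (auto simp: iff)
        next
          case False
          then have "a' < i" using \<open>(a, b) = c\<close> c le by simp
          then obtain k where k: "i = Suc k" "k \<in> J" using i by auto
          then have "?r i < ?r k" "?r k \<le> ?r a'" using \<open>a' < i\<close> anti[of a' k] by (auto simp: J_def)
          then show ?thesis using \<open>(a, b) = c\<close> c le by (simp add: iff)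
        qed
      next
        case False
        then show ?thesis using ab le young_diagramD[OF y] by blast
      qed
    qed simp
    then show "c \<in> A" by (simp add: A_def c iff)
  qed
  have B: "B = (\<lambda>i. (i, ?r i - 1)) ` J"
  proof (intro equalityI subsetI)
    fix c assume "c \<in> B"
    obtain i j where c: "c = (i, j)" by (cases c)
    have inn: "(i, j) \<in> ?D" and yi: "young_diagram (?D - {(i, j)})"
      using \<open>c \<in> B\<close> by (auto simp: B_def c)
    have "(i, Suc j) \<notin> ?D - {(i, j)}" using young_diagramD[OF yi, of i "Suc j" i j] by auto
    then have "?r i \<le> Suc j" by (simp add: iff)
    moreover have "j < ?r i" using inn by (simp add: iff)
    moreover have "(Suc i, j) \<notin> ?D - {(i, j)}" using young_diagramD[OF yi, of "Suc i" j i j] by auto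
    then have "?r (Suc i) \<le> j" by (simp add: iff)
    ultimately have "i \<in> J" "j = ?r i - 1" by (auto simp: J_def)
    then show "c \<in> (\<lambda>i. (i, ?r i - 1)) ` J" unfolding c by blast
  next
    fix c assume "c \<in> (\<lambda>i. (i, ?r i - 1)) ` J"
    then obtain i where i: "?r (Suc i) < ?r i" and c: "c = (i, ?r i - 1)" by (auto simp: J_def)
    have "young_diagram (?D - {c})"
      unfolding young_diagram_def
    proof (intro conjI allI impI)
      fix a b a' b' assume ab: "(a, b) \<in> ?D - {c}" and le: "a' \<le> a" "b' \<le> b"
      have "(a', b') \<noteq> c"
      proof
        assume eq: "(a', b') = c"
        show False
        proof (cases "a = i")
          case True
          then show False using ab le eq c by (auto simp: iff)
        next
          case False
          then have "?r a \<le> ?r (Suc i)" using eq c le by (intro anti) auto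
          then show False using ab le eq c i by (auto simp: iff)
        qed
      qed
      then show "(a', b') \<in> ?D - {c}" using ab le young_diagramD[OF y] by blast
    qed simp
    then show "c \<in> B" using i by (simp add: B_def c iff)
  qed
  have "finite B" by (simp add: B_def)
  then have finJ: "finite J"
    unfolding B by (rule finite_imageD) (auto simp: inj_on_def)
  have "cells ` upper_covers (Suc m) \<mu> = (\<lambda>c. insert c ?D) ` A"
  proof (intro equalityI subsetI)
    fix G assume "G \<in> cells ` upper_covers (Suc m) \<mu>"
    then obtain \<kappa> where k: "\<kappa> \<in> upper_covers (Suc m) \<mu>" and G: "G = cells \<kappa>" by blast
    have kp: "\<kappa> \<in> int_partitions (Suc (Suc m))" and "\<mu> \<in> lower_covers (Suc m) \<kappa>"
      using k mu by (auto simp: upper_covers_def lower_covers_def)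
    then obtain c where c: "c \<notin> ?D" "cells \<kappa> = insert c ?D" by (rule lower_added_cell)
    then show "G \<in> (\<lambda>c. insert c ?D) ` A"
      using young_diagram_cells[OF kp] by (auto simp: A_def G)
  next
    fix G assume "G \<in> (\<lambda>c. insert c ?D) ` A"
    then obtain c where c: "c \<notin> ?D" "young_diagram (insert c ?D)" "G = insert c ?D"
      by (auto simp: A_def)
    moreover have "card (insert c ?D) = Suc (Suc m)" using c(1) cardD by simp
    ultimately obtain \<kappa> where "\<kappa> \<in> int_partitions (Suc (Suc m))" "cells \<kappa> = G"
      using young_diagram_partition by metis
    then show "G \<in> cells ` upper_covers (Suc m) \<mu>" using c by (auto simp: upper_covers_def)
  qed
  moreover have "inj_on cells (upper_covers (Suc m) \<mu>)"
    using cells_inj_on by (rule inj_on_subset) (auto simp: upper_covers_def)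
  moreover have "inj_on (\<lambda>c. insert c ?D) A" by (rule inj_onI) (auto simp: A_def)
  ultimately have cardU: "card (upper_covers (Suc m) \<mu>) = card A" by (metis card_image)
  have "cells ` lower_covers m \<mu> = (\<lambda>c. ?D - {c}) ` B"
  proof (intro equalityI subsetI)
    fix G assume "G \<in> cells ` lower_covers m \<mu>"
    then obtain \<kappa> where k: "\<kappa> \<in> lower_covers m \<mu>" and G: "G = cells \<kappa>" by blast
    obtain c where c: "c \<notin> cells \<kappa>" "?D = insert c (cells \<kappa>)" using lower_added_cell[OF mu k] .
    then have G': "G = ?D - {c}" by (auto simp: G)
    have "young_diagram G" using k young_diagram_cells by (auto simp: lower_covers_def G)
    then have "c \<in> B" using c(2) G' by (simp add: B_def)
    then show "G \<in> (\<lambda>c. ?D - {c}) ` B" unfolding G' by (rule imageI)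
  next
    fix G assume "G \<in> (\<lambda>c. ?D - {c}) ` B"
    then obtain c where "c \<in> B" and G: "G = ?D - {c}" by blast
    then have c: "c \<in> ?D" "young_diagram (?D - {c})" by (simp_all add: B_def)
    have "card (?D - {c}) = m" using c(1) cardD by simp
    then obtain \<kappa> where k: "\<kappa> \<in> int_partitions m" "cells \<kappa> = ?D - {c}"
      by (rule young_diagram_partition[OF c(2)])
    have "\<kappa> \<in> lower_covers m \<mu>" using k by (auto simp: lower_covers_def)
    then show "G \<in> cells ` lower_covers m \<mu>" unfolding G k(2)[symmetric] by (rule imageI)
  qed
  moreover have "inj_on cells (lower_covers m \<mu>)"
    using cells_inj_on by (rule inj_on_subset) (auto simp: lower_covers_def)
  moreover have "inj_on (\<lambda>c. ?D - {c}) B" by (rule inj_onI) (auto simp: B_def)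
  ultimately have cardL: "card (lower_covers m \<mu>) = card B" by (metis card_image)
  have "card A = card (insert 0 (Suc ` J))"
    unfolding A by (rule card_image) (simp add: inj_on_def)
  also have "\<dots> = Suc (card J)" using finJ by (simp add: card_image)
  also have "card J = card B"
    unfolding B by (rule card_image[symmetric]) (simp add: inj_on_def)
  finally show ?thesis using cardU cardL by simp
qed

lemma int_partitions_0: "int_partitions 0 = {[]}"
proof -
  have "xs = []" if "0 \<notin> set xs" "sum_list xs = 0" for xs :: "nat list"
    using that by (cases xs) auto
  then show ?thesis by (auto simp: int_partitions_def)
qed

lemma int_partitions_1: "int_partitions (Suc 0) = {[Suc 0]}"
proof -
  have "xs = [Suc 0]" if "xs \<in> int_partitions (Suc 0)" for xs
  proof (cases xs)
    case (Cons a ys)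
    then have "a + sum_list ys = 1" "a \<noteq> 0" "0 \<notin> set ys" using that by (auto simp: int_partitions_def)
    then have "a = 1" "sum_list ys = 0" by linarith+
    with \<open>0 \<notin> set ys\<close> have "ys = []" by (cases ys) auto
    then show ?thesis using Cons \<open>a = 1\<close> by simp
  qed (use that in \<open>simp add: int_partitions_def\<close>)
  then show ?thesis by (auto simp: int_partitions_def)
qed

text \<open>The commutation relation \<open>D U = U D + I\<close> of Young's lattice as a
  differential poset, read entry by entry.\<close>

lemma card_upper_inter:
  assumes "\<mu> \<in> int_partitions (Suc m)" "\<nu> \<in> int_partitions (Suc m)"
  shows "card (upper_covers (Suc m) \<mu> \<inter> upper_covers (Suc m) \<nu>) = card (lower_covers m \<mu> \<inter> lower_covers m \<nu>) + (if \<mu> = \<nu> then 1 else 0)"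
  using card_upper_inter_neq[OF assms] card_upper[OF assms(1)] by auto

lemma upper_0: "upper_covers 0 [] = {[Suc 0]}"
  by (auto simp: upper_covers_def int_partitions_1 cells_def)

lemma sum_sum_filter_card:
  fixes g :: "'b \<Rightarrow> 'c::comm_semiring_1"
  assumes "finite A" "finite B"
  shows "(\<Sum>x\<in>A. \<Sum>y\<in>{y \<in> B. R x y}. g y) = (\<Sum>y\<in>B. of_nat (card {x \<in> A. R x y}) * g y)"
proof -
  have "(\<Sum>x\<in>A. \<Sum>y\<in>{y \<in> B. R x y}. g y) = (\<Sum>x\<in>A. \<Sum>y\<in>B. if R x y then g y else 0)"
    by (rule sum.cong[OF refl], rule sum.inter_filter[OF assms(2)])
  also have "\<dots> = (\<Sum>y\<in>B. \<Sum>x\<in>A. if R x y then g y else 0)"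
    by (rule sum.swap)
  also have "\<dots> = (\<Sum>y\<in>B. of_nat (card {x \<in> A. R x y}) * g y)"
    by (rule sum.cong[OF refl]) (simp add: sum.inter_filter[OF assms(1), symmetric])
  finally show ?thesis .
qed

lemma sum_upper_lower:
  fixes g :: "nat list \<Rightarrow> 'a::comm_semiring_1"
  assumes "\<mu> \<in> int_partitions n"
  shows "(\<Sum>\<kappa>\<in>upper_covers n \<mu>. \<Sum>\<nu>\<in>lower_covers n \<kappa>. g \<nu>)
    = (\<Sum>\<nu>\<in>int_partitions n. of_nat (card (upper_covers n \<mu> \<inter> upper_covers n \<nu>)) * g \<nu>)"
proof -
  have "upper_covers n \<mu> \<inter> upper_covers n \<nu> = {\<kappa> \<in> upper_covers n \<mu>. cells \<nu> \<subseteq> cells \<kappa>}" for \<nu>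
    by (auto simp: upper_covers_def)
  then show ?thesis
    using sum_sum_filter_card[OF finite_upper finite_int_partitions, where R = "\<lambda>\<kappa> \<nu>. cells \<nu> \<subseteq> cells \<kappa>" and g = g]
    by (simp add: lower_covers_def)
qed

lemma sum_lower_upper:
  fixes g :: "nat list \<Rightarrow> 'a::comm_semiring_1"
  assumes "\<mu> \<in> int_partitions (Suc n)"
  shows "(\<Sum>\<kappa>\<in>lower_covers n \<mu>. \<Sum>\<nu>\<in>upper_covers n \<kappa>. g \<nu>)
    = (\<Sum>\<nu>\<in>int_partitions (Suc n). of_nat (card (lower_covers n \<mu> \<inter> lower_covers n \<nu>)) * g \<nu>)"
proof -
  have "lower_covers n \<mu> \<inter> lower_covers n \<nu> = {\<kappa> \<in> lower_covers n \<mu>. cells \<kappa> \<subseteq> cells \<nu>}" for \<nu>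
    by (auto simp: lower_covers_def)
  then show ?thesis
    using sum_sum_filter_card[OF finite_lower finite_int_partitions, where R = "\<lambda>\<kappa> \<nu>. cells \<kappa> \<subseteq> cells \<nu>" and g = g]
    by (simp add: upper_covers_def)
qed

section \<open>Counting standard tableaux\<close>

lemma finite_standard_tableaux [simp]: "finite (standard_tableaux \<mu>)"
  by (rule finite_subset[OF _ finite_tableaux[of \<mu>]]) (auto simp: standard_tableaux_def)

lemma num_standard_tableaux_Nil: "num_standard_tableaux [] = 1"
proof -
  have "tableaux [] = {\<lambda>_. undefined}"
    by (auto simp: tableaux_def cells_def extensional_def fun_eq_iff bij_betw_def)
  then have "standard_tableaux [] = {\<lambda>_. undefined}"
    by (auto simp: standard_tableaux_def cells_def)
  then show ?thesis by (simp add: num_standard_tableaux_def)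
qed

text \<open>Since \<open>\<mu>\<close> is a diagram, \<open>\<kappa>\<close> has no cell to the
  right of \<open>c\<close> or below it, and \<open>Suc n\<close> exceeds all entries of
  \<open>t\<close>; so the comparisons involving \<open>c\<close> hold automatically.\<close>

lemma extend_standard_tableau_iff:
  assumes la: "\<kappa> \<in> int_partitions (Suc n)" and mu: "\<mu> \<in> int_partitions n"
    and c: "c \<notin> cells \<mu>" "cells \<kappa> = insert c (cells \<mu>)" and t: "t \<in> tableaux \<mu>"
  shows "t(c := Suc n) \<in> standard_tableaux \<kappa> \<longleftrightarrow> t \<in> standard_tableaux \<mu>"
proof -
  have n: "sum_list \<mu> = n" "sum_list \<kappa> = Suc n" using la mu by (auto simp: int_partitions_def)
  have T: "t(c := Suc n) \<in> tableaux \<kappa>" by (rule extend_tableau(1)[OF t n c])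
  have lt: "t d < Suc n" if "d \<in> cells \<mu>" for d
    using bij_betwE[OF tableaux_bij[OF t]] that n by fastforce
  have down: "(i, j) \<in> cells \<mu>" if "(i', j') \<in> cells \<mu>" "i \<le> i'" "j \<le> j'" for i j i' j'
    using cells_down[OF mu that] .
  show ?thesis
  proof
    assume s: "t(c := Suc n) \<in> standard_tableaux \<kappa>"
    have "t (i, j) < t (i, j')" if "j < j'" "(i, j) \<in> cells \<mu>" "(i, j') \<in> cells \<mu>" for i j j'
    proof -
      have "(t(c := Suc n)) (i, j) < (t(c := Suc n)) (i, j')"
        using s that c(2) by (simp only: standard_tableaux_def) blast
      moreover have "(i, j) \<noteq> c" "(i, j') \<noteq> c" using that c(1) by auto
      ultimately show ?thesis by simp
    qed
    moreover have "t (i, j) < t (i', j)" if "i < i'" "(i, j) \<in> cells \<mu>" "(i', j) \<in> cells \<mu>" for i i' j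
    proof -
      have "(t(c := Suc n)) (i, j) < (t(c := Suc n)) (i', j)"
        using s that c(2) by (simp only: standard_tableaux_def) blast
      moreover have "(i, j) \<noteq> c" "(i', j) \<noteq> c" using that c(1) by auto
      ultimately show ?thesis by simp
    qed
    ultimately show "t \<in> standard_tableaux \<mu>" using t by (simp add: standard_tableaux_def)
  next
    assume s: "t \<in> standard_tableaux \<mu>"
    have "(t(c := Suc n)) (i, j) < (t(c := Suc n)) (i, j')"
      if j: "j < j'" and m: "(i, j) \<in> cells \<kappa>" "(i, j') \<in> cells \<kappa>" for i j j'
    proof -
      have ne: "(i, j) \<noteq> c" using m c j down[of i j' i j] by auto
      then have ij: "(i, j) \<in> cells \<mu>" using m c by auto
      show ?thesis
      proof (cases "(i, j') = c")
        case True
        then show ?thesis using ne lt[OF ij] by simp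
      next
        case False
        then have "(i, j') \<in> cells \<mu>" using m c by auto
        then have "t (i, j) < t (i, j')" using s ij j by (simp add: standard_tableaux_def)
        then show ?thesis using ne False by simp
      qed
    qed
    moreover have "(t(c := Suc n)) (i, j) < (t(c := Suc n)) (i', j)"
      if j: "i < i'" and m: "(i, j) \<in> cells \<kappa>" "(i', j) \<in> cells \<kappa>" for i i' j
    proof -
      have ne: "(i, j) \<noteq> c" using m c j down[of i' j i j] by auto
      then have ij: "(i, j) \<in> cells \<mu>" using m c by auto
      show ?thesis
      proof (cases "(i', j) = c")
        case True
        then show ?thesis using ne lt[OF ij] by simp
      next
        case False
        then have "(i', j) \<in> cells \<mu>" using m c by auto
        then have "t (i, j) < t (i', j)" using s ij j by (simp add: standard_tableaux_def)
        then show ?thesis using ne False by simp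
      qed
    qed
    ultimately show "t(c := Suc n) \<in> standard_tableaux \<kappa>"
      using T unfolding standard_tableaux_def by blast
  qed
qed

text \<open>Standard tableaux are sorted by the shape that the entries up to \<open>n\<close>
  occupy: monotonicity makes the cell of \<open>Suc n\<close> removable, and restriction to the
  remaining cells inverts the extension.\<close>

lemma num_standard_tableaux_rec:
  assumes la: "\<kappa> \<in> int_partitions (Suc n)"
  shows "num_standard_tableaux \<kappa> = (\<Sum>\<mu>\<in>lower_covers n \<kappa>. num_standard_tableaux \<mu>)"
proof -
  have nk: "sum_list \<kappa> = Suc n" using la by (simp add: int_partitions_def)
  have mu: "\<mu> \<in> int_partitions n" "sum_list \<mu> = n" if "\<mu> \<in> lower_covers n \<kappa>" for \<mu>
    using that by (auto simp: lower_covers_def int_partitions_def)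
  define S where "S \<mu> = {s \<in> standard_tableaux \<kappa>. s ` cells \<mu> = {1..n}}" for \<mu>
  have cover: "standard_tableaux \<kappa> = (\<Union>\<mu>\<in>lower_covers n \<kappa>. S \<mu>)"
  proof (intro equalityI subsetI)
    fix s assume s: "s \<in> standard_tableaux \<kappa>"
    then have st: "s \<in> tableaux \<kappa>" by (simp add: standard_tableaux_def)
    define c where "c = position \<kappa> s (Suc n)"
    have c: "c \<in> cells \<kappa>" and sc: "s c = Suc n"
      using bij_betwE[OF position_bij[OF st]] position_tableau(2)[OF st, of "Suc n"] nk by (auto simp: c_def)
    have max: "s d \<le> Suc n" if "d \<in> cells \<kappa>" for d
      using bij_betwE[OF tableaux_bij[OF st]] that nk by fastforce
    have inj: "inj_on s (cells \<kappa>)" using tableaux_bij[OF st] by (rule bij_betw_imp_inj_on)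
    have "young_diagram (cells \<kappa> - {c})"
      unfolding young_diagram_def
    proof (intro conjI allI impI)
      fix a b a' b' assume ab: "(a, b) \<in> cells \<kappa> - {c}" and le: "a' \<le> a" "b' \<le> b"
      have in1: "(a', b') \<in> cells \<kappa>" and in2: "(a', b) \<in> cells \<kappa>"
        using ab le cells_down[OF la] by auto
      have "s (a', b') \<le> s (a', b)"
        using s in1 in2 le by (cases "b' = b") (auto simp: standard_tableaux_def intro: less_imp_le)
      also have "\<dots> \<le> s (a, b)"
        using s in2 ab le by (cases "a' = a") (auto simp: standard_tableaux_def intro: less_imp_le)
      also have "\<dots> < Suc n"
        using max[of "(a, b)"] ab sc inj_onD[OF inj, of "(a, b)" c] c by (auto simp: order_less_le)
      finally show "(a', b') \<in> cells \<kappa> - {c}" using in1 sc by auto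
    qed simp
    moreover have "card (cells \<kappa> - {c}) = n"
      using c int_partitions_card_cells[OF la] by simp
    ultimately obtain \<mu> where m: "\<mu> \<in> int_partitions n" "cells \<mu> = cells \<kappa> - {c}"
      using young_diagram_partition by metis
    have "s ` cells \<mu> = s ` cells \<kappa> - {s c}"
      using inj c by (simp add: m(2) inj_on_image_set_diff[OF inj])
    also have "\<dots> = {1..n}" using tableaux_bij[OF st] nk sc by (auto simp: bij_betw_def)
    finally have "s \<in> S \<mu>" using s by (simp add: S_def)
    moreover have "\<mu> \<in> lower_covers n \<kappa>" using m by (auto simp: lower_covers_def)
    ultimately show "s \<in> (\<Union>\<mu>\<in>lower_covers n \<kappa>. S \<mu>)" by blast
  qed (auto simp: S_def)
  have disj: "S \<mu> \<inter> S \<nu> = {}" if m: "\<mu> \<in> lower_covers n \<kappa>" "\<nu> \<in> lower_covers n \<kappa>" "\<mu> \<noteq> \<nu>" for \<mu> \<nu>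
  proof (rule ccontr)
    assume "\<not> ?thesis"
    then obtain s where "s \<in> S \<mu>" "s \<in> S \<nu>" by blast
    then have s: "s \<in> standard_tableaux \<kappa>" "s ` cells \<mu> = s ` cells \<nu>" by (simp_all add: S_def)
    have "inj_on s (cells \<kappa>)"
      using s tableaux_bij[of s \<kappa>] by (auto simp: standard_tableaux_def dest: bij_betw_imp_inj_on)
    then have "cells \<mu> = cells \<nu>"
      using s(2) m by (subst (asm) inj_on_image_eq_iff) (auto simp: lower_covers_def)
    then show False using cells_inject[OF mu(1)[OF m(1)] mu(1)[OF m(2)]] m(3) by simp
  qed
  have card: "card (S \<mu>) = num_standard_tableaux \<mu>" if m: "\<mu> \<in> lower_covers n \<kappa>" for \<mu>
  proof -
    obtain c where c: "c \<notin> cells \<mu>" "cells \<kappa> = insert c (cells \<mu>)" using lower_added_cell[OF la m] .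
    have "bij_betw (\<lambda>t. t(c := Suc n)) (standard_tableaux \<mu>) (S \<mu>)"
    proof (rule bij_betwI')
      fix t u assume tu: "t \<in> standard_tableaux \<mu>" "u \<in> standard_tableaux \<mu>"
      then have "t \<in> extensional (cells \<mu>)" "u \<in> extensional (cells \<mu>)"
        by (simp_all add: standard_tableaux_def tableaux_def)
      then have e: "t c = undefined" "u c = undefined"
        using c(1) by (auto intro: extensional_arb)
      show "(t(c := Suc n) = u(c := Suc n)) = (t = u)"
      proof
        assume eq: "t(c := Suc n) = u(c := Suc n)"
        have "t d = u d" for d using fun_cong[OF eq, of d] e by (cases "d = c") auto
        then show "t = u" by blast
      qed simp
    next
      fix t assume t: "t \<in> standard_tableaux \<mu>"
      then have tt: "t \<in> tableaux \<mu>" by (simp add: standard_tableaux_def)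
      have "(t(c := Suc n)) ` cells \<mu> = t ` cells \<mu>" using c(1) by (intro image_cong) auto
      also have "\<dots> = {1..n}" using tableaux_bij[OF tt] mu(2)[OF m] by (simp add: bij_betw_def)
      finally show "t(c := Suc n) \<in> S \<mu>"
        using extend_standard_tableau_iff[OF la mu(1)[OF m] c tt] t by (simp add: S_def)
    next
      fix s assume s: "s \<in> S \<mu>"
      then have st: "s \<in> tableaux \<kappa>" by (simp add: S_def standard_tableaux_def)
      define t where "t = restrict s (cells \<mu>)"
      have inj: "inj_on s (cells \<kappa>)" using tableaux_bij[OF st] by (rule bij_betw_imp_inj_on)
      have "bij_betw s (cells \<mu>) {1..n}"
        using s c inj_on_subset[OF inj, of "cells \<mu>"] by (auto simp: S_def bij_betw_def)
      then have "bij_betw t (cells \<mu>) {1..n}"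
        using bij_betw_cong[of "cells \<mu>" s t "{1..n}"] by (simp add: t_def)
      then have tt: "t \<in> tableaux \<mu>" using mu(2)[OF m] by (simp add: tableaux_def t_def)
      have "s ` cells \<kappa> = {1..Suc n}" using tableaux_bij[OF st] nk by (simp add: bij_betw_def)
      then have "insert (s c) {1..n} = {1..Suc n}" using s c(2) by (simp add: S_def)
      then have "Suc n \<in> insert (s c) {1..n}" by simp
      then have sc: "s c = Suc n" by auto
      have "s \<in> extensional (cells \<kappa>)" using st by (simp add: tableaux_def)
      then have "s d = (t(c := Suc n)) d" for d
        using c sc extensional_arb[of s "cells \<kappa>" d] by (simp add: t_def)
      then have eq: "s = t(c := Suc n)" by blast
      moreover have "t \<in> standard_tableaux \<mu>"
        using extend_standard_tableau_iff[OF la mu(1)[OF m] c tt] s eq by (simp add: S_def)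
      ultimately show "\<exists>t\<in>standard_tableaux \<mu>. s = t(c := Suc n)" by blast
    qed
    then show ?thesis unfolding num_standard_tableaux_def by (rule bij_betw_same_card[symmetric])
  qed
  have "num_standard_tableaux \<kappa> = (\<Sum>\<mu>\<in>lower_covers n \<kappa>. card (S \<mu>))"
    unfolding num_standard_tableaux_def
    by (subst cover, rule card_UN_disjoint) (use disj in \<open>auto simp: S_def\<close>)
  then show ?thesis using card by simp
qed

text \<open>The counts are reproduced by summing over lower covers, so by
  \<open>D U = U D + I\<close> the factor grows by one from each level to the next.\<close>

lemma sum_upper_num_standard_tableaux:
  "\<mu> \<in> int_partitions n \<Longrightarrow> (\<Sum>\<kappa>\<in>upper_covers n \<mu>. num_standard_tableaux \<kappa>) = Suc n * num_standard_tableaux \<mu>"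
proof (induction n arbitrary: \<mu>)
  case 0
  then have "\<mu> = []" by (simp add: int_partitions_0)
  moreover have "lower_covers 0 [Suc 0] = {[]}" by (auto simp: lower_covers_def int_partitions_0 cells_def)
  ultimately show ?case
    using num_standard_tableaux_rec[of "[Suc 0]" 0] by (simp add: upper_0 int_partitions_1)
next
  case (Suc m)
  let ?f = num_standard_tableaux
  have "(\<Sum>\<kappa>\<in>upper_covers (Suc m) \<mu>. ?f \<kappa>) = (\<Sum>\<kappa>\<in>upper_covers (Suc m) \<mu>. \<Sum>\<nu>\<in>lower_covers (Suc m) \<kappa>. ?f \<nu>)"
    by (intro sum.cong refl num_standard_tableaux_rec) (simp add: upper_covers_def)
  also have "\<dots> = (\<Sum>\<nu>\<in>int_partitions (Suc m). card (upper_covers (Suc m) \<mu> \<inter> upper_covers (Suc m) \<nu>) * ?f \<nu>)"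
    using sum_upper_lower[OF Suc.prems, of ?f] by simp
  also have "\<dots> = (\<Sum>\<nu>\<in>int_partitions (Suc m). card (lower_covers m \<mu> \<inter> lower_covers m \<nu>) * ?f \<nu>)
      + (\<Sum>\<nu>\<in>int_partitions (Suc m). if \<mu> = \<nu> then ?f \<nu> else 0)"
    unfolding sum.distrib[symmetric]
    by (intro sum.cong refl) (simp add: card_upper_inter[OF Suc.prems] distrib_right)
  also have "(\<Sum>\<nu>\<in>int_partitions (Suc m). if \<mu> = \<nu> then ?f \<nu> else 0) = ?f \<mu>"
    using Suc.prems by (simp add: sum.delta')
  also have "(\<Sum>\<nu>\<in>int_partitions (Suc m). card (lower_covers m \<mu> \<inter> lower_covers m \<nu>) * ?f \<nu>)
      = (\<Sum>\<kappa>\<in>lower_covers m \<mu>. \<Sum>\<nu>\<in>upper_covers m \<kappa>. ?f \<nu>)"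
    using sum_lower_upper[OF Suc.prems, of ?f] by simp
  also have "\<dots> = (\<Sum>\<kappa>\<in>lower_covers m \<mu>. Suc m * ?f \<kappa>)"
    by (intro sum.cong refl Suc.IH) (simp add: lower_covers_def)
  also have "\<dots> = Suc m * ?f \<mu>"
    using num_standard_tableaux_rec[OF Suc.prems] by (simp add: sum_distrib_left)
  finally show ?case by simp
qed

text \<open>One factor of each square is expanded over lower covers; after exchanging the sums, the
  other factor is summed over upper covers.\<close>

lemma sum_num_standard_tableaux_squared:
  "(\<Sum>\<mu>\<in>int_partitions n. (num_standard_tableaux \<mu>)\<^sup>2) = fact n"
proof (induction n)
  case 0
  then show ?case by (simp add: int_partitions_0 num_standard_tableaux_Nil)
next
  case (Suc n)
  let ?f = num_standard_tableaux
  have "(\<Sum>\<kappa>\<in>int_partitions (Suc n). (?f \<kappa>)\<^sup>2)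
    = (\<Sum>\<kappa>\<in>int_partitions (Suc n). \<Sum>\<mu>\<in>lower_covers n \<kappa>. ?f \<kappa> * ?f \<mu>)"
    by (rule sum.cong[OF refl])
      (simp add: power2_eq_square sum_distrib_left[symmetric] num_standard_tableaux_rec[symmetric])
  also have "\<dots> = (\<Sum>\<mu>\<in>int_partitions n. \<Sum>\<kappa>\<in>upper_covers n \<mu>. ?f \<kappa> * ?f \<mu>)"
    unfolding lower_covers_def upper_covers_def by (rule sum.swap_restrict) simp_all
  also have "\<dots> = (\<Sum>\<mu>\<in>int_partitions n. Suc n * (?f \<mu>)\<^sup>2)"
    by (rule sum.cong[OF refl])
      (simp only: sum_distrib_right[symmetric] sum_upper_num_standard_tableaux power2_eq_square mult.assoc)
  also have "\<dots> = fact (Suc n)" unfolding sum_distrib_left[symmetric] Suc by simp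
  finally show ?case .
qed

section \<open>Restricted characters and multiplication by the number of fixed points\<close>

text \<open>Keeps the simplifier from turning \<open>{1..n}\<close> into \<open>{Suc 0..n}\<close>.\<close>

declare One_nat_def [simp del]

section \<open>Bessel's inequality and the dimensions of Specht modules\<close>

lemma specht_char_gram:
  assumes "\<mu> \<in> int_partitions n" "\<nu> \<in> int_partitions n"
  shows "(\<Sum>\<sigma>\<in>perms n. specht_char \<mu> \<sigma> * specht_char \<nu> \<sigma>) = (if \<mu> = \<nu> then fact n else 0)"
  using specht_char_norm[OF assms(1)] specht_char_orthogonal[OF assms] by (cases "\<mu> = \<nu>") simp_all

text \<open>The squared norm of the remainder for arbitrary coefficients. It yields Bessel's
  inequality, and it also proves an expansion exact once the norms are seen to cancel.\<close>

lemma sum_square_minus_specht_chars: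
  "(\<Sum>\<sigma>\<in>perms n. (F \<sigma> - (\<Sum>\<mu>\<in>int_partitions n. a \<mu> * specht_char \<mu> \<sigma>))\<^sup>2)
    = (\<Sum>\<sigma>\<in>perms n. (F \<sigma>)\<^sup>2)
      - 2 * (\<Sum>\<mu>\<in>int_partitions n. a \<mu> * (\<Sum>\<sigma>\<in>perms n. F \<sigma> * specht_char \<mu> \<sigma>))
      + fact n * (\<Sum>\<mu>\<in>int_partitions n. (a \<mu>)\<^sup>2)"
proof -
  let ?P = "int_partitions n"
  define S where "S \<sigma> = (\<Sum>\<mu>\<in>?P. a \<mu> * specht_char \<mu> \<sigma>)" for \<sigma>
  have FS: "(\<Sum>\<sigma>\<in>perms n. F \<sigma> * S \<sigma>)
    = (\<Sum>\<mu>\<in>?P. a \<mu> * (\<Sum>\<sigma>\<in>perms n. F \<sigma> * specht_char \<mu> \<sigma>))"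
    unfolding S_def sum_distrib_left by (subst sum.swap) (simp add: mult_ac)
  have "(\<Sum>\<sigma>\<in>perms n. S \<sigma> * S \<sigma>)
    = (\<Sum>\<sigma>\<in>perms n. \<Sum>\<mu>\<in>?P. \<Sum>\<nu>\<in>?P. (a \<mu> * a \<nu>) * (specht_char \<mu> \<sigma> * specht_char \<nu> \<sigma>))"
    unfolding S_def sum_product by (intro sum.cong refl) (simp only: mult_ac)
  also have "\<dots> = (\<Sum>\<mu>\<in>?P. \<Sum>\<sigma>\<in>perms n. \<Sum>\<nu>\<in>?P. (a \<mu> * a \<nu>) * (specht_char \<mu> \<sigma> * specht_char \<nu> \<sigma>))"
    by (rule sum.swap)
  also have "\<dots> = (\<Sum>\<mu>\<in>?P. \<Sum>\<nu>\<in>?P. \<Sum>\<sigma>\<in>perms n. (a \<mu> * a \<nu>) * (specht_char \<mu> \<sigma> * specht_char \<nu> \<sigma>))"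
    by (rule sum.cong[OF refl], rule sum.swap)
  also have "\<dots> = (\<Sum>\<mu>\<in>?P. \<Sum>\<nu>\<in>?P. (a \<mu> * a \<nu>) * (if \<mu> = \<nu> then fact n else 0))"
    unfolding sum_distrib_left[symmetric] by (intro sum.cong refl) (simp add: specht_char_gram)
  also have "\<dots> = (\<Sum>\<mu>\<in>?P. \<Sum>\<nu>\<in>?P. if \<mu> = \<nu> then fact n * (a \<mu>)\<^sup>2 else 0)"
    by (intro sum.cong refl) (simp add: power2_eq_square)
  also have "\<dots> = fact n * (\<Sum>\<mu>\<in>?P. (a \<mu>)\<^sup>2)"
    by (simp add: sum_distrib_left)
  finally have SS: "(\<Sum>\<sigma>\<in>perms n. S \<sigma> * S \<sigma>) = fact n * (\<Sum>\<mu>\<in>?P. (a \<mu>)\<^sup>2)" .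
  have "(\<Sum>\<sigma>\<in>perms n. (F \<sigma> - S \<sigma>)\<^sup>2)
    = (\<Sum>\<sigma>\<in>perms n. (F \<sigma>)\<^sup>2) - 2 * (\<Sum>\<sigma>\<in>perms n. F \<sigma> * S \<sigma>) + (\<Sum>\<sigma>\<in>perms n. S \<sigma> * S \<sigma>)"
    unfolding sum_distrib_left sum_subtractf[symmetric] sum.distrib[symmetric]
    by (intro sum.cong refl) (simp add: power2_eq_square algebra_simps)
  then show ?thesis unfolding FS SS unfolding S_def .
qed

text \<open>Bessel's inequality for the character \<open>F\<close> of the regular representation,
  whose coefficients are the dimensions.\<close>

lemma sum_specht_dim_squared_le: "(\<Sum>\<mu>\<in>int_partitions n. (specht_char \<mu> id)\<^sup>2) \<le> fact n"
proof -
  let ?D = "\<Sum>\<mu>\<in>int_partitions n. (specht_char \<mu> id)\<^sup>2"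
  define F where "F \<sigma> = (if \<sigma> = id then fact n else 0::real)" for \<sigma> :: "nat \<Rightarrow> nat"
  have id: "id \<in> perms n" by (simp add: permutes_id)
  have 1: "(\<Sum>\<sigma>\<in>perms n. (F \<sigma>)\<^sup>2) = (fact n)\<^sup>2"
  proof -
    have "(\<Sum>\<sigma>\<in>perms n. (F \<sigma>)\<^sup>2) = (\<Sum>\<sigma>\<in>perms n. if \<sigma> = id then (fact n)\<^sup>2 else 0)"
      by (intro sum.cong refl) (simp add: F_def)
    then show ?thesis using id sum.delta[of "perms n" id "\<lambda>_. (fact n)\<^sup>2 :: real"] by simp
  qed
  have 2: "(\<Sum>\<sigma>\<in>perms n. F \<sigma> * specht_char \<mu> \<sigma>) = fact n * specht_char \<mu> id" for \<mu>
  proof -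
    have "(\<Sum>\<sigma>\<in>perms n. F \<sigma> * specht_char \<mu> \<sigma>)
      = (\<Sum>\<sigma>\<in>perms n. if \<sigma> = id then fact n * specht_char \<mu> \<sigma> else 0)"
      by (intro sum.cong refl) (simp add: F_def)
    then show ?thesis using id sum.delta[of "perms n" id "\<lambda>\<sigma>. fact n * specht_char \<mu> \<sigma>"] by simp
  qed
  have "0 \<le> (\<Sum>\<sigma>\<in>perms n. (F \<sigma> - (\<Sum>\<mu>\<in>int_partitions n. specht_char \<mu> id * specht_char \<mu> \<sigma>))\<^sup>2)"
    by (intro sum_nonneg zero_le_power2)
  also have "\<dots> = (fact n)\<^sup>2 - 2 * (fact n * ?D) + fact n * ?D"
    unfolding sum_square_minus_specht_chars 1 2
    by (simp add: sum_distrib_left power2_eq_square mult_ac)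
  finally have "fact n * ?D \<le> fact n * fact n" by (simp add: power2_eq_square)
  then show ?thesis by simp
qed

lemma specht_dim:
  "\<mu> \<in> int_partitions n \<Longrightarrow> specht_char \<mu> id = real (num_standard_tableaux \<mu>)"
proof (induction n arbitrary: \<mu>)
  case 0
  then have mu: "\<mu> = []" by (simp add: int_partitions_0)
  have "perms 0 = {id}" by auto
  then have "specht_char [] id * specht_char [] id = 1"
    using specht_char_norm[of "[]" 0] by (simp add: int_partitions_0)
  moreover have "specht_char [] id > 0"
    unfolding specht_char_id by (rule mtrace_proj_pos[of _ 0]) (simp add: int_partitions_0)
  ultimately have "specht_char [] id = 1" by (simp only: square_eq_1_iff) linarith
  then show ?case unfolding mu num_standard_tableaux_Nil by (simp only: of_nat_1)
next
  case (Suc n)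
  let ?P = "int_partitions (Suc n)" and ?f = "\<lambda>\<mu>. real (num_standard_tableaux \<mu>)"
  have ge: "?f \<kappa> \<le> specht_char \<kappa> id" if k: "\<kappa> \<in> ?P" for \<kappa>
  proof -
    have "?f \<kappa> = (\<Sum>\<mu>\<in>lower_covers n \<kappa>. ?f \<mu>)" using num_standard_tableaux_rec[OF k] by simp
    also have "\<dots> = (\<Sum>\<mu>\<in>lower_covers n \<kappa>. specht_char \<mu> id)"
      by (intro sum.cong refl Suc.IH[symmetric]) (simp add: lower_covers_def)
    also have "\<dots> \<le> specht_char \<kappa> id" by (rule specht_dim_ge[OF k])
    finally show ?thesis .
  qed
  have le: "(?f \<kappa>)\<^sup>2 \<le> (specht_char \<kappa> id)\<^sup>2" if "\<kappa> \<in> ?P" for \<kappa>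
    using ge[OF that] by (intro power_mono) auto
  have "(\<Sum>\<kappa>\<in>?P. (?f \<kappa>)\<^sup>2) = real (\<Sum>\<kappa>\<in>?P. (num_standard_tableaux \<kappa>)\<^sup>2)" by simp
  also have "\<dots> = fact (Suc n)" unfolding sum_num_standard_tableaux_squared by (rule of_nat_fact)
  finally have f: "(\<Sum>\<kappa>\<in>?P. (?f \<kappa>)\<^sup>2) = fact (Suc n)" .
  have eq: "(\<Sum>\<kappa>\<in>?P. (?f \<kappa>)\<^sup>2) = (\<Sum>\<kappa>\<in>?P. (specht_char \<kappa> id)\<^sup>2)"
  proof (rule antisym)
    show "(\<Sum>\<kappa>\<in>?P. (?f \<kappa>)\<^sup>2) \<le> (\<Sum>\<kappa>\<in>?P. (specht_char \<kappa> id)\<^sup>2)" by (intro sum_mono le)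
    show "(\<Sum>\<kappa>\<in>?P. (specht_char \<kappa> id)\<^sup>2) \<le> (\<Sum>\<kappa>\<in>?P. (?f \<kappa>)\<^sup>2)"
      unfolding f by (rule sum_specht_dim_squared_le)
  qed
  have "(?f \<mu>)\<^sup>2 = (specht_char \<mu> id)\<^sup>2"
    by (rule sum_mono_inv[OF eq le Suc.prems]) simp_all
  moreover have "specht_char \<mu> id \<ge> 0" using ge[OF Suc.prems] by linarith
  ultimately have "specht_char \<mu> id = ?f \<mu>" by simp
  then show ?case .
qed

lemma specht_char_restrict:
  assumes "\<kappa> \<in> int_partitions (Suc n)" "\<sigma> permutes {1..n}"
  shows "specht_char \<kappa> \<sigma> = (\<Sum>\<mu>\<in>lower_covers n \<kappa>. specht_char \<mu> \<sigma>)"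
proof (rule specht_char_restrict_if_dim[OF assms(1) _ assms(2)])
  have "specht_char \<kappa> id = (\<Sum>\<mu>\<in>lower_covers n \<kappa>. real (num_standard_tableaux \<mu>))"
    using specht_dim[OF assms(1)] num_standard_tableaux_rec[OF assms(1)] by simp
  also have "\<dots> = (\<Sum>\<mu>\<in>lower_covers n \<kappa>. specht_char \<mu> id)"
    by (intro sum.cong refl specht_dim[of _ n, symmetric]) (simp add: lower_covers_def)
  finally show "specht_char \<kappa> id = (\<Sum>\<mu>\<in>lower_covers n \<kappa>. specht_char \<mu> id)" .
qed

section \<open>Class functions, fixed points and Frobenius reciprocity\<close>

definition class_function :: "nat \<Rightarrow> ((nat \<Rightarrow> nat) \<Rightarrow> real) \<Rightarrow> bool" where
  "class_function n F \<longleftrightarrow> (\<forall>\<sigma>\<in>perms n. \<forall>\<tau>\<in>perms n. F (\<tau> \<circ> \<sigma> \<circ> inv' \<tau>) = F \<sigma>)"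

lemma class_function_specht_char:
  assumes "\<mu> \<in> int_partitions n"
  shows "class_function n (specht_char \<mu>)"
  unfolding class_function_def
proof (intro ballI)
  fix \<sigma> \<tau> assume "\<sigma> \<in> perms n" "\<tau> \<in> perms n"
  then have t: "\<tau> permutes {1..sum_list \<mu>}" using assms by (simp add: int_partitions_def)
  have i: "inv' \<tau> permutes {1..sum_list \<mu>}" by (rule permutes_inv[OF t])
  have "specht_char \<mu> (\<tau> \<circ> \<sigma> \<circ> inv' \<tau>)
    = (\<Sum>R\<in>tabloids \<mu>. specht_proj \<mu> (pullback (\<tau> \<circ> \<sigma> \<circ> inv' \<tau>) (pullback (inv' \<tau>) R)) (pullback (inv' \<tau>) R))"
    unfolding specht_char_def by (rule sum_pullback_tabloids[OF i, symmetric])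
  also have "\<dots> = specht_char \<mu> \<sigma>"
    by (simp add: pullback_comp pullback_inv[OF t] equivariantD[OF equivariant_specht_proj i] specht_char_def)
  finally show "specht_char \<mu> (\<tau> \<circ> \<sigma> \<circ> inv' \<tau>) = specht_char \<mu> \<sigma>" .
qed

definition num_fixpoints :: "nat \<Rightarrow> (nat \<Rightarrow> nat) \<Rightarrow> real" where
  "num_fixpoints n \<sigma> = (\<Sum>i\<in>{1..n}. if \<sigma> i = i then 1 else 0)"

lemma num_fixpoints_Suc: "\<sigma> permutes {1..n} \<Longrightarrow> num_fixpoints (Suc n) \<sigma> = num_fixpoints n \<sigma> + 1"
  using permutes_not_in[of \<sigma> "{1..n}" "Suc n"] by (simp add: num_fixpoints_def)

lemma num_fixpoints_0 [simp]: "num_fixpoints 0 \<sigma> = 0"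
  by (simp add: num_fixpoints_def)

lemma conjugation_bij:
  assumes t: "\<tau> permutes {1..n::nat}"
  shows "bij_betw (\<lambda>\<sigma>. \<tau> \<circ> \<sigma> \<circ> inv' \<tau>) (perms n) (perms n)"
proof (rule bij_betw_byWitness[where f' = "\<lambda>\<sigma>. inv' \<tau> \<circ> \<sigma> \<circ> \<tau>"])
  have i: "inv' \<tau> permutes {1..n}" by (rule permutes_inv[OF t])
  show "(\<lambda>\<sigma>. \<tau> \<circ> \<sigma> \<circ> inv' \<tau>) ` perms n \<subseteq> perms n"
    using permutes_compose[OF permutes_compose[OF i] t] by (auto simp: comp_assoc)
  show "(\<lambda>\<sigma>. inv' \<tau> \<circ> \<sigma> \<circ> \<tau>) ` perms n \<subseteq> perms n"
    using permutes_compose[OF permutes_compose[OF t] i] by (auto simp: comp_assoc)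
  have "inv' \<tau> \<circ> (\<tau> \<circ> \<sigma> \<circ> inv' \<tau>) \<circ> \<tau> = \<sigma>" "\<tau> \<circ> (inv' \<tau> \<circ> \<sigma> \<circ> \<tau>) \<circ> inv' \<tau> = \<sigma>" for \<sigma>
    by (simp_all only: comp_assoc inv_comp_cancel[OF t] permutes_inv_o[OF t] comp_id)
  then show "\<forall>\<sigma>\<in>perms n. inv' \<tau> \<circ> (\<tau> \<circ> \<sigma> \<circ> inv' \<tau>) \<circ> \<tau> = \<sigma>"
    "\<forall>\<sigma>\<in>perms n. \<tau> \<circ> (inv' \<tau> \<circ> \<sigma> \<circ> \<tau>) \<circ> inv' \<tau> = \<sigma>" by blast+
qed

lemma class_function_num_fixpoints: "class_function n (num_fixpoints n)"
  unfolding class_function_def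
proof (intro ballI)
  fix \<sigma> \<tau> assume "\<sigma> \<in> perms n" "\<tau> \<in> perms n"
  then have t: "\<tau> permutes {1..n}" by simp
  have "num_fixpoints n (\<tau> \<circ> \<sigma> \<circ> inv' \<tau>)
    = (\<Sum>i\<in>{1..n}. if (\<tau> \<circ> \<sigma> \<circ> inv' \<tau>) (\<tau> i) = \<tau> i then 1 else 0)"
    unfolding num_fixpoints_def by (rule sum.reindex_bij_betw[OF permutes_imp_bij[OF t], symmetric])
  also have "\<dots> = num_fixpoints n \<sigma>"
    unfolding num_fixpoints_def
    by (intro sum.cong refl if_cong) (simp_all add: permutes_inverses[OF t] inj_eq[OF permutes_inj[OF t]])
  finally show "num_fixpoints n (\<tau> \<circ> \<sigma> \<circ> inv' \<tau>) = num_fixpoints n \<sigma>" .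
qed

lemma class_function_mult: "class_function n F \<Longrightarrow> class_function n G \<Longrightarrow> class_function n (\<lambda>\<sigma>. F \<sigma> * G \<sigma>)"
  by (simp add: class_function_def)

lemma class_function_power: "class_function n F \<Longrightarrow> class_function n (\<lambda>\<sigma>. F \<sigma> ^ k)"
  by (simp add: class_function_def)

lemma perms_fixing_last: "{\<sigma> \<in> perms (Suc n). \<sigma> (Suc n) = Suc n} = perms n"
proof (intro equalityI subsetI)
  fix \<sigma> assume "\<sigma> \<in> {\<sigma> \<in> perms (Suc n). \<sigma> (Suc n) = Suc n}"
  then show "\<sigma> \<in> perms n"
    by (auto intro!: permutes_superset[of \<sigma> "{1..Suc n}" "{1..n}"] simp: le_Suc_eq)
next
  fix \<sigma> assume "\<sigma> \<in> perms n"
  then have "\<sigma> permutes {1..n}" by simp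
  then show "\<sigma> \<in> {\<sigma> \<in> perms (Suc n). \<sigma> (Suc n) = Suc n}"
    using permutes_subset[of \<sigma> "{1..n}" "{1..Suc n}"] permutes_not_in[of \<sigma> "{1..n}" "Suc n"] by auto
qed

text \<open>All points contribute equally: conjugation by the transposition of \<open>i\<close> and
  \<open>Suc n\<close> turns the permutations fixing \<open>i\<close> into those fixing
  \<open>Suc n\<close>, which form \<open>perms n\<close>.\<close>

lemma sum_num_fixpoints_mult:
  assumes F: "class_function (Suc n) F"
  shows "(\<Sum>\<sigma>\<in>perms (Suc n). num_fixpoints (Suc n) \<sigma> * F \<sigma>) = real (Suc n) * (\<Sum>\<sigma>\<in>perms n. F \<sigma>)"
proof -
  have fiber: "(\<Sum>\<sigma>\<in>perms (Suc n). if \<sigma> i = i then F \<sigma> else 0) = (\<Sum>\<sigma>\<in>perms n. F \<sigma>)"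
    if i: "i \<in> {1..Suc n}" for i
  proof -
    define \<tau> where "\<tau> = Transposition.transpose i (Suc n)"
    have t: "\<tau> permutes {1..Suc n}" unfolding \<tau>_def using i by (intro permutes_swap_id) auto
    have inv: "inv' \<tau> = \<tau>" unfolding \<tau>_def by simp
    have "(\<Sum>\<sigma>\<in>perms (Suc n). if \<sigma> i = i then F \<sigma> else 0)
      = (\<Sum>\<sigma>\<in>perms (Suc n). if (\<tau> \<circ> \<sigma> \<circ> inv' \<tau>) i = i then F (\<tau> \<circ> \<sigma> \<circ> inv' \<tau>) else 0)"
      by (rule sum.reindex_bij_betw[OF conjugation_bij[OF t], symmetric])
    also have "\<dots> = (\<Sum>\<sigma>\<in>perms (Suc n). if \<sigma> (Suc n) = Suc n then F \<sigma> else 0)"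
    proof (intro sum.cong refl if_cong)
      fix \<sigma> assume s: "\<sigma> \<in> perms (Suc n)"
      show "F (\<tau> \<circ> \<sigma> \<circ> inv' \<tau>) = F \<sigma>" using F s t by (simp add: class_function_def)
      have "\<tau> i = Suc n" "\<tau> (Suc n) = i" by (simp_all add: \<tau>_def)
      moreover have "\<tau> x = \<tau> y \<longleftrightarrow> x = y" for x y using permutes_inj[OF t] by (rule inj_eq)
      ultimately show "((\<tau> \<circ> \<sigma> \<circ> inv' \<tau>) i = i) = (\<sigma> (Suc n) = Suc n)"
        unfolding inv comp_apply by metis
    qed
    also have "\<dots> = (\<Sum>\<sigma>\<in>{\<sigma> \<in> perms (Suc n). \<sigma> (Suc n) = Suc n}. F \<sigma>)"
      by (rule sum.inter_filter[symmetric]) (rule finite_perms)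
    finally show ?thesis unfolding perms_fixing_last .
  qed
  have "(\<Sum>\<sigma>\<in>perms (Suc n). num_fixpoints (Suc n) \<sigma> * F \<sigma>)
    = (\<Sum>\<sigma>\<in>perms (Suc n). \<Sum>i\<in>{1..Suc n}. if \<sigma> i = i then F \<sigma> else 0)"
    unfolding num_fixpoints_def sum_distrib_right by (intro sum.cong refl) simp
  also have "\<dots> = (\<Sum>i\<in>{1..Suc n}. \<Sum>\<sigma>\<in>perms (Suc n). if \<sigma> i = i then F \<sigma> else 0)"
    by (rule sum.swap)
  also have "\<dots> = (\<Sum>i\<in>{1..Suc n}. \<Sum>\<sigma>\<in>perms n. F \<sigma>)"
    by (rule sum.cong[OF refl fiber])
  finally show ?thesis by simp
qed

definition char_inner :: "nat \<Rightarrow> ((nat \<Rightarrow> nat) \<Rightarrow> real) \<Rightarrow> ((nat \<Rightarrow> nat) \<Rightarrow> real) \<Rightarrow> real" where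
  "char_inner n F G = (\<Sum>\<sigma>\<in>perms n. F \<sigma> * G \<sigma>) / fact n"

lemma char_inner_specht:
  "\<mu> \<in> int_partitions n \<Longrightarrow> \<nu> \<in> int_partitions n \<Longrightarrow>
    char_inner n (specht_char \<mu>) (specht_char \<nu>) = (if \<mu> = \<nu> then 1 else 0)"
  by (simp add: char_inner_def specht_char_gram)

lemma char_inner_cong:
  "(\<And>\<sigma>. \<sigma> permutes {1..n} \<Longrightarrow> F \<sigma> * G \<sigma> = F' \<sigma> * G' \<sigma>) \<Longrightarrow> char_inner n F G = char_inner n F' G'"
  unfolding char_inner_def by (rule arg_cong[where f = "\<lambda>x. x / fact n"], rule sum.cong) auto

lemma char_inner_sum_left: "char_inner n (\<lambda>\<sigma>. \<Sum>i\<in>I. F i \<sigma>) G = (\<Sum>i\<in>I. char_inner n (F i) G)"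
  unfolding char_inner_def sum_distrib_right sum_divide_distrib by (rule sum.swap)

lemma char_inner_commute: "char_inner n F G = char_inner n G F"
  by (simp add: char_inner_def mult.commute)

lemma char_inner_sum_right: "char_inner n G (\<lambda>\<sigma>. \<Sum>i\<in>I. F i \<sigma>) = (\<Sum>i\<in>I. char_inner n G (F i))"
  unfolding char_inner_commute[of n G] by (rule char_inner_sum_left)

text \<open>Frobenius reciprocity: inducing the restriction of \<open>F\<close> amounts to
  multiplying \<open>F\<close> by the number of fixed points. The restricted irreducible character
  is then split by the branching rule.\<close>

lemma char_inner_num_fixpoints:
  assumes F: "class_function (Suc n) F" and k: "\<kappa> \<in> int_partitions (Suc n)"
  shows "char_inner (Suc n) (\<lambda>\<sigma>. num_fixpoints (Suc n) \<sigma> * F \<sigma>) (specht_char \<kappa>)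
    = (\<Sum>\<mu>\<in>lower_covers n \<kappa>. char_inner n F (specht_char \<mu>))"
proof -
  have "char_inner (Suc n) (\<lambda>\<sigma>. num_fixpoints (Suc n) \<sigma> * F \<sigma>) (specht_char \<kappa>)
    = (\<Sum>\<sigma>\<in>perms (Suc n). num_fixpoints (Suc n) \<sigma> * (F \<sigma> * specht_char \<kappa> \<sigma>)) / fact (Suc n)"
    by (simp only: char_inner_def mult.assoc)
  also have "\<dots> = (real (Suc n) * (\<Sum>\<sigma>\<in>perms n. F \<sigma> * specht_char \<kappa> \<sigma>)) / fact (Suc n)"
    by (subst sum_num_fixpoints_mult[OF class_function_mult[OF F class_function_specht_char[OF k]]]) (rule refl)
  also have "\<dots> = char_inner n F (specht_char \<kappa>)"
    by (simp add: char_inner_def del: of_nat_Suc)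
  also have "\<dots> = char_inner n F (\<lambda>\<sigma>. \<Sum>\<mu>\<in>lower_covers n \<kappa>. specht_char \<mu> \<sigma>)"
    by (rule char_inner_cong) (simp add: specht_char_restrict[OF k])
  finally show ?thesis by (simp only: char_inner_sum_right)
qed

lemma char_inner_num_fixpoints_specht:
  assumes l: "\<kappa> \<in> int_partitions (Suc n)" and k: "\<nu> \<in> int_partitions (Suc n)"
  shows "char_inner (Suc n) (\<lambda>\<sigma>. num_fixpoints (Suc n) \<sigma> * specht_char \<kappa> \<sigma>) (specht_char \<nu>)
    = card (lower_covers n \<kappa> \<inter> lower_covers n \<nu>)"
proof -
  have "char_inner (Suc n) (\<lambda>\<sigma>. num_fixpoints (Suc n) \<sigma> * specht_char \<kappa> \<sigma>) (specht_char \<nu>)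
    = (\<Sum>\<mu>\<in>lower_covers n \<nu>. char_inner n (specht_char \<kappa>) (specht_char \<mu>))"
    by (rule char_inner_num_fixpoints[OF class_function_specht_char[OF l] k])
  also have "\<dots> = (\<Sum>\<mu>\<in>lower_covers n \<nu>. char_inner n (\<lambda>\<sigma>. \<Sum>\<mu>'\<in>lower_covers n \<kappa>. specht_char \<mu>' \<sigma>) (specht_char \<mu>))"
    by (intro sum.cong refl char_inner_cong) (simp add: specht_char_restrict[OF l])
  also have "\<dots> = (\<Sum>\<mu>\<in>lower_covers n \<nu>. \<Sum>\<mu>'\<in>lower_covers n \<kappa>. if \<mu>' = \<mu> then 1 else 0)"
    unfolding char_inner_sum_left
    by (intro sum.cong refl char_inner_specht) (auto simp: lower_covers_def)
  also have "\<dots> = (\<Sum>\<mu>\<in>lower_covers n \<nu>. if \<mu> \<in> lower_covers n \<kappa> then 1 else 0)"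
    by (simp add: sum.delta)
  also have "\<dots> = card (lower_covers n \<nu> \<inter> lower_covers n \<kappa>)"
    by (simp add: sum.inter_restrict[symmetric])
  finally show ?thesis by (simp only: Int_commute)
qed

text \<open>On \<open>perms n\<close>, \<open>num_fixpoints n \<sigma> + 1\<close> counts the fixed
  points in \<open>{1..Suc n}\<close>, so multiplication by it is induction to the larger group
  followed by restriction. The summand 1 accounts for the excess of upper over lower covers.\<close>

lemma char_inner_num_fixpoints_Suc_specht:
  assumes m: "\<mu> \<in> int_partitions n" and k: "\<nu> \<in> int_partitions n"
  shows "char_inner n (\<lambda>\<sigma>. (num_fixpoints n \<sigma> + 1) * specht_char \<mu> \<sigma>) (specht_char \<nu>)
    = card (upper_covers n \<mu> \<inter> upper_covers n \<nu>)"
proof -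
  have split: "char_inner n (\<lambda>\<sigma>. (num_fixpoints n \<sigma> + 1) * specht_char \<mu> \<sigma>) (specht_char \<nu>)
    = char_inner n (\<lambda>\<sigma>. num_fixpoints n \<sigma> * specht_char \<mu> \<sigma>) (specht_char \<nu>) + (if \<mu> = \<nu> then 1 else 0)"
    unfolding char_inner_specht[OF m k, symmetric]
    by (simp add: char_inner_def add_divide_distrib[symmetric] sum.distrib[symmetric] distrib_right)
  show ?thesis
  proof (cases n)
    case 0
    then have "\<mu> = []" "\<nu> = []" using m k int_partitions_0 by auto
    moreover have "char_inner 0 (\<lambda>\<sigma>. num_fixpoints 0 \<sigma> * specht_char \<mu> \<sigma>) (specht_char \<nu>) = 0"
      by (simp add: char_inner_def)
    ultimately show ?thesis unfolding split using 0 by (simp add: upper_0)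
  next
    case (Suc m)
    then show ?thesis
      unfolding split using char_inner_num_fixpoints_specht[of \<mu> m \<nu>] card_upper_inter[of \<mu> m \<nu>] m k
      by simp
  qed
qed

text \<open>The coefficients are the inner products with the irreducible characters, and by
  \<open>card (upper_covers n \<mu> \<inter> upper_covers n \<nu>) = card (lower_covers m \<mu> \<inter> lower_covers m \<nu>) + \<delta>\<close> for \<open>n = m + 1\<close> the squared norm of
  the left-hand side equals the sum of their squares. So no completeness of the irreducible
  characters is needed.\<close>

lemma num_fixpoints_mult_specht_char:
  assumes k: "\<kappa> \<in> int_partitions (Suc n)" and s: "\<sigma> permutes {1..Suc n}"
  shows "num_fixpoints (Suc n) \<sigma> * specht_char \<kappa> \<sigma>
    = (\<Sum>\<nu>\<in>int_partitions (Suc n). card (lower_covers n \<kappa> \<inter> lower_covers n \<nu>) * specht_char \<nu> \<sigma>)"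
proof -
  let ?P = "int_partitions (Suc n)" and ?L = "lower_covers n \<kappa>"
  let ?F = "\<lambda>\<sigma>. num_fixpoints (Suc n) \<sigma> * specht_char \<kappa> \<sigma>"
  let ?a = "\<lambda>\<nu>. real (card (?L \<inter> lower_covers n \<nu>))"
  have cf: "class_function (Suc n) ?F"
    by (intro class_function_mult class_function_num_fixpoints class_function_specht_char k)
  have 1: "(\<Sum>\<sigma>\<in>perms (Suc n). ?F \<sigma> * specht_char \<nu> \<sigma>) = fact (Suc n) * ?a \<nu>" if "\<nu> \<in> ?P" for \<nu>
    using char_inner_num_fixpoints_specht[OF k that] by (simp only: char_inner_def nonzero_divide_eq_eq[OF fact_nonzero] mult.commute)
  have "(\<Sum>\<sigma>\<in>perms (Suc n). (?F \<sigma>)\<^sup>2) / fact (Suc n)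
    = char_inner (Suc n) (\<lambda>\<sigma>. num_fixpoints (Suc n) \<sigma> * ?F \<sigma>) (specht_char \<kappa>)"
    by (simp add: char_inner_def power2_eq_square mult_ac)
  also have "\<dots> = (\<Sum>\<mu>\<in>?L. char_inner n ?F (specht_char \<mu>))"
    by (rule char_inner_num_fixpoints[OF cf k])
  also have "\<dots> = (\<Sum>\<mu>\<in>?L. char_inner n (\<lambda>\<sigma>. \<Sum>\<mu>'\<in>?L. (num_fixpoints n \<sigma> + 1) * specht_char \<mu>' \<sigma>) (specht_char \<mu>))"
    by (intro sum.cong refl char_inner_cong)
      (simp add: specht_char_restrict[OF k] num_fixpoints_Suc sum_distrib_left)
  also have "\<dots> = (\<Sum>\<mu>\<in>?L. \<Sum>\<mu>'\<in>?L. real (card (upper_covers n \<mu>' \<inter> upper_covers n \<mu>)))"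
    unfolding char_inner_sum_left
    by (intro sum.cong refl char_inner_num_fixpoints_Suc_specht) (auto simp: lower_covers_def)
  \<comment> \<open>Common upper covers are counted by a sum over \<open>\<nu>\<close>; once it is
    outermost, the sums over \<open>\<mu>\<close> and \<open>\<mu>'\<close> factor into a
    square.\<close>
  also have "\<dots> = (\<Sum>\<mu>\<in>?L. \<Sum>\<mu>'\<in>?L. \<Sum>\<nu>\<in>?P. if \<mu>' \<in> lower_covers n \<nu> \<and> \<mu> \<in> lower_covers n \<nu> then 1 else 0)"
  proof (rule sum.cong[OF refl], rule sum.cong[OF refl])
    fix \<mu> \<mu>' assume "\<mu> \<in> ?L" "\<mu>' \<in> ?L"
    then have "upper_covers n \<mu>' \<inter> upper_covers n \<mu> = {\<nu> \<in> ?P. \<mu>' \<in> lower_covers n \<nu> \<and> \<mu> \<in> lower_covers n \<nu>}"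
      by (auto simp: lower_covers_def upper_covers_def)
    then show "real (card (upper_covers n \<mu>' \<inter> upper_covers n \<mu>)) = (\<Sum>\<nu>\<in>?P. if \<mu>' \<in> lower_covers n \<nu> \<and> \<mu> \<in> lower_covers n \<nu> then 1 else 0)"
      by (simp add: sum.inter_filter[symmetric])
  qed
  also have "\<dots> = (\<Sum>\<mu>\<in>?L. \<Sum>\<nu>\<in>?P. \<Sum>\<mu>'\<in>?L. if \<mu>' \<in> lower_covers n \<nu> \<and> \<mu> \<in> lower_covers n \<nu> then 1 else 0)"
    by (rule sum.cong[OF refl], rule sum.swap)
  also have "\<dots> = (\<Sum>\<nu>\<in>?P. \<Sum>\<mu>\<in>?L. \<Sum>\<mu>'\<in>?L. if \<mu>' \<in> lower_covers n \<nu> \<and> \<mu> \<in> lower_covers n \<nu> then 1 else 0)"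
    by (rule sum.swap)
  also have "\<dots> = (\<Sum>\<nu>\<in>?P. (?a \<nu>)\<^sup>2)"
  proof (rule sum.cong[OF refl])
    fix \<nu>
    have "?a \<nu> = (\<Sum>\<mu>\<in>?L. if \<mu> \<in> lower_covers n \<nu> then 1 else 0)" by (simp add: sum.inter_restrict[symmetric])
    then have "(?a \<nu>)\<^sup>2 = (\<Sum>\<mu>\<in>?L. \<Sum>\<mu>'\<in>?L. (if \<mu> \<in> lower_covers n \<nu> then 1 else 0) * (if \<mu>' \<in> lower_covers n \<nu> then 1 else 0))"
      by (simp only: power2_eq_square sum_product)
    also have "\<dots> = (\<Sum>\<mu>\<in>?L. \<Sum>\<mu>'\<in>?L. if \<mu>' \<in> lower_covers n \<nu> \<and> \<mu> \<in> lower_covers n \<nu> then 1 else 0)"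
      by (intro sum.cong refl) auto
    finally show "(\<Sum>\<mu>\<in>?L. \<Sum>\<mu>'\<in>?L. if \<mu>' \<in> lower_covers n \<nu> \<and> \<mu> \<in> lower_covers n \<nu> then 1 else 0) = (?a \<nu>)\<^sup>2" ..
  qed
  finally have 2: "(\<Sum>\<sigma>\<in>perms (Suc n). (?F \<sigma>)\<^sup>2) = fact (Suc n) * (\<Sum>\<nu>\<in>?P. (?a \<nu>)\<^sup>2)"
    by (simp only: nonzero_divide_eq_eq[OF fact_nonzero] mult.commute)
  have "(\<Sum>\<nu>\<in>?P. ?a \<nu> * (\<Sum>\<sigma>\<in>perms (Suc n). ?F \<sigma> * specht_char \<nu> \<sigma>)) = (\<Sum>\<nu>\<in>?P. fact (Suc n) * (?a \<nu>)\<^sup>2)"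
    by (rule sum.cong[OF refl]) (simp only: 1, simp only: power2_eq_square mult_ac)
  then have 3: "(\<Sum>\<nu>\<in>?P. ?a \<nu> * (\<Sum>\<sigma>\<in>perms (Suc n). ?F \<sigma> * specht_char \<nu> \<sigma>)) = fact (Suc n) * (\<Sum>\<nu>\<in>?P. (?a \<nu>)\<^sup>2)"
    by (simp only: sum_distrib_left)
  have "(\<Sum>\<sigma>\<in>perms (Suc n). (?F \<sigma> - (\<Sum>\<nu>\<in>?P. ?a \<nu> * specht_char \<nu> \<sigma>))\<^sup>2) = 0"
    unfolding sum_square_minus_specht_chars 2 3 by simp
  then have "(?F \<sigma> - (\<Sum>\<nu>\<in>?P. ?a \<nu> * specht_char \<nu> \<sigma>))\<^sup>2 = 0"
    using s sum_nonneg_eq_0_iff[OF finite_perms, of "Suc n" "\<lambda>\<sigma>. (?F \<sigma> - (\<Sum>\<nu>\<in>?P. ?a \<nu> * specht_char \<nu> \<sigma>))\<^sup>2"]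
    by auto
  then show ?thesis by simp
qed

section \<open>Counting multiplicities\<close>

lemma cells_Cons: "(i, j) \<in> cells (m # xs) \<longleftrightarrow> (case i of 0 \<Rightarrow> j < m | Suc i' \<Rightarrow> (i', j) \<in> cells xs)"
  by (simp add: cells_def split: nat.split)

text \<open>The value 0 at the empty list replaces the unspecified \<open>hd []\<close>, so that
  size conditions also make sense for the empty partition.\<close>

definition first_part :: "nat list \<Rightarrow> nat" where
  "first_part xs = (if xs = [] then 0 else hd xs)"

lemma int_partitions_Cons:
  "m # xs \<in> int_partitions n \<longleftrightarrow>
    0 < m \<and> first_part xs \<le> m \<and> m \<le> n \<and> xs \<in> int_partitions (n - m)"
proof -
  have "sorted_wrt (\<ge>) xs \<Longrightarrow> (\<forall>x\<in>set xs. x \<le> m) \<longleftrightarrow> first_part xs \<le> m"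
    by (cases xs) (auto simp: first_part_def)
  then show ?thesis by (auto simp: int_partitions_def)
qed

text \<open>A zero part is dropped, so that adding an empty first row to the empty partition gives the
  partition of \<open>0\<close>.\<close>

definition add_row :: "nat \<Rightarrow> nat list \<Rightarrow> nat list" where
  "add_row m xs = (if m = 0 then xs else m # xs)"

lemma add_row_int_partitions:
  assumes "xs \<in> int_partitions l" "l + first_part xs \<le> n"
  shows "add_row (n - l) xs \<in> int_partitions n"
proof (cases "n - l = 0")
  case True
  then have "n = l" using assms(2) by simp
  then show ?thesis using assms(1) by (simp add: add_row_def)
next
  case False
  then show ?thesis using assms by (simp add: add_row_def int_partitions_Cons)
qed

lemma cells_mono_Cons:
  "cells (a # xs) \<subseteq> cells (m # ys) \<longleftrightarrow> a \<le> m \<and> cells xs \<subseteq> cells ys"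
proof
  assume sub: "cells (a # xs) \<subseteq> cells (m # ys)"
  have "a \<le> m"
  proof (rule ccontr)
    assume "\<not> a \<le> m"
    then have "(0, m) \<in> cells (a # xs)" by (simp add: cells_Cons)
    then have "(0, m) \<in> cells (m # ys)" using sub by blast
    then show False by (simp add: cells_Cons)
  qed
  moreover have "(i, j) \<in> cells ys" if "(i, j) \<in> cells xs" for i j
  proof -
    have "(Suc i, j) \<in> cells (a # xs)" using that by (simp add: cells_Cons)
    then have "(Suc i, j) \<in> cells (m # ys)" using sub by blast
    then show ?thesis by (simp add: cells_Cons)
  qed
  ultimately show "a \<le> m \<and> cells xs \<subseteq> cells ys" by auto
next
  assume *: "a \<le> m \<and> cells xs \<subseteq> cells ys"
  show "cells (a # xs) \<subseteq> cells (m # ys)"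
  proof (rule subsetI)
    fix c assume "c \<in> cells (a # xs)"
    then show "c \<in> cells (m # ys)" using *
      by (cases c, cases "fst c") (auto simp: cells_Cons)
  qed
qed

lemma cells_Nil [simp]: "cells [] = {}"
  by (simp add: cells_def)

lemma first_part_mono:
  assumes "cells xs \<subseteq> cells ys"
  shows "first_part xs \<le> first_part ys"
proof (cases xs)
  case (Cons a xs')
  show ?thesis
  proof (cases "a = 0")
    case False
    then have "(0, a - 1) \<in> cells xs" using Cons by (simp add: cells_Cons)
    then have "(0, a - 1) \<in> cells ys" using assms by blast
    then show ?thesis using Cons by (cases ys) (auto simp: first_part_def cells_Cons)
  qed (simp add: first_part_def Cons)
qed (simp add: first_part_def)

text \<open>A removed cell comes either from the first row, which must stay at least as long as the
  next one, or from \<open>xs\<close>, in which case the first row keeps its length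
  \<open>Suc n - l = n - (l - 1)\<close>.\<close>

lemma lower_add_row:
  assumes xs: "xs \<in> int_partitions l" and le: "l + first_part xs \<le> Suc n"
  shows "lower_covers n (add_row (Suc n - l) xs)
    = (if l + first_part xs \<le> n then {add_row (n - l) xs} else {})
      \<union> (if l = 0 then {} else add_row (Suc n - l) ` lower_covers (l - 1) xs)"
    (is "?L = ?A \<union> ?B")
proof -
  have suml: "sum_list xs = l" using xs by (simp add: int_partitions_def)
  have m0: "Suc n - l > 0"
  proof (rule ccontr)
    assume "\<not> Suc n - l > 0"
    then have "l = Suc n" "first_part xs = 0" using le by auto
    moreover have "xs \<noteq> []" using suml \<open>l = Suc n\<close> by auto
    then have "first_part xs \<noteq> 0" using xs by (cases xs) (auto simp: first_part_def int_partitions_def)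
    ultimately show False by simp
  qed
  then have row: "add_row (Suc n - l) xs = (Suc n - l) # xs" by (simp add: add_row_def)
  show ?thesis
  proof (intro equalityI subsetI)
    fix \<mu> assume m: "\<mu> \<in> ?L"
    then have mp: "\<mu> \<in> int_partitions n" and sub: "cells \<mu> \<subseteq> cells ((Suc n - l) # xs)"
      unfolding row by (auto simp: lower_covers_def)
    show "\<mu> \<in> ?A \<union> ?B"
    proof (cases \<mu>)
      case Nil
      then have "n = 0" using mp by (simp add: int_partitions_def)
      then have "l = 0" using m0 by simp
      then have "xs = []" using xs int_partitions_0 by simp
      then show ?thesis using \<open>n = 0\<close> \<open>l = 0\<close> Nil by (simp add: first_part_def add_row_def)
    next
      case (Cons a \<nu>)
      have a: "a \<le> Suc n - l" and sub': "cells \<nu> \<subseteq> cells xs"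
        using sub unfolding Cons cells_mono_Cons by auto
      have p: "0 < a" "first_part \<nu> \<le> a" "a \<le> n" "\<nu> \<in> int_partitions (n - a)"
        using mp unfolding Cons int_partitions_Cons by auto
      \<comment> \<open>Containment in \<open>xs\<close> gives \<open>n - a \<le> l\<close>; with
        \<open>a \<le> Suc n - l\<close> only two lengths of the first row remain.\<close>
      have "card (cells \<nu>) \<le> card (cells xs)" using sub' by (intro card_mono) auto
      then have nl: "n - a \<le> l"
        using int_partitions_card_cells[OF p(4)] int_partitions_card_cells[OF xs] by simp
      show ?thesis
      proof (cases "a = Suc n - l")
        case True
        then have l: "l \<noteq> 0" using p(3) by auto
        then have "n - a = l - 1" using True p(3) m0 by simp
        then have "\<nu> \<in> lower_covers (l - 1) xs" using p(4) sub' by (simp add: lower_covers_def)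
        then show ?thesis using Cons True l m0 by (auto simp: add_row_def)
      next
        case False
        then have a': "a = n - l" "n - a = l" using a nl p(1,3) by linarith+
        then have "cells \<nu> = cells xs"
          using sub' int_partitions_card_cells[OF p(4)] int_partitions_card_cells[OF xs]
          by (intro card_subset_eq) auto
        then have "\<nu> = xs" using cells_inject[OF p(4) xs] by simp
        then show ?thesis using Cons a' p by (auto simp: add_row_def)
      qed
    qed
  next
    fix \<mu> assume "\<mu> \<in> ?A \<union> ?B"
    then show "\<mu> \<in> ?L"
    proof
      assume "\<mu> \<in> ?A"
      then have A: "l + first_part xs \<le> n" "\<mu> = add_row (n - l) xs" by (auto split: if_splits)
      have "cells \<mu> \<subseteq> cells ((Suc n - l) # xs)"
      proof (cases "n - l = 0")
        case True
        then have "first_part xs = 0" using A(1) by simp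
        then have "xs = []" using xs by (cases xs) (auto simp: first_part_def int_partitions_def)
        then show ?thesis using A(2) True by (simp add: add_row_def)
      next
        case False
        then show ?thesis using A(2) by (simp add: add_row_def cells_mono_Cons)
      qed
      then show ?thesis
        using add_row_int_partitions[OF xs A(1)] A(2) unfolding row lower_covers_def by simp
    next
      assume "\<mu> \<in> ?B"
      then obtain \<nu> where l: "l \<noteq> 0" and v: "\<nu> \<in> lower_covers (l - 1) xs" "\<mu> = add_row (Suc n - l) \<nu>"
        by (auto split: if_splits)
      have vp: "\<nu> \<in> int_partitions (l - 1)" and sub: "cells \<nu> \<subseteq> cells xs" using v(1) by (auto simp: lower_covers_def)
      have "Suc n - l = n - (l - 1)" using l by simp
      moreover have "add_row (n - (l - 1)) \<nu> \<in> int_partitions n"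
        using first_part_mono[OF sub] le l by (intro add_row_int_partitions[OF vp]) simp
      ultimately have "\<mu> \<in> int_partitions n" using v(2) by simp
      moreover have "cells \<mu> \<subseteq> cells ((Suc n - l) # xs)"
        using v(2) m0 sub by (simp add: add_row_def cells_mono_Cons)
      ultimately show ?thesis unfolding row lower_covers_def by simp
    qed
  qed
qed

section \<open>The trivial character and the character of \<open>[n, 1]\<close>\<close>

lemma tabloids_row: "tabloids [n] = {\<lambda>i. if i = 0 then {1..n} else {}}"
proof -
  have "tabloid_of [n] t = (\<lambda>i. if i = 0 then {1..n} else {})" if t: "t \<in> tableaux [n]" for t
  proof
    fix i
    have "fst (position [n] t x) = 0" if "x \<in> {1..n}" for x
    proof -
      have "position [n] t x \<in> cells [n]" using bij_betwE[OF position_bij[OF t]] that by simp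
      then show ?thesis by (auto simp: cells_def)
    qed
    then show "tabloid_of [n] t i = (if i = 0 then {1..n} else {})"
      by (auto simp: tabloid_of_eq[OF t])
  qed
  then show ?thesis using base_tableau[of "[n]"] unfolding tabloids_def by force
qed

text \<open>There is only one tabloid, so the character is constant; its norm makes the constant a
  square root of 1 and positivity of the trace selects the sign.\<close>

lemma specht_char_row:
  assumes s: "\<sigma> permutes {1..n}"
  shows "specht_char (add_row n []) \<sigma> = 1"
proof -
  let ?\<mu> = "add_row n []"
  have mu: "?\<mu> \<in> int_partitions n"
    using add_row_int_partitions[of "[]" 0 n] by (simp add: int_partitions_0 first_part_def)
  obtain T where T: "tabloids ?\<mu> = {T}"
  proof (cases "n = 0")
    case True
    have "tableaux [] = {\<lambda>_. undefined}"
      by (auto simp: tableaux_def extensional_def fun_eq_iff bij_betw_def)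
    then show ?thesis using that True by (simp add: add_row_def tabloids_def)
  next
    case False
    then show ?thesis using that tabloids_row[of n] by (simp add: add_row_def)
  qed
  have n: "sum_list ?\<mu> = n" using mu by (simp add: int_partitions_def)
  have const: "specht_char ?\<mu> \<tau> = specht_proj ?\<mu> T T" if "\<tau> permutes {1..n}" for \<tau>
  proof -
    have "pullback \<tau> T \<in> tabloids ?\<mu>"
      using that T n by (intro pullback_tabloids(1)) auto
    then have "pullback \<tau> T = T" using T by simp
    then show ?thesis by (simp add: specht_char_def T)
  qed
  have "specht_proj ?\<mu> T T * specht_proj ?\<mu> T T * fact n = (\<Sum>\<tau>\<in>perms n. specht_proj ?\<mu> T T * specht_proj ?\<mu> T T)"
    by simp
  also have "\<dots> = (\<Sum>\<tau>\<in>perms n. specht_char ?\<mu> \<tau> * specht_char ?\<mu> \<tau>)"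
    by (intro sum.cong refl) (simp add: const)
  also have "\<dots> = fact n" by (rule specht_char_norm[OF mu])
  finally have "specht_proj ?\<mu> T T * specht_proj ?\<mu> T T = 1" by simp
  moreover have "specht_proj ?\<mu> T T > 0" using mtrace_proj_pos[OF mu] by (simp add: T mtrace_def)
  ultimately have "specht_proj ?\<mu> T T = 1" unfolding square_eq_1_iff by linarith
  then show ?thesis using const[OF s] by simp
qed

text \<open>Multiplying the trivial character by the number of fixed points gives the sum over the
  upper covers of \<open>[n]\<close>, which are \<open>[Suc n]\<close> and
  \<open>[n, 1]\<close>.\<close>

lemma specht_char_hook:
  assumes s: "\<sigma> permutes {1..Suc n}" and n: "n > 0"
  shows "specht_char [n, 1] \<sigma> = num_fixpoints (Suc n) \<sigma> - 1"
proof -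
  have k: "[Suc n] \<in> int_partitions (Suc n)" and h: "[n, 1] \<in> int_partitions (Suc n)"
    and r: "[n] \<in> int_partitions n"
    using n by (auto simp: int_partitions_def)
  have low: "lower_covers n [Suc n] = {[n]}"
    using lower_add_row[of "[]" 0 n] n by (simp add: int_partitions_0 first_part_def add_row_def)
  obtain m where m: "n = Suc m" using n by (cases n) auto
  \<comment> \<open>A single lower cover means exactly two upper covers by
    \<open>card_upper\<close>, so the two exhibited ones are all.\<close>
  have "lower_covers m [Suc m] = {add_row m []}"
    using lower_add_row[of "[]" 0 m] by (simp add: int_partitions_0 first_part_def add_row_def)
  then have "card (upper_covers n [n]) = 2" using card_upper[of "[n]" m] r m by simp
  moreover have "{[Suc n], [n, 1]} \<subseteq> upper_covers n [n]"
    using k h by (auto simp: upper_covers_def cells_mono_Cons)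
  moreover have "card {[Suc n], [n, 1]} = 2" by simp
  ultimately have up: "upper_covers n [n] = {[Suc n], [n, 1]}"
    by (metis card_subset_eq finite_upper)
  have "num_fixpoints (Suc n) \<sigma> * specht_char [Suc n] \<sigma>
    = (\<Sum>\<nu>\<in>int_partitions (Suc n). card (lower_covers n [Suc n] \<inter> lower_covers n \<nu>) * specht_char \<nu> \<sigma>)"
    by (rule num_fixpoints_mult_specht_char[OF k s])
  also have "\<dots> = (\<Sum>\<nu>\<in>upper_covers n [n]. specht_char \<nu> \<sigma>)"
    using sum_lower_upper[OF k, of "\<lambda>\<nu>. specht_char \<nu> \<sigma>"] by (simp add: low)
  also have "\<dots> = specht_char [Suc n] \<sigma> + specht_char [n, 1] \<sigma>"
    by (simp add: up)
  finally show ?thesis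
    using specht_char_row[OF s] by (simp add: add_row_def)
qed

section \<open>Decomposition of Kronecker powers and multiplicities\<close>

lemma lower_nonempty:
  assumes "\<kappa> \<in> int_partitions (Suc n)"
  shows "lower_covers n \<kappa> \<noteq> {}"
proof
  assume "lower_covers n \<kappa> = {}"
  then have "num_standard_tableaux \<kappa> = 0" using num_standard_tableaux_rec[OF assms] by simp
  then show False using specht_dim[OF assms] mtrace_proj_pos[OF assms] by (simp only: specht_char_id)
qed

text \<open>Provides the existence half of \<open>multiplicity_in\<close>: multiplication by
  \<open>num_fixpoints (Suc n) \<sigma> - 1\<close> acts on irreducible characters by a matrix with
  natural entries.\<close>

lemma num_fixpoints_power_decomposition:
  "\<exists>m :: nat list \<Rightarrow> nat. \<forall>\<sigma>\<in>perms (Suc n). (num_fixpoints (Suc n) \<sigma> - 1) ^ k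
    = (\<Sum>\<mu>\<in>int_partitions (Suc n). real (m \<mu>) * specht_char \<mu> \<sigma>)"
proof (induction k)
  case 0
  let ?m = "\<lambda>\<mu>. if \<mu> = add_row (Suc n) [] then 1 else 0 :: nat"
  have r: "add_row (Suc n) [] \<in> int_partitions (Suc n)"
    using add_row_int_partitions[of "[]" 0 "Suc n"] by (simp add: int_partitions_0 first_part_def)
  have "(num_fixpoints (Suc n) \<sigma> - 1) ^ 0 = (\<Sum>\<mu>\<in>int_partitions (Suc n). real (?m \<mu>) * specht_char \<mu> \<sigma>)"
    if "\<sigma> \<in> perms (Suc n)" for \<sigma>
  proof -
    have "(\<Sum>\<mu>\<in>int_partitions (Suc n). real (?m \<mu>) * specht_char \<mu> \<sigma>)
      = (\<Sum>\<mu>\<in>int_partitions (Suc n). if \<mu> = add_row (Suc n) [] then specht_char \<mu> \<sigma> else 0)"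
      by (intro sum.cong refl) simp
    also have "\<dots> = 1" using r that specht_char_row[of \<sigma> "Suc n"] by (simp add: sum.delta)
    finally show ?thesis by simp
  qed
  then show ?case by (intro exI[of _ ?m] ballI)
next
  case (Suc k)
  let ?P = "int_partitions (Suc n)"
  from Suc.IH obtain m :: "nat list \<Rightarrow> nat" where IH: "\<forall>\<sigma>\<in>perms (Suc n).
    (num_fixpoints (Suc n) \<sigma> - 1) ^ k = (\<Sum>\<mu>\<in>?P. real (m \<mu>) * specht_char \<mu> \<sigma>)" ..
  note m = bspec[OF IH]
  \<comment> \<open>The truncated subtraction is exact, since each partition of \<open>Suc n\<close>
    has at least one lower cover.\<close>
  define c where "c \<mu> \<nu> = card (lower_covers n \<mu> \<inter> lower_covers n \<nu>) - (if \<mu> = \<nu> then 1 else 0)" for \<mu> \<nu>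
  have c: "real (c \<mu> \<nu>) = real (card (lower_covers n \<mu> \<inter> lower_covers n \<nu>)) - (if \<mu> = \<nu> then 1 else 0)"
    if "\<mu> \<in> ?P" for \<mu> \<nu>
  proof (cases "\<mu> = \<nu>")
    case True
    have "card (lower_covers n \<mu>) > 0" using lower_nonempty[OF that] by (simp add: card_gt_0_iff)
    then have "1 \<le> card (lower_covers n \<mu>)" by linarith
    then show ?thesis using True by (simp add: c_def of_nat_diff)
  qed (simp add: c_def)
  have "(num_fixpoints (Suc n) \<sigma> - 1) ^ Suc k
    = (\<Sum>\<nu>\<in>?P. real (\<Sum>\<mu>\<in>?P. m \<mu> * c \<mu> \<nu>) * specht_char \<nu> \<sigma>)" if s: "\<sigma> \<in> perms (Suc n)" for \<sigma>
  proof -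
    have step: "(num_fixpoints (Suc n) \<sigma> - 1) * specht_char \<mu> \<sigma> = (\<Sum>\<nu>\<in>?P. real (c \<mu> \<nu>) * specht_char \<nu> \<sigma>)"
      if mu: "\<mu> \<in> ?P" for \<mu>
    proof -
      have "(\<Sum>\<nu>\<in>?P. real (c \<mu> \<nu>) * specht_char \<nu> \<sigma>)
        = (\<Sum>\<nu>\<in>?P. real (card (lower_covers n \<mu> \<inter> lower_covers n \<nu>)) * specht_char \<nu> \<sigma> - (if \<mu> = \<nu> then specht_char \<nu> \<sigma> else 0))"
        by (intro sum.cong refl) (simp add: c[OF mu] left_diff_distrib)
      also have "\<dots> = num_fixpoints (Suc n) \<sigma> * specht_char \<mu> \<sigma> - specht_char \<mu> \<sigma>"
        using num_fixpoints_mult_specht_char[OF mu, of \<sigma>] s mu by (simp add: sum_subtractf sum.delta')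
      finally show ?thesis by (simp add: left_diff_distrib)
    qed
    have "(num_fixpoints (Suc n) \<sigma> - 1) ^ Suc k
      = (\<Sum>\<mu>\<in>?P. real (m \<mu>) * ((num_fixpoints (Suc n) \<sigma> - 1) * specht_char \<mu> \<sigma>))"
      by (simp add: m[OF s] sum_distrib_left mult_ac)
    also have "\<dots> = (\<Sum>\<mu>\<in>?P. \<Sum>\<nu>\<in>?P. real (m \<mu> * c \<mu> \<nu>) * specht_char \<nu> \<sigma>)"
      by (intro sum.cong refl) (simp add: step sum_distrib_left mult.assoc)
    also have "\<dots> = (\<Sum>\<nu>\<in>?P. \<Sum>\<mu>\<in>?P. real (m \<mu> * c \<mu> \<nu>) * specht_char \<nu> \<sigma>)"
      by (rule sum.swap)
    finally show ?thesis by (simp add: sum_distrib_right)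
  qed
  then show ?case by (intro exI[of _ "\<lambda>\<nu>. \<Sum>\<mu>\<in>?P. m \<mu> * c \<mu> \<nu>"] ballI)
qed

text \<open>Orthonormality forces the coefficient in any decomposition to be the inner product, so
  the definite description is well defined once a decomposition exists. The bound on
  \<open>N\<close> makes \<open>[N - 1, 1]\<close> a partition.\<close>

lemma multiplicity_in_eq:
  assumes N: "N \<ge> 2" and la: "\<kappa> \<in> int_partitions N"
  shows "real (multiplicity_in N \<kappa> (kronecker_power (irr_char [N - 1, 1]) k))
    = char_inner N (\<lambda>\<sigma>. (num_fixpoints N \<sigma> - 1) ^ k) (specht_char \<kappa>)"
proof -
  let ?P = "int_partitions N" and ?\<chi> = "kronecker_power (irr_char [N - 1, 1]) k"
  obtain n where n: "N = Suc n" "n > 0" using N by (cases N) auto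
  have hook: "[N - 1, 1] \<in> int_partitions N" using n by (auto simp: int_partitions_def)
  have dec: "decomposes N ?\<chi> m \<longleftrightarrow>
    (\<forall>\<sigma>\<in>perms N. (num_fixpoints N \<sigma> - 1) ^ k = (\<Sum>\<mu>\<in>?P. real (m \<mu>) * specht_char \<mu> \<sigma>))" for m
    unfolding decomposes_def carrier_sym_group
  proof (rule ball_cong[OF refl])
    fix \<sigma> assume "\<sigma> \<in> perms N"
    then have s: "\<sigma> permutes {1..N}" by simp
    have "specht_char [N - 1, 1] \<sigma> = num_fixpoints N \<sigma> - 1"
      using specht_char_hook[of \<sigma> n] s n by simp
    then have "?\<chi> \<sigma> = complex_of_real ((num_fixpoints N \<sigma> - 1) ^ k)"
      by (simp only: kronecker_power_def irr_char_eq[OF hook s] of_real_power)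
    moreover have "(\<Sum>\<mu>\<in>?P. of_nat (m \<mu>) * irr_char \<mu> \<sigma>)
      = complex_of_real (\<Sum>\<mu>\<in>?P. real (m \<mu>) * specht_char \<mu> \<sigma>)"
      unfolding of_real_sum by (intro sum.cong refl) (simp add: irr_char_eq[OF _ s])
    ultimately show "(?\<chi> \<sigma> = (\<Sum>\<mu>\<in>?P. of_nat (m \<mu>) * irr_char \<mu> \<sigma>))
      = ((num_fixpoints N \<sigma> - 1) ^ k = (\<Sum>\<mu>\<in>?P. real (m \<mu>) * specht_char \<mu> \<sigma>))"
      by (simp only: of_real_eq_iff)
  qed
  have val: "real (m \<kappa>) = char_inner N (\<lambda>\<sigma>. (num_fixpoints N \<sigma> - 1) ^ k) (specht_char \<kappa>)"
    if "decomposes N ?\<chi> m" for m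
  proof -
    have "char_inner N (\<lambda>\<sigma>. (num_fixpoints N \<sigma> - 1) ^ k) (specht_char \<kappa>)
      = char_inner N (\<lambda>\<sigma>. \<Sum>\<mu>\<in>?P. real (m \<mu>) * specht_char \<mu> \<sigma>) (specht_char \<kappa>)"
      using that unfolding dec by (intro char_inner_cong) simp
    also have "\<dots> = (\<Sum>\<mu>\<in>?P. real (m \<mu>) * char_inner N (specht_char \<mu>) (specht_char \<kappa>))"
      unfolding char_inner_sum_left
      by (intro sum.cong refl) (simp add: char_inner_def sum_distrib_left mult.assoc)
    also have "\<dots> = (\<Sum>\<mu>\<in>?P. if \<mu> = \<kappa> then real (m \<mu>) else 0)"
      by (intro sum.cong refl) (simp add: char_inner_specht[OF _ la])
    also have "\<dots> = real (m \<kappa>)" using la by (simp add: sum.delta)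
    finally show ?thesis ..
  qed
  obtain m where m: "decomposes N ?\<chi> m"
    using num_fixpoints_power_decomposition[of n k, folded n(1)] unfolding dec by (elim exE)
  have "multiplicity_in N \<kappa> ?\<chi> = m \<kappa>"
    unfolding multiplicity_in_def
  proof (rule the_equality)
    show "\<exists>m'. decomposes N ?\<chi> m' \<and> m' \<kappa> = m \<kappa>" using m by blast
    show "c = m \<kappa>" if "\<exists>m'. decomposes N ?\<chi> m' \<and> m' \<kappa> = c" for c
      using that val[OF m] val by (metis of_nat_eq_iff)
  qed
  then show ?thesis using val[OF m] by simp
qed

section \<open>The generating function and its coefficients\<close>

definition mult_fps :: "nat \<Rightarrow> real fps" where
  "mult_fps l = fps_const (1 / fact l) * fps_compose (fps_exp 1) (fps_exp 1 - fps_X - 1) * (fps_exp 1 - 1) ^ l"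

text \<open>In the stable range this is the multiplicity in the \<open>j\<close>-th power of the
  number of fixed points, divided by the number of standard tableaux of the rows below the first.
  The factor \<open>fps_exp 1\<close> accounts for \<open>fix\<close> in place of
  \<open>fix - 1\<close>.\<close>

definition moment :: "nat \<Rightarrow> nat \<Rightarrow> real" where
  "moment j l = fact j * fps_nth (mult_fps l * fps_exp 1) j"

text \<open>The composed exponential \<open>G\<close> satisfies \<open>G' = G * (e^x - 1)\<close>.
  The term with -1 cancels against the derivative of the extra factor \<open>e^x\<close>, and the
  derivative of the \<open>l\<close>-th power produces the series for \<open>l - 1\<close>.\<close>

lemma fps_deriv_mult_fps:
  "fps_deriv (mult_fps l * fps_exp 1) = fps_exp 1 * (mult_fps l * fps_exp 1
    + (if l = 0 then 0 else mult_fps (l - 1) * fps_exp 1))"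
proof -
  let ?e = "fps_exp 1 :: real fps" and ?p = "fps_exp 1 - fps_X - 1 :: real fps"
  define G where "G = fps_compose ?e ?p"
  have G: "fps_deriv G = G * (?e - 1)"
    unfolding G_def by (subst fps_compose_deriv) simp_all
  have U: "fps_deriv ((?e - 1) ^ l) = fps_const (real l) * ?e * (?e - 1) ^ (l - 1)"
    by (simp add: fps_deriv_power mult_ac)
  have "fps_deriv (mult_fps l * ?e) = fps_const (1 / fact l) *
    (G * (?e - 1) * (?e - 1) ^ l * ?e + G * (fps_const (real l) * ?e * (?e - 1) ^ (l - 1)) * ?e + G * (?e - 1) ^ l * ?e)"
    unfolding mult_fps_def G_def[symmetric] by (simp add: G U algebra_simps)
  also have "\<dots> = ?e * (fps_const (1 / fact l) * G * (?e - 1) ^ l * ?e)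
    + ?e * (fps_const (1 / fact l) * fps_const (real l) * G * (?e - 1) ^ (l - 1) * ?e)"
    by (simp add: algebra_simps)
  also have "fps_const (1 / fact l) * fps_const (real l) * G * (?e - 1) ^ (l - 1) * ?e
    = (if l = 0 then 0 else mult_fps (l - 1) * ?e)"
  proof (cases l)
    case (Suc m)
    have "fps_const (1 / fact l) * fps_const (real l) = (fps_const (1 / fact m) :: real fps)"
      using Suc by simp
    then show ?thesis using Suc by (simp add: mult_fps_def G_def)
  qed simp
  finally show ?thesis by (simp add: mult_fps_def G_def distrib_left)
qed

text \<open>Binomial convolution, used with \<open>c = 1\<close> for the recursion of the moments
  and with \<open>c = -1\<close> for the passage from \<open>fix\<close> to
  \<open>fix - 1\<close>.\<close>

lemma fps_exp_mult_nth:
  "fact j * fps_nth (fps_exp c * A) j = (\<Sum>i\<le>j. real (j choose i) * c ^ (j - i) * (fact i * fps_nth A i))"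
proof -
  have "fact j * fps_nth (fps_exp c * A) j = (\<Sum>i\<le>j. fact j * (c ^ (j - i) / fact (j - i) * fps_nth A i))"
    unfolding mult.commute[of "fps_exp c"] fps_mult_nth sum_distrib_left atLeast0AtMost
    by (intro sum.cong refl) simp
  also have "\<dots> = (\<Sum>i\<le>j. real (j choose i) * c ^ (j - i) * (fact i * fps_nth A i))"
  proof (rule sum.cong[OF refl])
    fix i assume "i \<in> {..j}"
    then have "real (j choose i) = fact j / (fact i * fact (j - i))" by (simp add: binomial_fact)
    then show "fact j * (c ^ (j - i) / fact (j - i) * fps_nth A i)
      = real (j choose i) * c ^ (j - i) * (fact i * fps_nth A i)" by (simp add: field_simps)
  qed
  finally show ?thesis .
qed

lemma moment_Suc:
  "moment (Suc j) l = (\<Sum>i\<le>j. real (j choose i) * (moment i l + (if l = 0 then 0 else moment i (l - 1))))"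
proof -
  have "moment (Suc j) l = fact j * fps_nth (fps_deriv (mult_fps l * fps_exp 1)) j"
    unfolding moment_def fps_deriv_nth Suc_eq_plus1[symmetric] fact_Suc by (simp only: mult_ac)
  also have "\<dots> = (\<Sum>i\<le>j. real (j choose i) * (moment i l + (if l = 0 then 0 else moment i (l - 1))))"
    unfolding fps_deriv_mult_fps fps_exp_mult_nth by (simp add: moment_def distrib_left)
  finally show ?thesis .
qed

text \<open>\<open>e^x - 1\<close> has no constant term, so its \<open>l\<close>-th power starts in
  degree \<open>l\<close>. The free factor \<open>A\<close> covers the series both with and without
  \<open>e^x\<close>.\<close>

lemma mult_fps_nth_eq_0:
  assumes "k < l"
  shows "fps_nth (mult_fps l * A) k = 0"
proof -
  have z: "fps_nth ((fps_exp 1 - 1 :: real fps) ^ l) i = 0" if "i < l" for i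
    using that by (intro startsby_zero_power_prefix[rule_format]) simp_all
  define B where "B = fps_const (1 / fact l) * fps_compose (fps_exp 1) (fps_exp 1 - fps_X - 1) * A"
  have eq: "mult_fps l * A = (fps_exp 1 - 1) ^ l * B"
    by (simp only: mult_fps_def B_def mult_ac)
  show ?thesis unfolding eq fps_mult_nth using assms by (intro sum.neutral ballI) (simp add: z)
qed

lemma moment_eq_0: "j < l \<Longrightarrow> moment j l = 0"
  by (simp add: moment_def mult_fps_nth_eq_0)

lemma moment_0: "moment 0 l = (if l = 0 then 1 else 0)"
  by (simp add: moment_def mult_fps_def fps_mult_nth_0 fps_compose_nth_0 power_0_left)

text \<open>One factor \<open>num_fixpoints\<close> restricts to degree \<open>N - 1\<close>, where
  the other \<open>j - 1\<close> factors become \<open>num_fixpoints + 1\<close> and expand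
  binomially into exponents \<open>i \<le> j - 1\<close>. First parts do not grow under passage to
  lower covers, so the bound on \<open>j\<close> is inherited and the recursion is that of
  \<open>moment_Suc\<close>.\<close>

lemma char_inner_num_fixpoints_power:
  assumes "xs \<in> int_partitions l" "l + first_part xs \<le> N" "j + first_part xs \<le> N"
  shows "char_inner N (\<lambda>\<sigma>. num_fixpoints N \<sigma> ^ j) (specht_char (add_row (N - l) xs))
    = real (num_standard_tableaux xs) * moment j l"
  using assms
proof (induction j arbitrary: N l xs rule: less_induct)
  case (less j)
  note xs = less.prems(1) and le = less.prems(2,3)
  have la: "add_row (N - l) xs \<in> int_partitions N" by (rule add_row_int_partitions[OF xs le(1)])
  show ?case
  proof (cases j)
    case 0
    have r: "add_row N [] \<in> int_partitions N"
      using add_row_int_partitions[of "[]" 0 N] by (simp add: int_partitions_0 first_part_def)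
    have "char_inner N (\<lambda>\<sigma>. num_fixpoints N \<sigma> ^ j) (specht_char (add_row (N - l) xs))
      = char_inner N (specht_char (add_row N [])) (specht_char (add_row (N - l) xs))"
      by (rule char_inner_cong) (simp add: 0 specht_char_row)
    also have "\<dots> = (if add_row N [] = add_row (N - l) xs then 1 else 0)"
      by (rule char_inner_specht[OF r la])
    also have "add_row N [] = add_row (N - l) xs \<longleftrightarrow> l = 0"
    proof
      assume "l = 0"
      then show "add_row N [] = add_row (N - l) xs" using xs int_partitions_0 by simp
    next
      assume eq: "add_row N [] = add_row (N - l) xs"
      show "l = 0"
      proof (cases "N - l = 0")
        case True
        then have "first_part xs = 0" using le(1) by simp
        then have "xs = []" using xs by (cases xs) (auto simp: first_part_def int_partitions_def)
        then show ?thesis using xs by (simp add: int_partitions_def)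
      next
        case False
        then show ?thesis using eq xs by (auto simp: add_row_def int_partitions_def split: if_splits)
      qed
    qed
    finally show ?thesis
      using xs by (auto simp: 0 moment_0 int_partitions_0 num_standard_tableaux_Nil)
  next
    case (Suc j')
    show ?thesis
    proof (cases N)
      case N0: 0
      then have "l = 0" "Suc j' \<le> 0" using le Suc by auto
      then show ?thesis by simp
    next
      case N: (Suc n)
      let ?f = "\<lambda>xs. real (num_standard_tableaux xs)"
      let ?W = "\<lambda>i \<mu>. char_inner n (\<lambda>\<sigma>. num_fixpoints n \<sigma> ^ i) (specht_char \<mu>)"
      let ?S = "\<lambda>\<mu>. \<Sum>i\<le>j'. real (j' choose i) * ?W i \<mu>"
      have inner: "char_inner n (\<lambda>\<sigma>. num_fixpoints N \<sigma> ^ j') (specht_char \<mu>) = ?S \<mu>" for \<mu>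
      proof -
        have "char_inner n (\<lambda>\<sigma>. num_fixpoints N \<sigma> ^ j') (specht_char \<mu>)
          = char_inner n (\<lambda>\<sigma>. \<Sum>i\<le>j'. real (j' choose i) * num_fixpoints n \<sigma> ^ i) (specht_char \<mu>)"
          by (rule char_inner_cong) (simp add: N num_fixpoints_Suc binomial_ring)
        also have "\<dots> = ?S \<mu>"
          unfolding char_inner_sum_left
          by (intro sum.cong refl) (simp add: char_inner_def sum_distrib_left mult.assoc)
        finally show ?thesis .
      qed
      have "char_inner N (\<lambda>\<sigma>. num_fixpoints N \<sigma> ^ j) (specht_char (add_row (N - l) xs))
        = char_inner (Suc n) (\<lambda>\<sigma>. num_fixpoints (Suc n) \<sigma> * num_fixpoints (Suc n) \<sigma> ^ j') (specht_char (add_row (N - l) xs))"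
        by (simp add: Suc N)
      also have "\<dots> = (\<Sum>\<mu>\<in>lower_covers n (add_row (N - l) xs). ?S \<mu>)"
        unfolding inner[symmetric] N using la[unfolded N]
        by (intro char_inner_num_fixpoints class_function_power class_function_num_fixpoints)
      also have "\<dots> = (\<Sum>\<mu>\<in>(if l + first_part xs \<le> n then {add_row (n - l) xs} else {}). ?S \<mu>)
        + (\<Sum>\<mu>\<in>(if l = 0 then {} else add_row (Suc n - l) ` lower_covers (l - 1) xs). ?S \<mu>)"
        unfolding N
      proof (subst lower_add_row[OF xs le(1)[unfolded N]], rule sum.union_disjoint)
        show "(if l + first_part xs \<le> n then {add_row (n - l) xs} else {})
          \<inter> (if l = 0 then {} else add_row (Suc n - l) ` lower_covers (l - 1) xs) = {}"
        proof -
          have False if "l \<noteq> 0" "\<nu> \<in> lower_covers (l - 1) xs" "l + first_part xs \<le> n"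
            "add_row (n - l) xs = add_row (Suc n - l) \<nu>" for \<nu>
          proof -
            have "Suc n - l \<noteq> 0" using that by simp
            then have "add_row (Suc n - l) \<nu> = (Suc n - l) # \<nu>" by (simp add: add_row_def)
            then have eq: "add_row (n - l) xs = (Suc n - l) # \<nu>" using that by simp
            show False
            proof (cases "n - l = 0")
              case True
              then have "first_part xs = 0" using that(3) by simp
              then have "xs = []" using xs by (cases xs) (auto simp: first_part_def int_partitions_def)
              then show False using eq True by (simp add: add_row_def)
            next
              case False
              then have "n - l = Suc n - l" using eq by (simp add: add_row_def)
              then show False using False by arith
            qed
          qed
          then show ?thesis by (auto split: if_splits)
        qed
      qed auto
      also have "(\<Sum>\<mu>\<in>(if l + first_part xs \<le> n then {add_row (n - l) xs} else {}). ?S \<mu>)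
        = ?f xs * (\<Sum>i\<le>j'. real (j' choose i) * moment i l)"
      proof (cases "l + first_part xs \<le> n")
        case True
        have "?S (add_row (n - l) xs) = (\<Sum>i\<le>j'. real (j' choose i) * (?f xs * moment i l))"
          using True le(2) Suc N
          by (intro sum.cong refl arg_cong2[where f = "(*)"] less.IH xs) auto
        then show ?thesis using True by (simp add: sum_distrib_left mult_ac)
      next
        case False
        \<comment> \<open>The first row cannot be shortened here, so the cover is absent. The bound
          on \<open>j\<close> then puts all exponents below \<open>l\<close>, where the moments in
          its term are zero.\<close>
        then have "j' < l" using le(2) Suc N by simp
        then have "(\<Sum>i\<le>j'. real (j' choose i) * moment i l) = 0"
          by (intro sum.neutral) (simp add: moment_eq_0)
        then show ?thesis using False by simp
      qed
      also have "(\<Sum>\<mu>\<in>(if l = 0 then {} else add_row (Suc n - l) ` lower_covers (l - 1) xs). ?S \<mu>)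
        = ?f xs * (\<Sum>i\<le>j'. real (j' choose i) * (if l = 0 then 0 else moment i (l - 1)))"
      proof (cases "l = 0")
        case False
        then obtain l' where l': "l = Suc l'" by (cases l) auto
        have inj: "inj_on (add_row (Suc n - l)) (lower_covers l' xs)"
          unfolding inj_on_def
        proof (intro ballI impI)
          fix \<mu> \<nu> assume m: "\<mu> \<in> lower_covers l' xs" "\<nu> \<in> lower_covers l' xs"
            and eq: "add_row (Suc n - l) \<mu> = add_row (Suc n - l) \<nu>"
          show "\<mu> = \<nu>" using eq by (cases "Suc n - l = 0") (simp_all add: add_row_def)
        qed
        have "(\<Sum>\<mu>\<in>add_row (Suc n - l) ` lower_covers l' xs. ?S \<mu>) = (\<Sum>\<nu>\<in>lower_covers l' xs. ?S (add_row (n - l') \<nu>))"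
          by (subst sum.reindex[OF inj]) (simp add: l')
        also have "\<dots> = (\<Sum>\<nu>\<in>lower_covers l' xs. \<Sum>i\<le>j'. real (j' choose i) * (?f \<nu> * moment i l'))"
        proof (rule sum.cong[OF refl], rule sum.cong[OF refl], rule arg_cong2[where f = "(*)", OF refl])
          fix \<nu> i assume v: "\<nu> \<in> lower_covers l' xs" and i: "i \<in> {..j'}"
          have vp: "\<nu> \<in> int_partitions l'" and fp: "first_part \<nu> \<le> first_part xs"
            using v first_part_mono by (auto simp: lower_covers_def)
          show "?W i (add_row (n - l') \<nu>) = ?f \<nu> * moment i l'"
            using fp i le Suc N l' by (intro less.IH vp) auto
        qed
        also have "\<dots> = (\<Sum>\<nu>\<in>lower_covers l' xs. ?f \<nu>) * (\<Sum>i\<le>j'. real (j' choose i) * moment i l')"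
          unfolding sum_product by (intro sum.cong refl) simp
        also have "(\<Sum>\<nu>\<in>lower_covers l' xs. ?f \<nu>) = ?f xs"
          using num_standard_tableaux_rec[of xs l'] xs l' by simp
        finally show ?thesis using l' by simp
      qed simp
      also have "?f xs * (\<Sum>i\<le>j'. real (j' choose i) * moment i l)
        + ?f xs * (\<Sum>i\<le>j'. real (j' choose i) * (if l = 0 then 0 else moment i (l - 1)))
        = ?f xs * moment j l"
        unfolding Suc moment_Suc distrib_left[symmetric] sum.distrib[symmetric] by (rule refl)
      finally show ?thesis .
    qed
  qed
qed

theorem corollary1:
  fixes l :: nat and lb :: "nat list" and n :: "nat \<Rightarrow> nat"
  assumes "0 < l"
    and "lb \<in> int_partitions l"
    and "\<And>k. l \<le> k \<Longrightarrow> k + hd lb \<le> n k"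
  shows "Abs_fps (\<lambda>k. if l \<le> k
             then real (multiplicity_in (n k) ((n k - l) # lb)
                          (kronecker_power (irr_char [n k - 1, 1]) k)) / fact k
             else 0)
         = fps_const (real (num_standard_tableaux lb) / fact l)
             * fps_compose (fps_exp 1) (fps_exp 1 - fps_X - 1)
             * (fps_exp 1 - 1) ^ l"
proof (rule fps_ext)
  fix k
  let ?f = "real (num_standard_tableaux lb)"
  have "fps_const (?f / fact l) = fps_const ?f * fps_const (1 / fact l)" by simp
  then have rhs: "fps_const (?f / fact l) * fps_compose (fps_exp 1) (fps_exp 1 - fps_X - 1) * (fps_exp 1 - 1) ^ l
    = fps_const ?f * mult_fps l"
    by (simp only: mult_fps_def mult.assoc)
  have ne: "lb \<noteq> []" using assms(1,2) by (auto simp: int_partitions_def)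
  then have hd: "hd lb > 0" "first_part lb = hd lb"
    using assms(2) by (cases lb; simp add: int_partitions_def first_part_def)+
  show "fps_nth (Abs_fps (\<lambda>k. if l \<le> k then real (multiplicity_in (n k) ((n k - l) # lb)
      (kronecker_power (irr_char [n k - 1, 1]) k)) / fact k else 0)) k
    = fps_nth (fps_const (?f / fact l) * fps_compose (fps_exp 1) (fps_exp 1 - fps_X - 1) * (fps_exp 1 - 1) ^ l) k"
  proof (cases "l \<le> k")
    case False
    then show ?thesis unfolding rhs using mult_fps_nth_eq_0[of k l 1] by simp
  next
    case True
    define N where "N = n k"
    have N: "k + first_part lb \<le> N" using assms(3)[OF True] hd by (simp add: N_def)
    \<comment> \<open>Both \<open>k \<ge> l > 0\<close> and a positive first part enter: they give
      \<open>N \<ge> 2\<close> and a nonempty first row.\<close>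
    then have N2: "N \<ge> 2" "l + first_part lb \<le> N" "N - l \<noteq> 0" using True hd assms(1) by simp_all
    have row: "add_row (N - l) lb = (N - l) # lb" using N2 by (simp add: add_row_def)
    have la: "(N - l) # lb \<in> int_partitions N"
      using add_row_int_partitions[OF assms(2) N2(2)] unfolding row .
    have "real (multiplicity_in N ((N - l) # lb) (kronecker_power (irr_char [N - 1, 1]) k))
      = char_inner N (\<lambda>\<sigma>. (num_fixpoints N \<sigma> - 1) ^ k) (specht_char (add_row (N - l) lb))"
      unfolding row by (rule multiplicity_in_eq[OF N2(1) la])
    also have "\<dots> = char_inner N (\<lambda>\<sigma>. \<Sum>i\<le>k. real (k choose i) * (- 1) ^ (k - i) * num_fixpoints N \<sigma> ^ i)
        (specht_char (add_row (N - l) lb))"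
    proof (rule char_inner_cong)
      fix \<sigma>
      have "(num_fixpoints N \<sigma> - 1) ^ k = (\<Sum>i\<le>k. real (k choose i) * (- 1) ^ (k - i) * num_fixpoints N \<sigma> ^ i)"
        using binomial_ring[of "num_fixpoints N \<sigma>" "-1" k] by (simp add: mult_ac)
      then show "(num_fixpoints N \<sigma> - 1) ^ k * specht_char (add_row (N - l) lb) \<sigma>
        = (\<Sum>i\<le>k. real (k choose i) * (- 1) ^ (k - i) * num_fixpoints N \<sigma> ^ i) * specht_char (add_row (N - l) lb) \<sigma>"
        by simp
    qed
    also have "\<dots> = (\<Sum>i\<le>k. real (k choose i) * (- 1) ^ (k - i) *
        char_inner N (\<lambda>\<sigma>. num_fixpoints N \<sigma> ^ i) (specht_char (add_row (N - l) lb)))"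
      unfolding char_inner_sum_left
      by (intro sum.cong refl) (simp add: char_inner_def sum_distrib_left mult.assoc)
    also have "\<dots> = (\<Sum>i\<le>k. real (k choose i) * (- 1) ^ (k - i) * (?f * moment i l))"
    proof (rule sum.cong[OF refl])
      \<comment> \<open>The assumption on \<open>n k\<close> for the exponent \<open>k\<close>
        covers every smaller exponent of the binomial expansion.\<close>
      fix i assume "i \<in> {..k}"
      then have "i + first_part lb \<le> N" using N by simp
      then show "real (k choose i) * (- 1) ^ (k - i) *
          char_inner N (\<lambda>\<sigma>. num_fixpoints N \<sigma> ^ i) (specht_char (add_row (N - l) lb))
        = real (k choose i) * (- 1) ^ (k - i) * (?f * moment i l)"
        using char_inner_num_fixpoints_power[OF assms(2) N2(2)] by simp
    qed
    also have "\<dots> = ?f * (\<Sum>i\<le>k. real (k choose i) * (- 1) ^ (k - i) * moment i l)"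
      by (simp add: sum_distrib_left mult_ac)
    \<comment> \<open>Binomial inversion: the alternating sum multiplies the series by
      \<open>e^(-x)\<close>, which cancels the factor \<open>e^x\<close> built into
      \<open>moment\<close>.\<close>
    also have "\<dots> = ?f * (fact k * fps_nth (fps_exp (-1) * (mult_fps l * fps_exp 1)) k)"
      unfolding fps_exp_mult_nth moment_def by (rule refl)
    also have "fps_exp (-1) * (mult_fps l * fps_exp 1) = mult_fps l * (fps_exp (-1 + 1))"
      unfolding fps_exp_add_mult by (simp only: mult_ac)
    finally have "real (multiplicity_in N ((N - l) # lb) (kronecker_power (irr_char [N - 1, 1]) k))
      = ?f * (fact k * fps_nth (mult_fps l) k)" by simp
    then show ?thesis unfolding rhs using True by (simp add: N_def)
  qed
qed

end
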